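(* For every integer $d\geq 3$, as $m\to\infty$, $$2^{\frac{(d-2)^2}{8d}m^2+o(m^2)}\leq g_d(m)\leq 2^{\frac{1}{2}(d-2)m^2+o(m^2)}.$$
   Context: For integers $d\geq 1$ and $m\geq 1$, $g_d(m)$ denotes the number of isomorphism classes of groups of order $2^m$ which admit a generating set consisting of $d$ involutions. *)

theory Defs
  imports
    "HOL-Algebra.Generated_Groups"
    "HOL-Algebra.Multiplicative_Group"
    "HOL-Library.Landau_Symbols"
    Complex_Main
begin

definition involution :: "('a, 'b) monoid_scheme \<Rightarrow> 'a \<Rightarrow> bool" where
  "involution G x \<longleftrightarrow> x \<in> carrier G \<and> group.ord G x = 2"

definition generated_by_involutions :: "nat \<Rightarrow> ('a, 'b) monoid_scheme \<Rightarrow> bool" where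
  "generated_by_involutions d G \<longleftrightarrow>
     (\<exists>S. finite S \<and> card S = d \<and> (\<forall>x\<in>S. involution G x) \<and> generate G S = carrier G)"

(* The carriers are finite sets of natural numbers. This loses no isomorphism class, since every
   finite group, over any type, is isomorphic to such a group (finite_group_iso_table below). *)
definition involution_groups :: "nat \<Rightarrow> nat \<Rightarrow> nat monoid set" where
  "involution_groups d m = {G. group G \<and> order G = 2 ^ m \<and> generated_by_involutions d G}"

definition group_iso_rel :: "'a monoid set \<Rightarrow> ('a monoid \<times> 'a monoid) set" where
  "group_iso_rel A = {(G, H). G \<in> A \<and> H \<in> A \<and> G \<cong> H}"

(* The set of classes is finite (finite_involution_group_classes below), so card really counts. *)
definition num_involution_groups :: "nat \<Rightarrow> nat \<Rightarrow> nat" where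
  "num_involution_groups d m =
     card (involution_groups d m // group_iso_rel (involution_groups d m))"

lemma equiv_group_iso_rel:
  assumes "\<And>G. G \<in> A \<Longrightarrow> group G"
  shows "equiv A (group_iso_rel A)"
proof (rule equivI)
  show "group_iso_rel A \<subseteq> A \<times> A" by (auto simp: group_iso_rel_def)
  show "refl_on A (group_iso_rel A)" by (auto simp: refl_on_def group_iso_rel_def)
  show "sym (group_iso_rel A)"
    using assms by (auto simp: sym_def group_iso_rel_def intro: group.iso_sym)
  show "trans (group_iso_rel A)"
    unfolding trans_def group_iso_rel_def by (blast intro: iso_trans)
qed

definition table_monoid :: "nat \<Rightarrow> (nat \<times> nat \<Rightarrow> nat) \<Rightarrow> nat \<Rightarrow> nat monoid" where
  "table_monoid n f e = \<lparr>carrier = {..<n}, monoid.mult = (\<lambda>x y. f (x, y)), monoid.one = e\<rparr>"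

lemma finite_group_iso_table:
  assumes "group G" "finite (carrier G)"
  obtains f e where "f \<in> {..<order G} \<times> {..<order G} \<rightarrow>\<^sub>E {..<order G}" "e < order G"
    "G \<cong> table_monoid (order G) f e" "group (table_monoid (order G) f e)"
proof -
  interpret group G by fact
  define n where "n = order G"
  obtain h where h: "bij_betw h (carrier G) {..<n}"
    using assms(2) ex_bij_betw_finite_nat[of "carrier G"]
    by (auto simp: n_def order_def atLeast0LessThan)
  define k where "k = the_inv_into (carrier G) h"
  have inj: "inj_on h (carrier G)" using h by (simp add: bij_betw_def)
  have k: "k (h x) = x" if "x \<in> carrier G" for x
    using that inj by (simp add: k_def the_inv_into_f_f)
  have hk: "h x < n" if "x \<in> carrier G" for x using h that by (auto simp: bij_betw_def)
  have kc: "k y \<in> carrier G" if "y < n" for y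
    using that h k by (metis bij_betw_def imageE lessThan_iff)
  define f where "f = (\<lambda>p\<in>{..<n} \<times> {..<n}. h (k (fst p) \<otimes>\<^bsub>G\<^esub> k (snd p)))"
  let ?T = "table_monoid n f (h \<one>\<^bsub>G\<^esub>)"
  have f: "f \<in> {..<n} \<times> {..<n} \<rightarrow>\<^sub>E {..<n}" using hk kc by (auto simp: f_def)
  have iso: "h \<in> iso G ?T"
    using h hk k by (auto simp: iso_def hom_def table_monoid_def f_def)
  have "group (?T\<lparr>monoid.one := h \<one>\<^bsub>G\<^esub>\<rparr>)" by (rule iso_imp_img_group[OF iso])
  hence "group ?T" by (simp add: table_monoid_def)
  thus ?thesis using that f hk iso unfolding n_def by (metis is_isoI one_closed)
qed

lemma finite_involution_group_classes:
  "finite (involution_groups d m // group_iso_rel (involution_groups d m))"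
proof -
  let ?A = "involution_groups d m" and ?n = "2 ^ m :: nat"
  let ?R = "{(G, H). H \<in> ?A \<and> G \<cong> H}" and ?F = "({..<?n} \<times> {..<?n} \<rightarrow>\<^sub>E {..<?n}) \<times> {..<?n}"
  have "?A // group_iso_rel ?A \<subseteq> (\<lambda>(f, e). ?R `` {table_monoid ?n f e}) ` ?F"
  proof
    fix X assume "X \<in> ?A // group_iso_rel ?A"
    then obtain G where G: "G \<in> ?A" "X = group_iso_rel ?A `` {G}" by (auto elim: quotientE)
    hence g: "group G" and o: "order G = ?n" by (auto simp: involution_groups_def)
    hence "finite (carrier G)" by (simp add: order_def card_ge_0_finite)
    then obtain f e where fe: "f \<in> {..<?n} \<times> {..<?n} \<rightarrow>\<^sub>E {..<?n}" "e < ?n"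
      and i: "G \<cong> table_monoid ?n f e"
      using finite_group_iso_table[OF g, unfolded o] by blast
    have "table_monoid ?n f e \<cong> H \<longleftrightarrow> G \<cong> H" for H :: "nat monoid"
      using iso_trans[OF i] iso_trans[OF group.iso_sym[OF g i]] by blast
    hence "X = ?R `` {table_monoid ?n f e}" using G by (simp add: group_iso_rel_def Image_def)
    moreover have "(f, e) \<in> ?F" using fe by blast
    ultimately show "X \<in> (\<lambda>(f, e). ?R `` {table_monoid ?n f e}) ` ?F"
      by (intro image_eqI[where x = "(f, e)"]) simp_all
  qed
  moreover have "finite ?F" by (intro finite_cartesian_product finite_PiE) auto
  ultimately show ?thesis using finite_surj by blast
qed

end

theory Submission
  imports Defs
    "HOL-Algebra.Group_Action" "HOL-Algebra.SndIsomorphismGrp" "HOL-Algebra.Product_Groups"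
    "HOL-Computational_Algebra.Primes" "HOL-Computational_Algebra.Formal_Power_Series"
    "HOL-Library.Z2" "HOL-Real_Asymp.Real_Asymp"
begin

text \<open>
  Upper bound. All the groups in question are quotients of one finite 2-group generated by \<open>d\<close>
  involutions, a subgroup of the product of representatives of the isomorphism classes. Its even
  part \<open>F\<close> has index at most 2 and is generated by \<open>d - 1\<close> elements, and a quotient is determined up
  to isomorphism by its kernel in \<open>F\<close>, so it suffices to count normal subgroups of \<open>F\<close>. A normal
  subgroup of index \<open>2^(k+1)\<close> has index 2 in one of index \<open>2^k\<close>, and the number of choices is bounded
  by the order of a central elementary abelian subgroup \<open>A\<close> in a group \<open>E\<close> with \<open>|E/A| = 2^k\<close> and
  \<open>d - 1\<close> generators. As commuting with a fixed generator does not see \<open>A\<close>, climbing a central series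
  bounds \<open>E'\<close> and with it \<open>A\<close>: \<open>|A| \<le> 2^((d-2)k + d-1)\<close>. Summing over \<open>k\<close> gives the exponent
  \<open>(d-2)m^2/2\<close>.

  Lower bound. With \<open>e = d - 2\<close> and \<open>K = F_2[T]/(T^j)\<close>, a dihedral 2-group of order \<open>O(j)\<close> acts on a
  class-2 group with quotient \<open>K^e \<times> K^e\<close> and central commutators in \<open>K^(e^2)\<close>, trivially on the
  latter. The semidirect product is generated by \<open>d\<close> involutions and has a central elementary
  abelian subgroup of rank \<open>r = e^2 j\<close> with quotient of order \<open>2^(2ej + O(log j))\<close>. It has at least
  \<open>2^(v(r-v))\<close> central quotients in which the rank drops to \<open>v\<close>, and at most \<open>2^(dm)\<close> of them are
  isomorphic to a given group of order \<open>2^m\<close>. Optimising \<open>j\<close> for fixed \<open>m\<close> yields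
  \<open>(d-2)^2 m^2/(8d)\<close>.
\<close>

section \<open>Central steps in finite 2-groups\<close>

text \<open>The exponent d - 2 comes from saving a generator twice: even words in d involutions need
  only d - 1 generators, and a generator commutes with itself, which saves one more when commutators
  are counted. The subgroup of a finite product stands in for the free product of d copies of the
  group of order 2, so that every argument stays inside finite 2-groups.

  For the lower bound the number of generators is fixed while the rank must grow linearly in m. The
  dihedral group achieves this cheaply: modulo \<open>T^j\<close> the unit \<open>1 + T\<close> has
  order dividing 2^q once 2^q is at least j, so it costs only O(log m) in the exponent, yet the
  multiples of one vector by powers of \<open>1 + T\<close> span a space of dimension j. The
  commutators must be fixed by the action for every subspace of their span to be normal; this is the
  reason for the second copy of \<open>K^e\<close>, on which \<open>1 + T\<close> acts inversely,
  and for the ring automorphism that inverts \<open>1 + T\<close>.\<close>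

abbreviation (in group) comm :: "'a \<Rightarrow> 'a \<Rightarrow> 'a" where
  "comm a b \<equiv> a \<otimes> b \<otimes> inv a \<otimes> inv b"

text \<open>Class equation: if conjugation fixed no element of \<open>H - {\<one>}\<close>, all
  orbits there would have even size, although \<open>card H\<close> is even as well. A suitable
  power of a fixed point then has order 2.\<close>

lemma (in group) two_group_center:
  assumes ord: "order G = 2 ^ n" and H: "H \<lhd> G" and nt: "H \<noteq> {\<one>}"
  obtains z where "z \<in> H" "z \<noteq> \<one>" "z \<otimes> z = \<one>" "\<And>g. g \<in> carrier G \<Longrightarrow> z \<otimes> g = g \<otimes> z"
proof -
  have fin: "finite (carrier G)" using ord order_gt_0_iff_finite by simp
  have sub: "subgroup H G" using H by (simp add: normal_imp_subgroup)
  interpret H: subgroup H G by fact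
  have finH: "finite H" using fin H.subset finite_subset by blast
  define \<phi> where "\<phi> = (\<lambda>g. \<lambda>h\<in>carrier G. g \<otimes> h \<otimes> inv g)"
  interpret A: group_action G "carrier G" \<phi> unfolding \<phi>_def by (rule action_by_conjugation)
  have orb: "orbit G \<phi> x = (\<lambda>g. g \<otimes> x \<otimes> inv g) ` carrier G" if "x \<in> carrier G" for x
    using that by (auto simp: orbit_def \<phi>_def)
  have orbH: "orbit G \<phi> x \<subseteq> H" if "x \<in> H" for x
    using that H H.subset by (auto simp: orb normal_inv_iff)
  have "\<exists>z\<in>H - {\<one>}. orbit G \<phi> z = {z}"
  proof (rule ccontr)
    assume no: "\<not> ?thesis"
    let ?C = "orbit G \<phi> ` (H - {\<one>})"
    have one: "orbit G \<phi> \<one> = {\<one>}" by (auto simp: orb)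
    have U: "\<Union>?C = H - {\<one>}"
    proof
      show "\<Union>?C \<subseteq> H - {\<one>}"
      proof
        fix y assume "y \<in> \<Union>?C"
        then obtain x where x: "x \<in> H" "x \<noteq> \<one>" "y \<in> orbit G \<phi> x" by auto
        have "y \<in> H" using x orbH by blast
        moreover have "y \<noteq> \<one>"
          using A.orbit_sym[of x y] x H.subset one \<open>y \<in> H\<close> by auto
        ultimately show "y \<in> H - {\<one>}" by simp
      qed
      show "H - {\<one>} \<subseteq> \<Union>?C" using A.orbit_refl H.subset by blast
    qed
    have ev: "even (card c)" if "c \<in> ?C" for c
    proof -
      from that obtain x where x: "x \<in> H - {\<one>}" "c = orbit G \<phi> x" by (elim imageE)
      have xc: "x \<in> carrier G" using x H.subset by blast
      have "card c dvd 2 ^ n" using A.orbit_stabilizer_theorem[OF xc] ord x(2)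
        by (metis dvd_triv_left)
      then obtain i where i: "card c = 2 ^ i" using divides_primepow_nat[of "2::nat" "card c" n]
        by auto
      have "i \<noteq> 0"
      proof
        assume "i = 0"
        hence "card c = 1" using i by simp
        then obtain y where "c = {y}" using card_1_singletonE by blast
        hence "c = {x}" using A.orbit_refl[OF xc] x(2) by auto
        thus False using no x by auto
      qed
      thus ?thesis using i by simp
    qed
    have dis: "c1 \<inter> c2 = {}" if "c1 \<in> ?C" "c2 \<in> ?C" "c1 \<noteq> c2" for c1 c2
    proof (rule ccontr)
      assume "c1 \<inter> c2 \<noteq> {}"
      then obtain y where y: "y \<in> c1" "y \<in> c2" by auto
      from that(1) obtain x1 where x1: "x1 \<in> H - {\<one>}" "c1 = orbit G \<phi> x1" by (elim imageE)
      from that(2) obtain x2 where x2: "x2 \<in> H - {\<one>}" "c2 = orbit G \<phi> x2" by (elim imageE)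
      have xc: "x1 \<in> carrier G" "x2 \<in> carrier G" using x1 x2 H.subset by blast+
      have y': "y \<in> orbit G \<phi> x1" "y \<in> orbit G \<phi> x2" using y x1 x2 by simp_all
      have yc: "y \<in> carrier G" using y'(1) xc(1) unfolding orb[OF xc(1)] by auto
      have same: "orbit G \<phi> a = orbit G \<phi> y" if a: "a \<in> carrier G" "y \<in> orbit G \<phi> a" for a
      proof -
        have ay: "a \<in> orbit G \<phi> y" using A.orbit_sym a yc by auto
        have sub: "b \<in> carrier G" if "b \<in> orbit G \<phi> c" "c \<in> carrier G" for b c
          using that by (auto simp: orb)
        show ?thesis
          using A.orbit_trans[OF yc a(1)] A.orbit_trans[OF a(1) yc] sub ay a yc
          by (intro subset_antisym subsetI) blast+
      qed
      have "c1 = c2" unfolding x1 x2 using same[OF xc(1) y'(1)] same[OF xc(2) y'(2)] by simp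
      thus False using that by simp
    qed
    have "2 dvd card (\<Union>?C)"
    proof (rule dvd_partition)
      show "finite (\<Union>?C)" unfolding U using finH by simp
      show "\<forall>c\<in>?C. 2 dvd card c" by (intro ballI ev)
      show "\<forall>c1\<in>?C. \<forall>c2\<in>?C. c1 \<noteq> c2 \<longrightarrow> c1 \<inter> c2 = {}" by (intro ballI impI dis)
    qed
    hence "even (card (H - {\<one>}))" using U by simp
    moreover have "card H = card (H - {\<one>}) + 1"
      using card.remove[OF finH H.one_closed] by presburger
    moreover have "even (card H)"
    proof -
      have "card H dvd 2 ^ n" using lagrange[OF sub] ord by (metis dvd_triv_right)
      then obtain i where i: "card H = 2 ^ i" using divides_primepow_nat[of "2::nat" "card H" n]
        by auto
      have "i \<noteq> 0"
      proof
        assume "i = 0"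
        then obtain y where "H = {y}" using i card_1_singletonE by auto
        thus False using nt H.one_closed by auto
      qed
      thus ?thesis using i by simp
    qed
    ultimately show False by presburger
  qed
  then obtain z where z: "z \<in> H" "z \<noteq> \<one>" "orbit G \<phi> z = {z}" by blast
  have zc: "z \<in> carrier G" using z H.subset by blast
  have cen: "z \<otimes> g = g \<otimes> z" if g: "g \<in> carrier G" for g
  proof -
    have "g \<otimes> z \<otimes> inv g = z" using z(3) orb[OF zc] g by auto
    thus ?thesis using g zc by (metis inv_solve_right m_closed)
  qed
  \<comment> \<open>Among the iterated squares of \<open>z\<close>, the last nontrivial one squares
    to \<open>\<one>\<close>; as a power of \<open>z\<close> it is still central and in
    \<open>H\<close>.\<close>
  have ex: "\<exists>i. z [^] ((2::nat) ^ i) = \<one>" using pow_order_eq_1[OF zc] ord by auto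
  define i where "i = (LEAST i. z [^] ((2::nat) ^ i) = \<one>)"
  have i: "z [^] ((2::nat) ^ i) = \<one>" unfolding i_def using ex by (rule LeastI_ex)
  have "i \<noteq> 0" using i z zc by (metis nat_pow_eone power_0)
  then obtain j where j: "i = Suc j" by (cases i) auto
  define w where "w = z [^] ((2::nat) ^ j)"
  have w1: "w \<noteq> \<one>" using not_less_Least[of j "\<lambda>i. z [^] ((2::nat) ^ i) = \<one>"] j unfolding w_def i_def
    by auto
  have "z [^] k \<in> H" for k :: nat using z by (induction k) auto
  hence wH: "w \<in> H" by (simp add: w_def)
  have "w \<otimes> w = z [^] ((2::nat) ^ j + 2 ^ j)" unfolding w_def using zc by (simp add: nat_pow_mult)
  also have "\<dots> = \<one>" using i j by (simp add: mult_2)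
  finally have ww: "w \<otimes> w = \<one>" .
  have "w \<otimes> g = g \<otimes> w" if g: "g \<in> carrier G" for g
  proof -
    have "z [^] m \<otimes> g = g \<otimes> z [^] m" for m :: nat
    proof (induction m)
      case (Suc m)
      thus ?case using g zc cen by (metis m_assoc nat_pow_Suc nat_pow_closed)
    qed (use g in simp)
    thus ?thesis unfolding w_def by simp
  qed
  thus ?thesis using that wH w1 ww by blast
qed

text \<open>The preceding lemma in \<open>G Mod N\<close>, pulled back to elements of
  \<open>G\<close>, so that a central series can be climbed without forming a new quotient at each
  step.\<close>

lemma (in group) two_group_normal_step:
  assumes ord: "order G = 2 ^ n" and N: "N \<lhd> G" and H: "H \<lhd> G" and NH: "N \<subset> H"
  obtains z where "z \<in> H" "z \<notin> N" "z \<otimes> z \<in> N" "\<And>g. g \<in> carrier G \<Longrightarrow> comm z g \<in> N"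
proof -
  interpret N: normal N G by fact
  interpret H: normal H G by fact
  interpret Q: group "G Mod N" by (rule N.factorgroup_is_group)
  interpret p: group_hom G "G Mod N" "\<lambda>a. N #> a"
    by unfold_locales (rule N.r_coset_hom_Mod)
  have im: "(\<lambda>a. N #> a) ` carrier G = carrier (G Mod N)" by (simp add: carrier_FactGroup)
  have "order (G Mod N) dvd 2 ^ n"
    using lagrange[OF N.is_subgroup] ord
      by (metis dvd_triv_left order_def FactGroup_def partial_object.simps(1))
  then obtain k where k: "order (G Mod N) = 2 ^ k" using divides_primepow_nat[of "2::nat" _ n]
    by auto
  have nH: "(\<lambda>a. N #> a) ` H \<lhd> G Mod N"
    by (rule H.surj_hom_normal_subgroup[OF p.group_hom_axioms im])
  have nt: "(\<lambda>a. N #> a) ` H \<noteq> {\<one>\<^bsub>G Mod N\<^esub>}"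
  proof
    assume eq: "(\<lambda>a. N #> a) ` H = {\<one>\<^bsub>G Mod N\<^esub>}"
    have "h \<in> N" if "h \<in> H" for h
    proof -
      have "N #> h = N" using eq that by auto
      thus ?thesis using that H.subset coset_join1 N.is_subgroup by blast
    qed
    thus False using NH by auto
  qed
  obtain Z where Z: "Z \<in> (\<lambda>a. N #> a) ` H" "Z \<noteq> \<one>\<^bsub>G Mod N\<^esub>" "Z \<otimes>\<^bsub>G Mod N\<^esub> Z = \<one>\<^bsub>G Mod N\<^esub>"
    and c: "\<And>g. g \<in> carrier (G Mod N) \<Longrightarrow> Z \<otimes>\<^bsub>G Mod N\<^esub> g = g \<otimes>\<^bsub>G Mod N\<^esub> Z"
    using Q.two_group_center[OF k nH nt] by metis
  obtain z where z: "z \<in> H" "Z = N #> z" using Z(1) by auto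
  have zc: "z \<in> carrier G" using z H.subset by blast
  have mem: "a \<otimes> inv b \<in> N" if "N #> a = N #> b" "a \<in> carrier G" "b \<in> carrier G" for a b
    using that by (metis N.rcos_module group_axioms rcos_self N.is_subgroup)
  show ?thesis
  proof
    show "z \<in> H" by fact
    show "z \<notin> N" using Z(2) z(2) zc coset_join2 N.is_subgroup by auto
    have "N #> (z \<otimes> z) = N" using Z(3)
      unfolding z(2) mult_FactGroup one_FactGroup N.rcos_sum[OF zc zc] .
    thus "z \<otimes> z \<in> N" using coset_join1 N.is_subgroup zc by blast
    fix g assume g: "g \<in> carrier G"
    have "N #> g \<in> carrier (G Mod N)" using g im by blast
    hence "N #> (z \<otimes> g) = N #> (g \<otimes> z)" using c[of "N #> g"]
      unfolding z(2) mult_FactGroup N.rcos_sum[OF zc g] N.rcos_sum[OF g zc] by blast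
    hence "z \<otimes> g \<otimes> inv (g \<otimes> z) \<in> N" using mem zc g by blast
    thus "comm z g \<in> N" using zc g by (simp add: inv_mult_group m_assoc)
  qed
qed

section \<open>Commutators modulo a central subgroup\<close>

text \<open>The ratios d'/d \<le> b/a and d/d1 \<le> a/c multiply to d'/d1 \<le> b/c. Written
  without division, this telescopes the size bounds along a central series.\<close>

lemma mult_le_chain:
  fixes a b c d d' d1 :: nat
  assumes "d' * a \<le> d * b" "d * c \<le> d1 * a" "a > 0"
  shows "d' * c \<le> d1 * b"
proof -
  have "a * (d' * c) = d' * a * c" by (simp only: mult_ac)
  also have "\<dots> \<le> d * b * c" by (rule mult_le_mono1[OF assms(1)])
  also have "\<dots> = d * c * b" by (simp only: mult_ac)
  also have "\<dots> \<le> d1 * a * b" by (rule mult_le_mono1[OF assms(2)])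
  also have "\<dots> = a * (d1 * b)" by (simp only: mult_ac)
  finally show ?thesis using assms(3) by simp
qed

context group
begin

lemma inv_cancel_left [simp]:
  assumes "x \<in> carrier G" "y \<in> carrier G"
  shows "x \<otimes> (inv x \<otimes> y) = y" "inv x \<otimes> (x \<otimes> y) = y"
  using assms by (simp_all flip: m_assoc)

text \<open>Both sets are the preimage of the centralizer of \<open>D #> z\<close> in
  \<open>G Mod D\<close>. Hence commuting modulo \<open>D\<close> has to be checked on generators
  only.\<close>

lemma subgroup_commutes_mod:
  assumes D: "D \<lhd> G" and z: "z \<in> carrier G"
  shows "subgroup {g \<in> carrier G. comm z g \<in> D} G" "subgroup {g \<in> carrier G. comm g z \<in> D} G"
proof -
  interpret D: normal D G by fact
  have conj: "x \<otimes> h \<otimes> inv x \<in> D" if "x \<in> carrier G" "h \<in> D" for x h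
    using that D.inv_op_closed2 by blast
  have flip: "comm b a \<in> D" if "comm a b \<in> D" "a \<in> carrier G" "b \<in> carrier G" for a b
  proof -
    have "inv (comm a b) = comm b a" using that by (simp add: inv_mult_group m_assoc)
    thus ?thesis using that D.m_inv_closed by metis
  qed
  show 1: "subgroup {g \<in> carrier G. comm z g \<in> D} G"
  proof (rule subgroupI)
    show "{g \<in> carrier G. comm z g \<in> D} \<noteq> {}"
      using z D.one_closed by (auto intro!: exI[of _ \<one>])
    fix a assume "a \<in> {g \<in> carrier G. comm z g \<in> D}"
    hence a: "a \<in> carrier G" "comm z a \<in> D" by auto
    have "comm z (inv a) = inv a \<otimes> inv (comm z a) \<otimes> inv (inv a)"
      using a z by (simp add: inv_mult_group m_assoc)
    also have "\<dots> \<in> D" using a z by (intro conj D.m_inv_closed) auto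
    finally show "inv a \<in> {g \<in> carrier G. comm z g \<in> D}" using a by auto
    fix b assume "b \<in> {g \<in> carrier G. comm z g \<in> D}"
    hence b: "b \<in> carrier G" "comm z b \<in> D" by auto
    have "comm z (a \<otimes> b) = comm z a \<otimes> (a \<otimes> comm z b \<otimes> inv a)"
      using a b z by (simp add: inv_mult_group m_assoc)
    also have "\<dots> \<in> D" by (rule D.m_closed[OF a(2) conj[OF a(1) b(2)]])
    finally show "a \<otimes> b \<in> {g \<in> carrier G. comm z g \<in> D}" using a b by auto
  qed auto
  have "{g \<in> carrier G. comm g z \<in> D} = {g \<in> carrier G. comm z g \<in> D}"
    using flip z by blast
  thus "subgroup {g \<in> carrier G. comm g z \<in> D} G" using 1 by simp
qed

text \<open>The union is the preimage of the subgroup generated by \<open>D #> c\<close> in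
  \<open>G Mod D\<close>, which is central of order at most 2.\<close>

lemma adjoin_central:
  assumes D: "D \<lhd> G" and c: "c \<in> carrier G" and cc: "c \<otimes> c \<in> D"
    and cg: "\<And>g. g \<in> carrier G \<Longrightarrow> comm c g \<in> D"
  shows "D \<union> (D #> c) \<lhd> G"
proof -
  interpret D: normal D G by fact
  have conj: "x \<otimes> h \<otimes> inv x \<in> D" if "x \<in> carrier G" "h \<in> D" for x h
    using that D.inv_op_closed2 by blast
  have Dc: "d \<in> carrier G" if "d \<in> D" for d using that D.subset by blast
  let ?M = "D \<union> (D #> c)"
  have M: "x \<in> ?M \<longleftrightarrow> x \<in> D \<or> (\<exists>d\<in>D. x = d \<otimes> c)" for x by (auto simp: r_coset_def)
  have Mc: "x \<in> carrier G" if "x \<in> ?M" for x using that[unfolded M] c Dc by auto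
  have DM: "d \<otimes> x \<in> ?M" if "d \<in> D" "x \<in> ?M" for d x
    using that(2)[unfolded M]
  proof
    assume "\<exists>e\<in>D. x = e \<otimes> c"
    then obtain e where "e \<in> D" "x = e \<otimes> c" by blast
    hence "d \<otimes> x = d \<otimes> e \<otimes> c" using that(1) c Dc by (simp add: m_assoc)
    thus ?thesis using \<open>e \<in> D\<close> that(1) M D.m_closed by blast
  qed (use that in simp)
  have cM: "c \<otimes> x \<in> ?M" if x: "x \<in> ?M" for x
  proof -
    from x[unfolded M] show ?thesis
    proof
      assume d: "x \<in> D"
      have "c \<otimes> x = (c \<otimes> x \<otimes> inv c) \<otimes> c" using d Dc c by (simp add: m_assoc)
      thus ?thesis using conj[OF c d] M by blast
    next
      assume "\<exists>d\<in>D. x = d \<otimes> c"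
      then obtain d where d: "d \<in> D" "x = d \<otimes> c" by auto
      have "c \<otimes> x = (c \<otimes> d \<otimes> inv c) \<otimes> (c \<otimes> c)" using d Dc c by (simp add: m_assoc)
      thus ?thesis using conj[OF c d(1)] cc D.m_closed M by metis
    qed
  qed
  have mult: "x \<otimes> y \<in> ?M" if x: "x \<in> ?M" and y: "y \<in> ?M" for x y
  proof -
    from x[unfolded M] show ?thesis
    proof
      assume "x \<in> D" thus ?thesis using DM y by blast
    next
      assume "\<exists>d\<in>D. x = d \<otimes> c"
      then obtain d where d: "d \<in> D" "x = d \<otimes> c" by auto
      have "x \<otimes> y = d \<otimes> (c \<otimes> y)" using d Dc c Mc y by (simp add: m_assoc)
      thus ?thesis using DM cM d y by metis
    qed
  qed
  have cM': "c \<in> ?M" using rcos_self[OF c D.is_subgroup] by blast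
  have "inv c = inv (c \<otimes> c) \<otimes> c" using c by (simp add: inv_mult_group m_assoc)
  hence icM: "inv c \<in> ?M" using DM[OF D.m_inv_closed[OF cc] cM'] by metis
  have "subgroup ?M G"
  proof (rule subgroupI)
    show "?M \<subseteq> carrier G" using Mc by blast
    show "?M \<noteq> {}" using cM' by blast
    fix x assume x: "x \<in> ?M"
    from x[unfolded M] show "inv x \<in> ?M"
    proof
      assume "x \<in> D" thus ?thesis by simp
    next
      assume "\<exists>d\<in>D. x = d \<otimes> c"
      then obtain d where d: "d \<in> D" "x = d \<otimes> c" by auto
      have "inv x = inv c \<otimes> inv d" using d Dc c by (simp add: inv_mult_group)
      thus ?thesis using mult[OF icM, of "inv d"] d by auto
    qed
  qed (use mult in blast)
  moreover have "g \<otimes> x \<otimes> inv g \<in> ?M" if g: "g \<in> carrier G" and x: "x \<in> ?M" for g x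
  proof -
    from x[unfolded M] show ?thesis
    proof
      assume "x \<in> D" thus ?thesis using conj g by blast
    next
      assume "\<exists>d\<in>D. x = d \<otimes> c"
      then obtain d where d: "d \<in> D" "x = d \<otimes> c" by auto
      have "g \<otimes> x \<otimes> inv g = (g \<otimes> d \<otimes> inv g) \<otimes> inv (comm c g) \<otimes> c"
        using d Dc c g by (simp add: inv_mult_group m_assoc)
      moreover have "(g \<otimes> d \<otimes> inv g) \<otimes> inv (comm c g) \<in> D"
        using conj[OF g d(1)] cg[OF g] by simp
      ultimately show ?thesis using M by blast
    qed
  qed
  ultimately show ?thesis using normal_inv_iff by blast
qed

lemma card_adjoin_le:
  assumes "finite (carrier G)" "subgroup D G" "c \<in> carrier G"
  shows "card (D \<union> (D #> c)) \<le> 2 * card D"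
proof -
  interpret D: subgroup D G by fact
  have "card (D #> c) = card D" using card_rcosets_equal[OF rcosetsI] assms D.subset by metis
  thus ?thesis using card_Un_le[of D "D #> c"] by simp
qed

lemma card_adjoin_eq:
  assumes "finite (carrier G)" "subgroup D G" "c \<in> carrier G" "c \<notin> D"
  shows "card (D \<union> (D #> c)) = 2 * card D"
proof -
  interpret D: subgroup D G by fact
  have c: "card (D #> c) = card D" using card_rcosets_equal[OF rcosetsI] assms D.subset by metis
  have "D \<inter> (D #> c) = {}"
  proof (rule ccontr)
    assume "D \<inter> (D #> c) \<noteq> {}"
    then obtain d where d: "d \<in> D" "d \<otimes> c \<in> D" by (auto simp: r_coset_def)
    hence "inv d \<otimes> (d \<otimes> c) \<in> D" by blast
    thus False using assms d D.subset by (auto simp: subsetD)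
  qed
  moreover have "finite D" "finite (D #> c)"
    using assms D.subset finite_subset r_coset_subset_G by metis+
  ultimately show ?thesis using c by (simp add: card_Un_disjoint)
qed

text \<open>The conditions on \<open>T\<close> relative to \<open>D\<close> persist for the larger
  subgroups met on the way, so elements can be adjoined one at a time, each at most doubling the
  size.\<close>

lemma adjoin_central_set:
  assumes fin: "finite (carrier G)" and T: "finite T" and D: "D \<lhd> G"
    and "T \<subseteq> carrier G" "\<And>c. c \<in> T \<Longrightarrow> c \<otimes> c \<in> D"
    and "\<And>c g. c \<in> T \<Longrightarrow> g \<in> carrier G \<Longrightarrow> comm c g \<in> D"
  shows "\<exists>D'. D' \<lhd> G \<and> D \<union> T \<subseteq> D' \<and> card D' \<le> 2 ^ card T * card D"
  using T assms(4-)
proof (induction T rule: finite_induct)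
  case empty
  show ?case using D by auto
next
  case (insert c T)
  then obtain D' where D': "D' \<lhd> G" "D \<union> T \<subseteq> D'" "card D' \<le> 2 ^ card T * card D" by auto
  have c: "c \<in> carrier G" using insert by simp
  let ?E = "D' \<union> (D' #> c)"
  have "?E \<lhd> G" using insert D' c by (intro adjoin_central) auto
  moreover have "c \<in> ?E" using rcos_self[OF c] D'(1) normal_imp_subgroup by blast
  moreover have "card ?E \<le> 2 * card D'"
    using card_adjoin_le[OF fin _ c] D'(1) normal_imp_subgroup by blast
  hence "card ?E \<le> 2 ^ card (insert c T) * card D" using D'(3) insert by simp
  ultimately show ?case using D'(2) by blast
qed

lemma card_subgroup_pos:
  assumes "finite (carrier G)" "subgroup H G"
  shows "card H > 0"
  using assms subgroup.one_closed[OF assms(2)] finite_subset[OF subgroup.subset[OF assms(2)]]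
  by (auto simp: card_gt_0_iff)

lemma subgroup_eq_carrierI:
  assumes "subgroup S G" "X \<subseteq> S" "generate G X = carrier G"
  shows "S = carrier G"
  using assms by (metis generate_subgroup_incl subgroup.subset subset_antisym)

lemma set_mult_normal_subgroup:
  assumes "N \<lhd> G" "subgroup A G"
  shows "subgroup (N <#> A) G"
  using assms by (intro second_isomorphism_grp.normal_set_mult_subgroup)
    (simp add: second_isomorphism_grp_def second_isomorphism_grp_axioms_def)

text \<open>Going up from \<open>N\<close> to \<open>H\<close> by central steps of order 2, a step inside \<open>N A\<close> adds no commutators,
  and any other step by \<open>z\<close> adds only the elements \<open>[z, x]\<close> with \<open>x \<in> T\<close>, which are central of order
  at most 2 modulo what is already there.\<close>

lemma commutators_climb:
  assumes ord: "order G = 2 ^ n"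
    and A: "subgroup A G" "\<And>a g. a \<in> A \<Longrightarrow> g \<in> carrier G \<Longrightarrow> a \<otimes> g = g \<otimes> a"
    and X: "generate G X = carrier G" "X \<subseteq> carrier G" and T: "finite T" "T \<subseteq> X"
    and N: "N \<lhd> G" and H: "H \<lhd> G" "N \<subseteq> H" and D: "D \<lhd> G"
    and ND: "\<And>n g. n \<in> N \<Longrightarrow> g \<in> carrier G \<Longrightarrow> comm n g \<in> D"
    and HX: "\<And>h x. h \<in> H \<Longrightarrow> x \<in> X - T \<Longrightarrow> comm h x \<in> D"
  shows "\<exists>D'. D' \<lhd> G \<and> D \<subseteq> D' \<and> (\<forall>h\<in>H. \<forall>g\<in>carrier G. comm h g \<in> D') \<and>
    card D' * card (N <#> A) ^ card T \<le> card D * card (H <#> A) ^ card T"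
  using N H D ND HX
proof (induction "card H - card N" arbitrary: N D rule: less_induct)
  case less
  have fin: "finite (carrier G)" using ord order_gt_0_iff_finite by simp
  interpret A: subgroup A G by fact
  interpret N: normal N G by fact
  interpret H: normal H G by fact
  interpret D: normal D G by fact
  have finH: "finite H" using fin H.subset finite_subset by blast
  show ?case
  proof (cases "N = H")
    case True
    thus ?thesis using less.prems by (intro exI[of _ D]) auto
  next
    case False
    hence "N \<subset> H" using less.prems by blast
    then obtain z where z: "z \<in> H" "z \<notin> N" "z \<otimes> z \<in> N" "\<And>g. g \<in> carrier G \<Longrightarrow> comm z g \<in> N"
      using two_group_normal_step[OF ord less.prems(1,2)] by metis
    have zc: "z \<in> carrier G" using z H.subset by blast
    define M where "M = N \<union> (N #> z)"
    have M: "M \<lhd> G" unfolding M_def by (rule adjoin_central) (use zc z less.prems in auto)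
    have MH: "M \<subseteq> H" using z less.prems(3) by (auto simp: M_def r_coset_def)
    have "card M = 2 * card N" unfolding M_def using card_adjoin_eq[OF fin N.is_subgroup zc z(2)] .
    moreover have "card M \<le> card H" using MH finH card_mono by blast
    moreover have "card N > 0" using N.one_closed finH less.prems(3) finite_subset card_gt_0_iff
      by blast
    ultimately have dec: "card H - card M < card H - card N" by linarith
    have NM: "N \<subseteq> M" by (auto simp: M_def)
    have NA: "subgroup (N <#> A) G" by (rule set_mult_normal_subgroup[OF less.prems(1) A(1)])
    \<comment> \<open>Only generators \<open>x\<close> are considered here;
      \<open>subgroup_commutes_mod\<close> then passes to all of \<open>carrier G\<close>, and from
      \<open>z\<close> and \<open>N\<close> to all of \<open>M\<close>.\<close>
    have "\<exists>D''. D'' \<lhd> G \<and> D \<subseteq> D'' \<and> (\<forall>x\<in>X. comm z x \<in> D'') \<and>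
      card D'' * card (N <#> A) ^ card T \<le> card D * card (M <#> A) ^ card T"
    proof (cases "z \<in> N <#> A")
      case True
      then obtain m a where ma: "m \<in> N" "a \<in> A" "z = m \<otimes> a" by (auto simp: set_mult_def)
      have "comm z x \<in> D" if "x \<in> carrier G" for x
      proof -
        have c: "m \<in> carrier G" "a \<in> carrier G" using ma N.subset A.subset by auto
        have "comm z x = m \<otimes> (a \<otimes> x) \<otimes> inv a \<otimes> inv m \<otimes> inv x"
          using ma(3) c that by (simp add: inv_mult_group m_assoc)
        also have "\<dots> = comm m x" unfolding A(2)[OF ma(2) that] using c that by (simp add: m_assoc)
        finally show ?thesis using less.prems(5) ma that by simp
      qed
      moreover have "card (N <#> A) \<le> card (M <#> A)"
      proof (rule card_mono)
        have "M <#> A \<subseteq> carrier G" using MH H.subset A.subset by (intro set_mult_closed) auto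
        thus "finite (M <#> A)" using fin finite_subset by blast
        show "N <#> A \<subseteq> M <#> A" using NM by (intro mono_set_mult) auto
      qed
      ultimately show ?thesis using X less.prems(4)
        by (intro exI[of _ D]) (auto intro!: mult_left_mono power_mono)
    next
      case False
      let ?C = "(\<lambda>x. comm z x) ` T"
      have TC: "T \<subseteq> carrier G" using T X by blast
      have C: "\<exists>D'. D' \<lhd> G \<and> D \<union> ?C \<subseteq> D' \<and> card D' \<le> 2 ^ card ?C * card D"
      proof (rule adjoin_central_set[OF fin _ less.prems(4)])
        show "finite ?C" using T by simp
        show "?C \<subseteq> carrier G" using TC zc by auto
        fix c assume "c \<in> ?C"
        then obtain x where x: "x \<in> T" "c = comm z x" by auto
        have xc: "x \<in> carrier G" using x TC by auto
        have cN: "c \<in> N" using x z(4) xc by simp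
        have cc: "c \<in> carrier G" using x xc zc by simp
        show "comm c g \<in> D" if "g \<in> carrier G" for g using less.prems(5) cN that by simp
        \<comment> \<open>\<open>c \<otimes> c\<close> differs from the commutator of
          \<open>z \<otimes> z\<close> and \<open>x\<close> by one of \<open>c\<close> and
          \<open>z\<close>. Both \<open>z \<otimes> z\<close> and \<open>c\<close> lie in
          \<open>N\<close>, so both commutators are in \<open>D\<close>.\<close>
        have "comm (z \<otimes> z) x \<in> D" using less.prems(5) z(3) xc by simp
        moreover have "comm (z \<otimes> z) x = inv (comm c z) \<otimes> (c \<otimes> c)"
          using x zc xc by (simp add: inv_mult_group m_assoc)
        ultimately have "comm c z \<otimes> (inv (comm c z) \<otimes> (c \<otimes> c)) \<in> D"
          using less.prems(5)[OF cN zc] by simp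
        thus "c \<otimes> c \<in> D" using zc cc by (simp del: inv_mult_group)
      qed
      then obtain D' where D': "D' \<lhd> G" "D \<union> ?C \<subseteq> D'" "card D' \<le> 2 ^ card ?C * card D" by blast
      have "card ?C \<le> card T" using T card_image_le by blast
      hence "(2::nat) ^ card ?C \<le> 2 ^ card T" by simp
      hence "card D' \<le> 2 ^ card T * card D" using D'(3) by (meson le_trans mult_le_mono1)
      hence "card D' * card (N <#> A) ^ card T \<le> card D * (2 * card (N <#> A)) ^ card T"
        by (simp add: power_mult_distrib mult.commute mult.left_commute)
      \<comment> \<open>A step outside \<open>N <#> A\<close> doubles this product, and the
        doubling, raised to the power \<open>card T\<close>, absorbs the growth of
        \<open>D'\<close>.\<close>
      also have "2 * card (N <#> A) = card ((N <#> A) \<union> ((N <#> A) #> z))"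
        using card_adjoin_eq[OF fin NA zc False] by simp
      also have "\<dots> \<le> card (M <#> A)"
      proof (rule card_mono)
        have "M <#> A \<subseteq> carrier G" using MH H.subset A.subset by (intro set_mult_closed) auto
        thus "finite (M <#> A)" using fin finite_subset by blast
        have "m \<otimes> a \<otimes> z \<in> M <#> A" if "m \<in> N" "a \<in> A" for m a
        proof -
          have "m \<otimes> a \<otimes> z = (m \<otimes> z) \<otimes> a" using that N.subset A.subset zc A(2)[OF that(2) zc]
            by (simp add: m_assoc subsetD)
          moreover have "m \<otimes> z \<in> M" using that by (auto simp: M_def r_coset_def)
          ultimately show ?thesis using that by (auto simp: set_mult_def)
        qed
        thus "(N <#> A) \<union> ((N <#> A) #> z) \<subseteq> M <#> A"
          using NM by (force simp: r_coset_def set_mult_def)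
      qed
      finally have "card D' * card (N <#> A) ^ card T \<le> card D * card (M <#> A) ^ card T"
        by (meson le_refl le_trans mult_le_mono power_mono zero_le)
      moreover have "comm z x \<in> D'" if "x \<in> X" for x
        using that less.prems(6)[OF z(1), of x] D'(2) by blast
      ultimately show ?thesis using D' by blast
    qed
    then obtain D'' where D'': "D'' \<lhd> G" "D \<subseteq> D''" "\<And>x. x \<in> X \<Longrightarrow> comm z x \<in> D''"
      "card D'' * card (N <#> A) ^ card T \<le> card D * card (M <#> A) ^ card T" by blast
    have "{g \<in> carrier G. comm z g \<in> D''} = carrier G"
      by (rule subgroup_eq_carrierI[OF subgroup_commutes_mod(1)[OF D''(1) zc] _ X(1)]) (use X D'' in auto)
    hence zg: "comm z g \<in> D''" if "g \<in> carrier G" for g using that by blast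
    have MD: "comm m g \<in> D''" if "m \<in> M" "g \<in> carrier G" for m g
    proof -
      have S: "subgroup {h \<in> carrier G. comm h g \<in> D''} G"
        by (rule subgroup_commutes_mod(2)[OF D''(1) that(2)])
      have "N \<subseteq> {h \<in> carrier G. comm h g \<in> D''}" using less.prems(5) N.subset D''(2) that by auto
      moreover have "z \<in> {h \<in> carrier G. comm h g \<in> D''}" using zg zc that by auto
      ultimately have "m \<in> {h \<in> carrier G. comm h g \<in> D''}"
        using that(1) subgroup.m_closed[OF S] unfolding M_def r_coset_def by blast
      thus ?thesis by simp
    qed
    have "\<exists>D'. D' \<lhd> G \<and> D'' \<subseteq> D' \<and> (\<forall>h\<in>H. \<forall>g\<in>carrier G. comm h g \<in> D') \<and>
      card D' * card (M <#> A) ^ card T \<le> card D'' * card (H <#> A) ^ card T"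
      by (rule less.hyps[OF dec M less.prems(2) MH D''(1) MD]) (use less.prems(6) D''(2) in blast)+
    then obtain D' where D': "D' \<lhd> G" "D'' \<subseteq> D'" "\<forall>h\<in>H. \<forall>g\<in>carrier G. comm h g \<in> D'"
      "card D' * card (M <#> A) ^ card T \<le> card D'' * card (H <#> A) ^ card T" by blast
    have "card (M <#> A) ^ card T > 0"
      using card_subgroup_pos[OF fin set_mult_normal_subgroup[OF M A(1)]] by simp
    from mult_le_chain[OF D'(4) D''(4) this]
    have "card D' * card (N <#> A) ^ card T \<le> card D * card (H <#> A) ^ card T" .
    thus ?thesis using D' D''(2) by (intro exI[of _ D']) auto
  qed
qed

end

section \<open>The bound for a central elementary abelian subgroup\<close>

lemma (in group_hom) card_kernel_image:
  assumes "finite (carrier G)"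
  shows "card (kernel G H h) * card (h ` carrier G) = order G"
proof -
  let ?K = "kernel G H h"
  have "bij_betw (\<lambda>X. the_elem (h ` X)) (carrier (G Mod ?K)) (h ` carrier G)"
    unfolding bij_betw_def
  proof
    show "inj_on (\<lambda>X. the_elem (h ` X)) (carrier (G Mod ?K))" by (rule FactGroup_inj_on)
    have "the_elem (h ` (?K #> x)) = h x" if x: "x \<in> carrier G" for x
    proof -
      have "h ` (?K #> x) = {h x}"
      proof
        show "h ` (?K #> x) \<subseteq> {h x}" using x by (auto simp: r_coset_def kernel_def)
        show "{h x} \<subseteq> h ` (?K #> x)" using G.rcos_self[OF x subgroup_kernel] by blast
      qed
      thus ?thesis by simp
    qed
    thus "(\<lambda>X. the_elem (h ` X)) ` carrier (G Mod ?K) = h ` carrier G"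
      unfolding carrier_FactGroup image_image by (rule image_cong[OF refl])
  qed
  hence "card (rcosets ?K) = card (h ` carrier G)"
    using bij_betw_same_card by (simp add: FactGroup_def) blast
  thus ?thesis using G.lagrange[OF subgroup_kernel] by (simp add: mult.commute)
qed

text \<open>The set is the kernel of squaring, so it has as many elements as there are cosets of the
  squares; modulo squares the group is elementary abelian with \<open>card Y\<close>
  generators.\<close>

lemma (in comm_group) card_involutions_le:
  assumes fin: "finite (carrier G)" and Y: "finite Y" "Y \<subseteq> carrier G" "generate G Y = carrier G"
  shows "card {b \<in> carrier G. b \<otimes> b = \<one>} \<le> 2 ^ card Y"
proof -
  interpret s: group_hom G G "\<lambda>b. b \<otimes> b"
    by unfold_locales (auto simp: hom_def m_ac)
  let ?I = "(\<lambda>b. b \<otimes> b) ` carrier G"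
  have I: "subgroup ?I G" using s.img_is_subgroup by simp
  hence nI: "?I \<lhd> G" using normal_iff_subgroup by simp
  have "\<exists>D'. D' \<lhd> G \<and> ?I \<union> Y \<subseteq> D' \<and> card D' \<le> 2 ^ card Y * card ?I"
  proof (rule adjoin_central_set[OF fin Y(1) nI Y(2)])
    fix c assume c: "c \<in> Y" thus "c \<otimes> c \<in> ?I" using Y by blast
    fix g assume "g \<in> carrier G"
    moreover have "c \<in> carrier G" using c Y by blast
    ultimately have "c \<otimes> g \<otimes> inv c \<otimes> inv g = \<one>" by (simp add: m_comm[of c g] m_assoc)
    thus "c \<otimes> g \<otimes> inv c \<otimes> inv g \<in> ?I" using subgroup.one_closed[OF I] by simp
  qed
  then obtain D where D: "D \<lhd> G" "?I \<union> Y \<subseteq> D" "card D \<le> 2 ^ card Y * card ?I" by blast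
  have "D = carrier G" using subgroup_eq_carrierI[OF normal_imp_subgroup[OF D(1)] _ Y(3)] D(2)
    by blast
  hence "order G \<le> 2 ^ card Y * card ?I" using D by (simp add: order_def)
  hence "card (kernel G G (\<lambda>b. b \<otimes> b)) * card ?I \<le> 2 ^ card Y * card ?I"
    using s.card_kernel_image[OF fin] by simp
  moreover have "card ?I > 0" using fin by (auto simp: card_gt_0_iff)
  ultimately show ?thesis by (simp add: kernel_def)
qed

context group
begin

lemma subset_generate: "S \<subseteq> generate G S"
  by (auto intro: generate.incl)

lemma normal_if_contains_derived:
  assumes H: "subgroup H G" and D: "derived G (carrier G) \<subseteq> H"
  shows "H \<lhd> G"
proof (rule normal_invI[OF H])
  interpret H: subgroup H G by fact
  fix x h assume xh: "x \<in> carrier G" "h \<in> H"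
  have "comm x h \<in> derived G (carrier G)"
    unfolding derived_def using xh H.subset by (intro generate.incl) blast
  hence "comm x h \<otimes> h \<in> H" using D xh by blast
  thus "x \<otimes> h \<otimes> inv x \<in> H" using xh by (simp add: m_assoc)
qed

text \<open>The generators are adjoined to \<open>E'\<close> one by one; while \<open>x\<close> is adjoined, \<open>[_, x]\<close> contributes
  nothing, so above \<open>E'\<close> each step costs one generator less. This is what turns the exponent
  \<open>card X\<close> into \<open>card X - 1\<close>.\<close>

lemma central_elementary_bound:
  assumes ord: "order G = 2 ^ n"
    and A: "subgroup A G" "\<And>a g. a \<in> A \<Longrightarrow> g \<in> carrier G \<Longrightarrow> a \<otimes> g = g \<otimes> a"
      "\<And>a. a \<in> A \<Longrightarrow> a \<otimes> a = \<one>"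
    and X: "finite X" "X \<subseteq> carrier G" "generate G X = carrier G"
  shows "card A ^ card X \<le> order G ^ (card X - 1) * 2 ^ card X"
proof (cases "X = {}")
  case True
  hence "carrier G = {\<one>}" using X generate_empty by simp
  hence "A \<subseteq> {\<one>}" using subgroup.subset[OF A(1)] by simp
  thus ?thesis using True by simp
next
  case False
  have fin: "finite (carrier G)" using ord order_gt_0_iff_finite by simp
  interpret A: subgroup A G by fact
  define e where "e = card X"
  define C where "C = derived G (carrier G)"
  have C: "C \<lhd> G" unfolding C_def by (rule derived_is_normal[OF normal_self])
  interpret C: normal C G by fact
  \<comment> \<open>No generator is known to commute with all of \<open>C\<close>, so the climb up
    to \<open>C\<close> charges every one of them.\<close>
  have "\<exists>D. D \<lhd> G \<and> {\<one>} \<subseteq> D \<and> (\<forall>h\<in>C. \<forall>g\<in>carrier G. comm h g \<in> D) \<and>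
    card D * card ({\<one>} <#> A) ^ card X \<le> card {\<one>} * card (C <#> A) ^ card X"
    by (rule commutators_climb[OF ord A(1,2) X(3,2,1) subset_refl one_is_normal C])
      (auto simp: one_is_normal)
  moreover have "{\<one>} <#> A = A" using A.subset by (force simp: set_mult_def)
  ultimately obtain D1 where D1: "D1 \<lhd> G" "\<forall>h\<in>C. \<forall>g\<in>carrier G. comm h g \<in> D1"
    "card D1 * card A ^ e \<le> card (C <#> A) ^ e" unfolding e_def by auto
  define J where "J S = generate G (C \<union> S)" for S
  have Jsub: "subgroup (J S) G" if "S \<subseteq> X" for S
    unfolding J_def using that C.subset X by (intro generate_is_subgroup) auto
  have Jn: "J S \<lhd> G" if "S \<subseteq> X" for S
    using normal_if_contains_derived[OF Jsub[OF that]] subset_generate[of "C \<union> S"]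
    unfolding J_def C_def by blast
  have "\<exists>D. D \<lhd> G \<and> (\<forall>h\<in>J S. \<forall>g\<in>carrier G. comm h g \<in> D) \<and>
    card D * card (C <#> A) ^ (e - 1) \<le> card D1 * card (J S <#> A) ^ (e - 1)"
    if "S \<subseteq> X" for S
    using finite_subset[OF that X(1)] that
  proof (induction S rule: finite_induct)
    case empty
    have "J {} = C" unfolding J_def
      using generate_subgroup_incl[OF subset_refl C.is_subgroup] subset_generate[of C] by auto
    thus ?case using D1 by auto
  next
    case (insert x S)
    then obtain D where D: "D \<lhd> G" "\<forall>h\<in>J S. \<forall>g\<in>carrier G. comm h g \<in> D"
      "card D * card (C <#> A) ^ (e - 1) \<le> card D1 * card (J S <#> A) ^ (e - 1)" by auto
    have xc: "x \<in> carrier G" and xX: "x \<in> X" and SX: "S \<subseteq> X" using insert X by auto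
    interpret D: normal D G by (rule D(1))
    have "J S \<subseteq> J (insert x S)" unfolding J_def by (rule mono_generate) auto
    moreover have "comm h x \<in> D" if "h \<in> J (insert x S)" for h
    proof -
      have S': "subgroup {h \<in> carrier G. comm h x \<in> D} G"
        by (rule subgroup_commutes_mod(2)[OF D(1) xc])
      have "C \<union> insert x S \<subseteq> {h \<in> carrier G. comm h x \<in> D}"
      proof
        \<comment> \<open>Modulo \<open>D\<close>, the generator \<open>x\<close> commutes with
          itself, and with \<open>C\<close> and \<open>S\<close> because these lie in
          \<open>J S\<close>.\<close>
        fix s assume s: "s \<in> C \<union> insert x S"
        have sc: "s \<in> carrier G" using s C.subset insert X by auto
        show "s \<in> {h \<in> carrier G. comm h x \<in> D}"
        proof (cases "s = x")
          case True
          thus ?thesis using xc by (simp add: m_assoc)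
        next
          case False
          hence "s \<in> J S" using s subset_generate[of "C \<union> S"] unfolding J_def by blast
          thus ?thesis using D(2) xc sc by blast
        qed
      qed
      hence "J (insert x S) \<subseteq> {h \<in> carrier G. comm h x \<in> D}"
        unfolding J_def by (rule generate_subgroup_incl[OF _ S'])
      thus ?thesis using that by blast
    qed
    ultimately have "\<exists>D'. D' \<lhd> G \<and> D \<subseteq> D' \<and> (\<forall>h\<in>J (insert x S). \<forall>g\<in>carrier G. comm h g \<in> D') \<and>
      card D' * card (J S <#> A) ^ card (X - {x}) \<le> card D * card (J (insert x S) <#> A) ^ card (X - {x})"
      using D X xX Jn[OF SX] Jn[OF insert.prems]
      by (intro commutators_climb[OF ord A(1,2) X(3,2)]) auto
    moreover have "card (X - {x}) = e - 1" using X xX by (simp add: e_def)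
    ultimately obtain D' where D': "D' \<lhd> G" "\<forall>h\<in>J (insert x S). \<forall>g\<in>carrier G. comm h g \<in> D'"
      "card D' * card (J S <#> A) ^ (e - 1) \<le> card D * card (J (insert x S) <#> A) ^ (e - 1)"
        by auto
    have "card (J S <#> A) ^ (e - 1) > 0"
      using card_subgroup_pos[OF fin set_mult_normal_subgroup[OF Jn[OF SX] A(1)]] by simp
    from mult_le_chain[OF D'(3) D(3) this]
    have "card D' * card (C <#> A) ^ (e - 1) \<le> card D1 * card (J (insert x S) <#> A) ^ (e - 1)" .
    thus ?case using D' by blast
  qed
  from this[OF subset_refl] obtain D where D: "D \<lhd> G" "\<forall>h\<in>J X. \<forall>g\<in>carrier G. comm h g \<in> D"
    "card D * card (C <#> A) ^ (e - 1) \<le> card D1 * card (J X <#> A) ^ (e - 1)" by blast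
  have "J X = carrier G"
    by (rule subgroup_eq_carrierI[OF Jsub[OF subset_refl] _ X(3)])
      (use subset_generate[of "C \<union> X"] in \<open>auto simp: J_def\<close>)
  \<comment> \<open>At the top of the climb all commutators of \<open>G\<close> lie in
    \<open>D\<close>, so the bound on \<open>D\<close> bounds the derived subgroup.\<close>
  have "C \<subseteq> D" unfolding C_def derived_def
    using D(2) unfolding \<open>J X = carrier G\<close>
    by (intro generate_subgroup_incl[OF _ normal_imp_subgroup[OF D(1)]]) auto
  hence "card C \<le> card D"
    using fin subgroup.subset[OF normal_imp_subgroup[OF D(1)]] by (meson card_mono finite_subset)
  have "carrier G <#> A = carrier G" using set_mult_carrier_idem[OF A(1)] .
  hence D3: "card C * card (C <#> A) ^ (e - 1) \<le> card D1 * order G ^ (e - 1)"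
    using D(3) \<open>card C \<le> card D\<close> unfolding \<open>J X = carrier G\<close> order_def
    by (metis le_trans mult_le_mono1)
  have CA0: "card (C <#> A) > 0"
    by (rule card_subgroup_pos[OF fin set_mult_normal_subgroup[OF C A(1)]])
  have C0: "card C > 0" by (rule card_subgroup_pos[OF fin C.is_subgroup])
  have e: "e = Suc (e - 1)" using False X by (simp add: e_def card_gt_0_iff)
  have D1': "card A ^ e * card D1 \<le> card (C <#> A) * card (C <#> A) ^ (e - 1)"
    using D1(3) e by (metis mult.commute power_Suc)
  have "card A ^ e * card C * card (C <#> A) ^ (e - 1) = card A ^ e * (card C * card (C <#> A) ^ (e - 1))"
    by (simp only: mult.assoc)
  also have "\<dots> \<le> card A ^ e * (card D1 * order G ^ (e - 1))" by (rule mult_le_mono2[OF D3])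
  also have "\<dots> = card A ^ e * card D1 * order G ^ (e - 1)" by (simp only: mult.assoc)
  also have "\<dots> \<le> card (C <#> A) * card (C <#> A) ^ (e - 1) * order G ^ (e - 1)"
    by (rule mult_le_mono1[OF D1'])
  also have "\<dots> = card (C <#> A) * order G ^ (e - 1) * card (C <#> A) ^ (e - 1)"
    by (simp only: mult_ac)
  \<comment> \<open>Combining the two climbs has eliminated \<open>D1\<close> and all but one factor
    \<open>card (C <#> A)\<close>. The quotient of that factor by \<open>card C\<close> is the size
    of the image of \<open>A\<close> in the abelianization, which is elementary abelian and hence at
    most \<open>2 ^ e\<close>.\<close>
  finally have 1: "card C * card A ^ e \<le> card (C <#> A) * order G ^ (e - 1)"
    using CA0 by (simp add: mult.commute)
  interpret B: comm_group "G Mod C" unfolding C_def by (rule derived_quot_is_comm_group)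
  interpret p: group_hom G "G Mod C" "\<lambda>a. C #> a"
    by unfold_locales (rule C.r_coset_hom_Mod)
  have im: "(\<lambda>a. C #> a) ` carrier G = carrier (G Mod C)" by (simp add: carrier_FactGroup)
  let ?Y = "(\<lambda>a. C #> a) ` X"
  have "generate (G Mod C) ?Y = carrier (G Mod C)" using p.generate_img[OF X(2)] X(3) im by simp
  moreover have "finite (carrier (G Mod C))" using fin im by (metis finite_imageI)
  moreover have "?Y \<subseteq> carrier (G Mod C)" using X im by blast
  ultimately have "card {b \<in> carrier (G Mod C). b \<otimes>\<^bsub>G Mod C\<^esub> b = \<one>\<^bsub>G Mod C\<^esub>} \<le> 2 ^ card ?Y"
    using X(1) by (intro B.card_involutions_le) auto
  also have "\<dots> \<le> 2 ^ e" using X(1) card_image_le by (simp add: e_def)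
  finally have "card {b \<in> carrier (G Mod C). b \<otimes>\<^bsub>G Mod C\<^esub> b = \<one>\<^bsub>G Mod C\<^esub>} \<le> 2 ^ e" .
  moreover have sA: "(\<lambda>a. C #> a) ` A \<subseteq> {b \<in> carrier (G Mod C). b \<otimes>\<^bsub>G Mod C\<^esub> b = \<one>\<^bsub>G Mod C\<^esub>}"
  proof
    fix b assume "b \<in> (\<lambda>a. C #> a) ` A"
    then obtain a where a: "a \<in> A" "b = C #> a" by auto
    have ac: "a \<in> carrier G" using a A.subset by blast
    have "b \<otimes>\<^bsub>G Mod C\<^esub> b = C #> (a \<otimes> a)" unfolding a(2) mult_FactGroup
      by (rule C.rcos_sum[OF ac ac])
    also have "\<dots> = C" using A(3)[OF a(1)] C.subset by simp
    finally show "b \<in> {b \<in> carrier (G Mod C). b \<otimes>\<^bsub>G Mod C\<^esub> b = \<one>\<^bsub>G Mod C\<^esub>}" using a ac im by auto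
  qed
  moreover have finI: "finite {b \<in> carrier (G Mod C). b \<otimes>\<^bsub>G Mod C\<^esub> b = \<one>\<^bsub>G Mod C\<^esub>}"
    using \<open>finite (carrier (G Mod C))\<close> by simp
  ultimately have cA: "card ((\<lambda>a. C #> a) ` A) \<le> 2 ^ e"
    using card_mono[OF finI sA] by linarith
  have "C <#> A = \<Union>((\<lambda>a. C #> a) ` A)" by (auto simp: set_mult_def r_coset_def)
  hence "card (C <#> A) \<le> (\<Sum>b\<in>(\<lambda>a. C #> a) ` A. card b)" using card_Union_le_sum_card by metis
  also have "\<dots> = (\<Sum>b\<in>(\<lambda>a. C #> a) ` A. card C)"
    using A.subset C.subset
      by (intro sum.cong refl) (auto intro!: card_rcosets_equal[symmetric] rcosetsI)
  also have "\<dots> \<le> 2 ^ e * card C" using cA by simp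
  finally have "card C * card A ^ e \<le> 2 ^ e * card C * order G ^ (e - 1)"
    using 1 by (meson le_trans mult_le_mono1)
  hence "card C * card A ^ e \<le> card C * (order G ^ (e - 1) * 2 ^ e)"
    by (simp only: mult_ac)
  thus ?thesis using C0 unfolding e_def by simp
qed

end

section \<open>Counting normal subgroups\<close>

context group
begin

text \<open>Every adjoined element at least doubles the subgroup, so the binary logarithm of the
  index bounds the number of generators needed over \<open>K\<close>.\<close>

lemma generators_over_subgroup:
  assumes fin: "finite (carrier G)" and M: "subgroup M G" and K: "subgroup K G" "K \<subseteq> M"
  shows "\<exists>Y. finite Y \<and> Y \<subseteq> M \<and> generate G (K \<union> Y) = M \<and> 2 ^ card Y * card K \<le> card M"
  using K
proof (induction "card M - card K" arbitrary: K rule: less_induct)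
  case less
  interpret M: subgroup M G by fact
  interpret K: subgroup K G by fact
  have finM: "finite M" using fin M.subset finite_subset by blast
  show ?case
  proof (cases "K = M")
    case True
    moreover have "generate G M = M"
      using generate_subgroup_incl[OF subset_refl M] subset_generate[of M] by blast
    ultimately show ?thesis by (intro exI[of _ "{}"]) simp
  next
    case False
    then obtain y where y: "y \<in> M" "y \<notin> K" using less.prems by blast
    have yc: "y \<in> carrier G" using y M.subset by blast
    let ?L = "generate G (insert y K)"
    have L: "subgroup ?L G" using yc K.subset by (intro generate_is_subgroup) simp
    have LM: "?L \<subseteq> M" using less.prems y by (intro generate_subgroup_incl[OF _ M]) simp
    have KL: "insert y K \<subseteq> ?L" by (rule subset_generate)
    have "K \<union> (K #> y) \<subseteq> ?L"
      using KL subgroup.m_closed[OF L] by (auto simp: r_coset_def)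
    hence "card (K \<union> (K #> y)) \<le> card ?L"
      using finite_subset[OF LM finM] by (rule card_mono[rotated])
    hence c: "2 * card K \<le> card ?L" using card_adjoin_eq[OF fin less.prems(1) yc y(2)] by simp
    have "card ?L \<le> card M" using LM finM card_mono by blast
    moreover have "card K > 0" by (rule card_subgroup_pos[OF fin less.prems(1)])
    ultimately have "card M - card ?L < card M - card K" using c by linarith
    from less.hyps[OF this L LM] obtain Y where Y: "finite Y" "Y \<subseteq> M"
      "generate G (?L \<union> Y) = M" "2 ^ card Y * card ?L \<le> card M" by blast
    have "generate G (K \<union> insert y Y) = M"
    proof
      show "generate G (K \<union> insert y Y) \<subseteq> M"
        using less.prems y Y by (intro generate_subgroup_incl[OF _ M]) simp
      have S: "subgroup (generate G (K \<union> insert y Y)) G"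
        using less.prems M.subset y Y by (intro generate_is_subgroup) auto
      have "?L \<subseteq> generate G (K \<union> insert y Y)" by (rule mono_generate) auto
      moreover have "Y \<subseteq> generate G (K \<union> insert y Y)" using subset_generate[of "K \<union> insert y Y"]
        by auto
      ultimately have "generate G (?L \<union> Y) \<subseteq> generate G (K \<union> insert y Y)"
        by (intro generate_subgroup_incl[OF _ S]) simp
      thus "M \<subseteq> generate G (K \<union> insert y Y)" using Y(3) by simp
    qed
    moreover have "2 ^ card (insert y Y) * card K \<le> card M"
    proof -
      have "(2::nat) ^ card (insert y Y) \<le> 2 ^ Suc (card Y)"
        using Y(1) by (intro power_increasing) (auto simp: card_insert_if)
      hence "2 ^ card (insert y Y) * card K \<le> 2 ^ Suc (card Y) * card K" by (rule mult_le_mono1)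
      also have "\<dots> = 2 ^ card Y * (2 * card K)" by simp
      also have "\<dots> \<le> 2 ^ card Y * card ?L" using c by (rule mult_le_mono2)
      finally show ?thesis using Y(4) by simp
    qed
    ultimately show ?thesis using Y y by (intro exI[of _ "insert y Y"]) simp
  qed
qed

text \<open>What lies in \<open>M\<close> outside \<open>N\<close> is a single coset, so membership
  in \<open>N\<close> behaves like a homomorphism from \<open>M\<close> to the group of order
  2.\<close>

lemma index_two_diff:
  assumes fin: "finite (carrier G)" and M: "subgroup M G" and N: "subgroup N G" "N \<subseteq> M"
    and c: "2 * card N = card M" and xy: "x \<in> M" "y \<in> M" "x \<in> N \<longleftrightarrow> y \<in> N"
  shows "x \<otimes> inv y \<in> N"
proof (cases "y \<in> N")
  case True
  thus ?thesis using xy subgroup.m_closed[OF N(1)] subgroup.m_inv_closed[OF N(1)] by blast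
next
  case False
  interpret M: subgroup M G by fact
  interpret N: subgroup N G by fact
  have yc: "y \<in> carrier G" and xc: "x \<in> carrier G" using xy M.subset by auto
  have "N \<union> (N #> y) \<subseteq> M" using N(2) xy by (auto simp: r_coset_def)
  moreover have "card (N \<union> (N #> y)) = card M" using card_adjoin_eq[OF fin N(1) yc False] c by simp
  moreover have "finite M" using fin M.subset finite_subset by blast
  ultimately have "N \<union> (N #> y) = M" by (simp add: card_subset_eq)
  hence "x \<in> N #> y" using xy False by blast
  thus ?thesis using N.rcos_module_imp[OF group_axioms yc] by blast
qed

text \<open>Let \<open>K\<close> be the intersection of the subgroups counted. Each is the kernel of
  a homomorphism from \<open>M\<close> to the group of order 2, so \<open>M\<close> modulo
  \<open>K\<close> is elementary abelian; it is central in \<open>G Mod K\<close> because the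
  subgroups are normal in \<open>G\<close>. There are at most as many such homomorphisms as elements
  of \<open>M\<close> modulo \<open>K\<close>, and \<open>central_elementary_bound\<close> bounds
  the latter.\<close>

lemma card_index_two_normal_le:
  assumes ord: "order G = 2 ^ n" and X: "finite X" "X \<subseteq> carrier G" "generate G X = carrier G"
    and M: "M \<lhd> G" and idx: "order G = 2 ^ k * card M"
  shows "card {N. N \<lhd> G \<and> N \<subseteq> M \<and> 2 * card N = card M} \<le> 2 ^ ((card X - 1) * k + card X)"
    (is "card ?S \<le> _")
proof (cases "?S = {}")
  case True
  show ?thesis unfolding True by simp
next
  case ne: False
  have fin: "finite (carrier G)" using ord order_gt_0_iff_finite by simp
  interpret M: normal M G by fact
  define e where "e = card X"
  have "e > 0"
  proof (rule ccontr)
    assume "\<not> e > 0"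
    hence "carrier G = {\<one>}" using X generate_empty by (simp add: e_def)
    hence "M = {\<one>}" using M.subset M.one_closed by blast
    moreover obtain N where "N \<in> ?S" using ne by auto
    hence "2 * card N = card M" by simp
    ultimately have "2 * card N = 1" by simp
    thus False by presburger
  qed
  define K where "K = \<Inter>?S"
  have subS: "subgroup N G" if "N \<in> ?S" for N using that normal_imp_subgroup by blast
  have Ksub: "subgroup K G" unfolding K_def using subS ne by (intro subgroups_Inter) auto
  have K: "K \<lhd> G"
  proof (rule normal_invI[OF Ksub])
    fix x h assume xh: "x \<in> carrier G" "h \<in> K"
    show "x \<otimes> h \<otimes> inv x \<in> K" unfolding K_def
    proof
      fix N assume N: "N \<in> ?S"
      hence "h \<in> N" using xh unfolding K_def by blast
      thus "x \<otimes> h \<otimes> inv x \<in> N" using N normal_invE(2) xh by blast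
    qed
  qed
  interpret K: normal K G by fact
  have KM: "K \<subseteq> M" using ne unfolding K_def by blast
  have id2: "x \<otimes> inv y \<in> N" if "N \<in> ?S" "x \<in> M" "y \<in> M" "x \<in> N \<longleftrightarrow> y \<in> N" for N x y
    using that index_two_diff[OF fin M.is_subgroup subS[OF that(1)]] by auto
  have sqK: "m \<otimes> m \<in> K" if m: "m \<in> M" for m unfolding K_def
  proof
    fix N assume N: "N \<in> ?S"
    have "inv m \<in> N \<longleftrightarrow> m \<in> N"
      using subgroup.m_inv_closed[OF subS[OF N]] m M.subset by (metis inv_inv subsetD)
    hence "m \<otimes> inv (inv m) \<in> N" using id2[OF N m, of "inv m"] m by simp
    thus "m \<otimes> m \<in> N" using m M.subset by (simp add: subsetD)
  qed
  have commK: "comm m g \<in> K" if m: "m \<in> M" and g: "g \<in> carrier G" for m g unfolding K_def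
  proof
    fix N assume N: "N \<in> ?S"
    have mc: "m \<in> carrier G" using m M.subset by blast
    interpret N: normal N G using N by blast
    have gm: "g \<otimes> m \<otimes> inv g \<in> M" using M.inv_op_closed2[OF g m] .
    \<comment> \<open>Normality of \<open>N\<close> puts \<open>m\<close> and its conjugate into the
      same one of the two cosets of \<open>N\<close> in \<open>M\<close>.\<close>
    have "g \<otimes> m \<otimes> inv g \<in> N \<longleftrightarrow> m \<in> N"
    proof
      assume "g \<otimes> m \<otimes> inv g \<in> N"
      from N.inv_op_closed1[OF g this] show "m \<in> N" using g mc by (simp add: m_assoc)
    qed (rule N.inv_op_closed2[OF g])
    hence "m \<otimes> inv (g \<otimes> m \<otimes> inv g) \<in> N" using id2[OF N m gm] by blast
    thus "comm m g \<in> N" using g mc by (simp add: inv_mult_group m_assoc)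
  qed
  interpret Q: group "G Mod K" by (rule K.factorgroup_is_group)
  interpret p: group_hom G "G Mod K" "\<lambda>a. K #> a"
    by unfold_locales (rule K.r_coset_hom_Mod)
  have im: "(\<lambda>a. K #> a) ` carrier G = carrier (G Mod K)" by (simp add: carrier_FactGroup)
  have eqK: "K #> a = K #> b" if "a \<otimes> inv b \<in> K" "a \<in> carrier G" "b \<in> carrier G" for a b
    using that by (metis K.rcos_module_rev group_axioms repr_independence K.is_subgroup)
  let ?A = "(\<lambda>a. K #> a) ` M" and ?Y = "(\<lambda>a. K #> a) ` X"
  have oQ: "order (G Mod K) * card K = order G"
    using lagrange[OF Ksub] by (simp add: order_def FactGroup_def)
  have cA: "card ?A * card K = card M"
  proof -
    have "card K * card ?A = card (\<Union>?A)"
    proof (rule card_partition)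
      show "finite ?A" "finite (\<Union>?A)"
        using fin M.subset KM
          by (auto intro!: finite_subset[OF r_coset_subset_G] finite_subset[OF M.subset])
      show "card c = card K" if "c \<in> ?A" for c
        using that M.subset K.subset by (auto intro!: card_rcosets_equal[symmetric] rcosetsI)
      show "c1 \<inter> c2 = {}" if "c1 \<in> ?A" "c2 \<in> ?A" "c1 \<noteq> c2" for c1 c2
      proof -
        have "c1 \<in> rcosets K" "c2 \<in> rcosets K"
          using that(1,2) M.subset K.subset by (auto intro: rcosetsI)
        thus ?thesis using rcos_disjoint[OF Ksub] that(3) unfolding pairwise_def disjnt_def by blast
      qed
    qed
    also have "\<Union>?A = M"
    proof
      show "\<Union>?A \<subseteq> M" using KM by (auto simp: r_coset_def)
      show "M \<subseteq> \<Union>?A" using rcos_self[OF _ Ksub] M.subset by blast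
    qed
    finally show ?thesis by (simp add: mult.commute)
  qed
  have K0: "card K > 0" by (rule card_subgroup_pos[OF fin Ksub])
  have oQA: "order (G Mod K) = 2 ^ k * card ?A"
  proof -
    have "order (G Mod K) * card K = (2 ^ k * card ?A) * card K" using oQ idx cA
      by (simp add: mult.assoc)
    thus ?thesis using K0 by simp
  qed
  have "order (G Mod K) dvd 2 ^ n" using oQ ord by (metis dvd_triv_left)
  then obtain n' where n': "order (G Mod K) = 2 ^ n'"
    using divides_primepow_nat[of "2::nat" "order (G Mod K)" n] by auto
  have "card ?A ^ card ?Y \<le> order (G Mod K) ^ (card ?Y - 1) * 2 ^ card ?Y"
  proof (rule Q.central_elementary_bound[OF n'])
    show "subgroup ?A (G Mod K)" by (rule p.subgroup_img_is_subgroup[OF M.is_subgroup])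
    fix a assume "a \<in> ?A"
    then obtain m where m: "m \<in> M" "a = K #> m" by auto
    have mc: "m \<in> carrier G" using m M.subset by blast
    have "a \<otimes>\<^bsub>G Mod K\<^esub> a = K #> (m \<otimes> m)" unfolding m(2) mult_FactGroup
      by (rule K.rcos_sum[OF mc mc])
    also have "\<dots> = K" using coset_join2[OF _ Ksub sqK[OF m(1)]] mc by simp
    finally show "a \<otimes>\<^bsub>G Mod K\<^esub> a = \<one>\<^bsub>G Mod K\<^esub>" by simp
    fix g assume "g \<in> carrier (G Mod K)"
    then obtain b where b: "b \<in> carrier G" "g = K #> b" using im by auto
    have "(m \<otimes> b) \<otimes> inv (b \<otimes> m) = comm m b" using b mc by (simp add: inv_mult_group m_assoc)
    hence "K #> (m \<otimes> b) = K #> (b \<otimes> m)" using eqK[of "m \<otimes> b" "b \<otimes> m"] commK[OF m(1) b(1)] b mc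
      by simp
    thus "a \<otimes>\<^bsub>G Mod K\<^esub> g = g \<otimes>\<^bsub>G Mod K\<^esub> a"
      unfolding m(2) b(2) mult_FactGroup K.rcos_sum[OF mc b(1)] K.rcos_sum[OF b(1) mc] .
  next
    show "finite ?Y" using X by simp
    show "?Y \<subseteq> carrier (G Mod K)" using X im by blast
    show "generate (G Mod K) ?Y = carrier (G Mod K)" using p.generate_img[OF X(2)] X(3) im by simp
  qed
  \<comment> \<open>The order of \<open>G Mod K\<close> contains the factor \<open>card ?A\<close>,
    so a power of it stands on both sides; cancelling with exponent \<open>card ?Y - 1\<close>
    isolates a single \<open>card ?A\<close>.\<close>
  hence A1: "card ?A ^ card ?Y \<le> (2 ^ k * card ?A) ^ (card ?Y - 1) * 2 ^ card ?Y" using oQA by simp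
  have A0: "card ?A > 0" using cA card_subgroup_pos[OF fin M.is_subgroup]
    by (metis mult_0 neq0_conv)
  have Y: "card ?Y = Suc (card ?Y - 1)" using \<open>e > 0\<close> X by (auto simp: e_def card_gt_0_iff)
  have "card ?A * card ?A ^ (card ?Y - 1) = card ?A ^ card ?Y" by (subst (2) Y) simp
  also have "\<dots> \<le> (2 ^ k * card ?A) ^ (card ?Y - 1) * 2 ^ card ?Y" by (rule A1)
  also have "\<dots> = (2 ^ (k * (card ?Y - 1)) * 2 ^ card ?Y) * card ?A ^ (card ?Y - 1)"
    unfolding power_mult_distrib power_mult by (simp only: mult_ac)
  finally have "card ?A \<le> 2 ^ (k * (card ?Y - 1)) * 2 ^ card ?Y" using A0 by simp
  also have "\<dots> = 2 ^ (k * (card ?Y - 1) + card ?Y)" by (simp add: power_add)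
  also have "\<dots> \<le> 2 ^ ((e - 1) * k + e)"
  proof (rule power_increasing)
    have "card ?Y \<le> e" unfolding e_def by (rule card_image_le[OF X(1)])
    thus "k * (card ?Y - 1) + card ?Y \<le> (e - 1) * k + e"
      by (metis add_mono diff_le_mono mult.commute mult_le_mono1)
  qed simp
  finally have cA': "card ?A \<le> 2 ^ ((e - 1) * k + e)" .
  obtain Y where Y: "finite Y" "Y \<subseteq> M" "generate G (K \<union> Y) = M" "2 ^ card Y * card K \<le> card M"
    using generators_over_subgroup[OF fin M.is_subgroup Ksub KM] by blast
  have "inj_on (\<lambda>N. N \<inter> Y) ?S"
  proof (rule inj_onI)
    have half: "M \<inter> N1 \<subseteq> N2" if N: "N1 \<in> ?S" "N2 \<in> ?S" and eq: "N1 \<inter> Y = N2 \<inter> Y" for N1 N2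
    proof -
      interpret N1: normal N1 G using N by blast
      interpret N2: normal N2 G using N by blast
      \<comment> \<open>\<open>?E\<close> is where the two homomorphisms with kernels
        \<open>N1\<close> and \<open>N2\<close> agree: a subgroup, and it contains \<open>K\<close>
        and \<open>Y\<close>, which generate \<open>M\<close>.\<close>
      let ?E = "{m \<in> M. m \<in> N1 \<longleftrightarrow> m \<in> N2}"
      have inN: "m \<otimes> m' \<in> N \<longleftrightarrow> (m \<in> N \<longleftrightarrow> m' \<in> N)" if "m \<in> M" "m' \<in> M" "N \<in> ?S" for m m' N
      proof -
        interpret N: normal N G using that by blast
        have c: "m \<in> carrier G" "m' \<in> carrier G" using that M.subset by auto
        have iv: "inv m' \<in> N \<longleftrightarrow> m' \<in> N" using c by (metis N.m_inv_closed inv_inv)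
        show ?thesis
        proof
          assume "m \<in> N \<longleftrightarrow> m' \<in> N"
          hence "m \<otimes> inv (inv m') \<in> N" using id2[OF that(3,1), of "inv m'"] that iv by simp
          thus "m \<otimes> m' \<in> N" using c by simp
        next
          assume a: "m \<otimes> m' \<in> N"
          show "m \<in> N \<longleftrightarrow> m' \<in> N"
          proof
            assume "m \<in> N"
            hence "inv m \<otimes> (m \<otimes> m') \<in> N" using a by blast
            thus "m' \<in> N" using c by simp
          next
            assume "m' \<in> N"
            hence "(m \<otimes> m') \<otimes> inv m' \<in> N" using a by blast
            thus "m \<in> N" using c by (simp add: m_assoc)
          qed
        qed
      qed
      have E: "subgroup ?E G"
      proof (rule subgroupI)
        show "?E \<noteq> {}" using M.one_closed N1.one_closed N2.one_closed by blast
        show "?E \<subseteq> carrier G" using M.subset by blast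
        fix a assume a: "a \<in> ?E"
        have "inv a \<in> N \<longleftrightarrow> a \<in> N" if "N \<in> ?S" for N
          using subgroup.m_inv_closed[OF subS[OF that]] a M.subset
            by (metis (lifting) inv_inv mem_Collect_eq subsetD)
        thus "inv a \<in> ?E" using a N by simp
        fix b assume "b \<in> ?E"
        thus "a \<otimes> b \<in> ?E" using a inN[OF _ _ N(1)] inN[OF _ _ N(2)] by simp
      qed
      have "K \<union> Y \<subseteq> ?E" using KM Y(2) N eq unfolding K_def by blast
      hence "M \<subseteq> ?E" using generate_subgroup_incl[OF _ E] Y(3) by metis
      thus ?thesis by blast
    qed
    fix N1 N2 assume "N1 \<in> ?S" "N2 \<in> ?S" "N1 \<inter> Y = N2 \<inter> Y"
    thus "N1 = N2" using half[of N1 N2] half[of N2 N1] by blast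
  qed
  hence "card ?S \<le> card (Pow Y)" by (rule card_inj_on_le) (use Y in auto)
  also have "\<dots> = 2 ^ card Y" using Y(1) by (rule card_Pow)
  also have "\<dots> \<le> card ?A"
  proof -
    have "2 ^ card Y * card K \<le> card ?A * card K" using Y(4) cA by simp
    thus ?thesis using K0 by simp
  qed
  finally show ?thesis using cA' unfolding e_def by linarith
qed

lemma card_normal_subgroups_le:
  assumes ord: "order G = 2 ^ n" and X: "finite X" "X \<subseteq> carrier G" "generate G X = carrier G"
  shows "card {N. N \<lhd> G \<and> order G = 2 ^ k * card N} \<le> 2 ^ (\<Sum>i<k. (card X - 1) * i + card X)"
proof (induction k)
  have fin: "finite (carrier G)" using ord order_gt_0_iff_finite by simp
  case 0
  have "{N. N \<lhd> G \<and> order G = 2 ^ 0 * card N} \<subseteq> {carrier G}"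
  proof
    fix N assume "N \<in> {N. N \<lhd> G \<and> order G = 2 ^ 0 * card N}"
    hence N: "N \<lhd> G" "card N = card (carrier G)" by (auto simp: order_def)
    have "N \<subseteq> carrier G" by (rule subgroup.subset[OF normal_imp_subgroup[OF N(1)]])
    thus "N \<in> {carrier G}" using fin N(2) by (simp add: card_subset_eq)
  qed
  hence "card {N. N \<lhd> G \<and> order G = 2 ^ 0 * card N} \<le> card {carrier G}"
    by (rule card_mono[rotated]) simp
  thus ?case by simp
next
  have fin: "finite (carrier G)" using ord order_gt_0_iff_finite by simp
  case (Suc k)
  let ?S = "\<lambda>k. {N. N \<lhd> G \<and> order G = 2 ^ k * card N}"
  let ?T = "\<lambda>M. {N. N \<lhd> G \<and> N \<subseteq> M \<and> 2 * card N = card M}"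
  have finS: "finite (?S k)" for k
    by (rule finite_subset[of _ "Pow (carrier G)"])
      (use fin normal_imp_subgroup subgroup.subset in blast)+
  \<comment> \<open>The same \<open>N\<close> may lie below several \<open>M\<close>; the union
    bound tolerates this overcount.\<close>
  have "?S (Suc k) \<subseteq> (\<Union>M\<in>?S k. ?T M)"
  proof
    fix N assume "N \<in> ?S (Suc k)"
    hence N: "N \<lhd> G" "order G = 2 ^ Suc k * card N" by auto
    interpret N: normal N G by fact
    have "N \<noteq> carrier G"
    proof
      assume "N = carrier G"
      hence "card N = 2 * 2 ^ k * card N" using N(2) by (simp add: order_def)
      moreover have "card N > 0" by (rule card_subgroup_pos[OF fin N.is_subgroup])
      ultimately show False by (simp add: mult.assoc)
    qed
    hence "N \<subset> carrier G" using N.subset by blast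
    then obtain z where z: "z \<in> carrier G" "z \<notin> N" "z \<otimes> z \<in> N" "\<And>g. g \<in> carrier G \<Longrightarrow> comm z g \<in> N"
      using two_group_normal_step[OF ord N(1) normal_self] by metis
    have "N \<union> (N #> z) \<lhd> G" by (rule adjoin_central[OF N(1) z(1,3,4)])
    moreover have "card (N \<union> (N #> z)) = 2 * card N"
      by (rule card_adjoin_eq[OF fin N.is_subgroup z(1,2)])
    ultimately show "N \<in> (\<Union>M\<in>?S k. ?T M)"
      using N by (intro UN_I[of "N \<union> (N #> z)"]) auto
  qed
  moreover have "finite (\<Union>M\<in>?S k. ?T M)"
    by (rule finite_subset[of _ "Pow (carrier G)"])
      (use fin normal_imp_subgroup subgroup.subset in blast)+
  ultimately have "card (?S (Suc k)) \<le> card (\<Union>M\<in>?S k. ?T M)" by (metis (lifting) card_mono)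
  also have "\<dots> \<le> (\<Sum>M\<in>?S k. card (?T M))" by (rule card_UN_le[OF finS])
  also have "\<dots> \<le> (\<Sum>M\<in>?S k. 2 ^ ((card X - 1) * k + card X))"
    using card_index_two_normal_le[OF ord X] by (intro sum_mono) auto
  also have "\<dots> = card (?S k) * 2 ^ ((card X - 1) * k + card X)" by simp
  also have "\<dots> \<le> 2 ^ (\<Sum>i<k. (card X - 1) * i + card X) * 2 ^ ((card X - 1) * k + card X)"
    by (rule mult_le_mono1[OF Suc.IH])
  also have "\<dots> = 2 ^ (\<Sum>i<Suc k. (card X - 1) * i + card X)" by (simp add: power_add)
  finally show ?case .
qed

end

section \<open>The upper bound\<close>

lemma iso_if_same_kernel:
  assumes "group_hom G A f" "group_hom G B h"
    and "f ` carrier G = carrier A" "h ` carrier G = carrier B"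
    and "kernel G A f = kernel G B h"
  shows "A \<cong> B"
proof -
  interpret f: group_hom G A f by fact
  interpret h: group_hom G B h by fact
  have "G Mod kernel G A f \<cong> A" by (rule f.FactGroup_iso[OF assms(3)])
  hence "A \<cong> G Mod kernel G A f"
    using group.iso_sym normal.factorgroup_is_group[OF f.normal_kernel] by blast
  moreover have "G Mod kernel G A f \<cong> B" using h.FactGroup_iso[OF assms(4)] assms(5) by simp
  ultimately show ?thesis by (rule iso_trans)
qed

lemma involution_iff:
  assumes "group G"
  shows "involution G x \<longleftrightarrow> x \<in> carrier G \<and> x \<noteq> \<one>\<^bsub>G\<^esub> \<and> x \<otimes>\<^bsub>G\<^esub> x = \<one>\<^bsub>G\<^esub>"
proof (cases "x \<in> carrier G")
  case True
  interpret group G by fact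
  have sq: "x [^]\<^bsub>G\<^esub> (2::nat) = x \<otimes>\<^bsub>G\<^esub> x" using True by (simp add: numeral_2_eq_2)
  show ?thesis
  proof
    assume "involution G x"
    hence o: "ord x = 2" by (simp add: involution_def)
    have "x \<otimes>\<^bsub>G\<^esub> x = \<one>\<^bsub>G\<^esub>" using pow_ord_eq_1[OF True] sq o by simp
    moreover have "x \<noteq> \<one>\<^bsub>G\<^esub>" using o ord_eq_1[OF True] by auto
    ultimately show "x \<in> carrier G \<and> x \<noteq> \<one>\<^bsub>G\<^esub> \<and> x \<otimes>\<^bsub>G\<^esub> x = \<one>\<^bsub>G\<^esub>" using True by simp
  next
    assume a: "x \<in> carrier G \<and> x \<noteq> \<one>\<^bsub>G\<^esub> \<and> x \<otimes>\<^bsub>G\<^esub> x = \<one>\<^bsub>G\<^esub>"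
    hence "ord x dvd 2" using pow_eq_id[OF True, of 2] sq by simp
    moreover have "ord x \<noteq> 1" using a ord_eq_1 by blast
    ultimately have "ord x = 2" using two_is_prime_nat prime_nat_iff by metis
    thus "involution G x" using True by (simp add: involution_def)
  qed
qed (simp add: involution_def)

text \<open>\<open>F\<close> consists of the words of even length. Conjugation by \<open>a k\<close>
  inverts each generator \<open>a k \<otimes> a i\<close> of \<open>F\<close>, so \<open>F\<close>
  is normalized by \<open>a k\<close> and together with one coset fills the generated group.\<close>

lemma (in group) generate_involutions_subset:
  assumes a: "\<And>i. i \<in> I \<Longrightarrow> a i \<in> carrier G" "\<And>i. i \<in> I \<Longrightarrow> a i \<otimes> a i = \<one>" and k: "k \<in> I"
  defines "F \<equiv> generate G ((\<lambda>i. a k \<otimes> a i) ` (I - {k}))"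
  assumes g: "g \<in> generate G (a ` I)"
  shows "g \<in> F \<or> g \<otimes> a k \<in> F"
proof -
  have kc: "a k \<in> carrier G" and kk: "a k \<otimes> a k = \<one>" using a k by auto
  have kk': "a k \<otimes> (a k \<otimes> x) = x" if "x \<in> carrier G" for x
    using kk kc that by (simp flip: m_assoc)
  have inva: "inv (a i) = a i" if "i \<in> I" for i using a that by (simp add: inv_equality)
  have Fs: "subgroup F G" unfolding F_def using a kc by (intro generate_is_subgroup) auto
  interpret F: subgroup F G by fact
  have Fc: "f \<in> carrier G" if "f \<in> F" for f using that F.subset by blast
  have conj: "a k \<otimes> f \<otimes> a k \<in> F" if "f \<in> F" for f
    using that unfolding F_def
  proof (induction rule: generate.induct)
    case one
    show ?case using kc kk by (simp add: generate.one)
  next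
    case (incl h)
    then obtain i where i: "i \<in> I - {k}" "h = a k \<otimes> a i" by auto
    have "a k \<otimes> h \<otimes> a k = inv (a k \<otimes> a i)" using i a kc kk' inva k by (simp add: inv_mult_group)
    thus ?case using i by (metis generate.inv image_eqI)
  next
    case (inv h)
    then obtain i where i: "i \<in> I - {k}" "h = a k \<otimes> a i" by auto
    have "a k \<otimes> inv h \<otimes> a k = a k \<otimes> a i" using i a kc kk inva k
      by (simp add: inv_mult_group m_assoc)
    thus ?case using i by (metis generate.incl image_eqI)
  next
    case (eng h1 h2)
    have c: "h1 \<in> carrier G" "h2 \<in> carrier G" using eng(1,2) Fc unfolding F_def by auto
    have "a k \<otimes> (h1 \<otimes> h2) \<otimes> a k = (a k \<otimes> h1 \<otimes> a k) \<otimes> (a k \<otimes> h2 \<otimes> a k)"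
      using c kc kk' by (simp add: m_assoc)
    thus ?case using generate.eng[OF eng(3,4)] by simp
  qed
  let ?S = "{g \<in> carrier G. g \<in> F \<or> g \<otimes> a k \<in> F}"
  have "subgroup ?S G"
  proof (rule subgroupI)
    show "?S \<subseteq> carrier G" by blast
    show "?S \<noteq> {}" using F.one_closed by blast
    fix g assume g: "g \<in> ?S"
    hence gc: "g \<in> carrier G" by simp
    show "inv g \<in> ?S"
    proof (cases "g \<in> F")
      case False
      hence f: "g \<otimes> a k \<in> F" using g by simp
      have "inv g \<otimes> a k = a k \<otimes> inv (g \<otimes> a k) \<otimes> a k"
        using gc kc kk' inva[OF k] by (simp add: inv_mult_group m_assoc)
      thus ?thesis using conj[OF F.m_inv_closed[OF f]] gc by simp
    qed (use gc in simp)
    fix h assume h: "h \<in> ?S"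
    hence hc: "h \<in> carrier G" by simp
    consider "g \<in> F" "h \<in> F" | "g \<in> F" "h \<otimes> a k \<in> F" | "g \<otimes> a k \<in> F" "h \<in> F" | "g \<otimes> a k \<in> F" "h \<otimes> a k \<in> F"
      using g h by blast
    thus "g \<otimes> h \<in> ?S"
    proof cases
      case 1
      thus ?thesis using gc hc by simp
    next
      case 2
      hence "g \<otimes> (h \<otimes> a k) \<in> F" by simp
      thus ?thesis using gc hc kc by (simp add: m_assoc)
    next
      case 3
      hence "(g \<otimes> a k) \<otimes> (a k \<otimes> h \<otimes> a k) \<in> F" using conj by simp
      thus ?thesis using gc hc kc kk' by (simp add: m_assoc)
    next
      case 4
      hence "(g \<otimes> a k) \<otimes> (a k \<otimes> (h \<otimes> a k) \<otimes> a k) \<in> F" using conj by simp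
      thus ?thesis using gc hc kc kk kk' by (simp add: m_assoc)
    qed
  qed
  moreover have "a ` I \<subseteq> ?S"
  proof
    fix x assume "x \<in> a ` I"
    then obtain i where i: "i \<in> I" "x = a i" by auto
    show "x \<in> ?S"
    proof (cases "i = k")
      case True
      thus ?thesis using i kc kk F.one_closed by simp
    next
      case False
      hence "a k \<otimes> a i \<in> F" unfolding F_def using i by (intro generate.incl) auto
      hence "inv (a k \<otimes> a i) \<in> F" by simp
      thus ?thesis using i a kc inva k by (simp add: inv_mult_group)
    qed
  qed
  ultimately have "generate G (a ` I) \<subseteq> ?S" by (intro generate_subgroup_incl)
  thus ?thesis using g by blast
qed

section \<open>Class representatives and their common cover\<close>

definition class_rep :: "nat monoid set \<Rightarrow> nat monoid" where
  "class_rep C = (SOME G. G \<in> C)"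

context
  fixes d m :: nat
begin

abbreviation "inv_classes \<equiv> involution_groups d m // group_iso_rel (involution_groups d m)"

lemma equiv_inv_groups: "equiv (involution_groups d m) (group_iso_rel (involution_groups d m))"
  by (rule equiv_group_iso_rel) (simp add: involution_groups_def)

lemma class_rep_in:
  assumes "C \<in> inv_classes"
  shows "class_rep C \<in> C" "class_rep C \<in> involution_groups d m"
proof -
  have "C \<noteq> {}" by (rule in_quotient_imp_non_empty[OF equiv_inv_groups assms])
  thus 1: "class_rep C \<in> C" unfolding class_rep_def by (metis some_in_eq)
  show "class_rep C \<in> involution_groups d m"
    using 1 in_quotient_imp_subset[OF equiv_inv_groups assms] by blast
qed

lemma class_rep_iso_imp_eq:
  assumes "C \<in> inv_classes" "C' \<in> inv_classes" "class_rep C \<cong> class_rep C'"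
  shows "C = C'"
  using quotient_eq_iff[OF equiv_inv_groups assms(1,2) class_rep_in(1)[OF assms(1)] class_rep_in(1)[OF assms(2)]]
    assms(3) class_rep_in(2)[OF assms(1)] class_rep_in(2)[OF assms(2)]
  by (simp add: group_iso_rel_def)

text \<open>In a group of order \<open>2 ^ m\<close> the even words form a subgroup of index 1 or 2.
  Accordingly the kernel in the common even part has index \<open>2 ^ m\<close> or
  \<open>2 ^ (m - 1)\<close>; the two summands count these two kinds of kernels.\<close>

lemma num_involution_groups_le:
  assumes d: "d \<ge> 1" and m: "m \<ge> 1"
  shows "num_involution_groups d m \<le>
    2 ^ (\<Sum>i<m. (d - 2) * i + (d - 1)) + 2 ^ (\<Sum>i<m - 1. (d - 2) * i + (d - 1))"
proof -
  let ?r = class_rep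
  let ?Cs = inv_classes
  have finC: "finite ?Cs" by (rule finite_involution_group_classes)
  have r: "group (?r C)" "order (?r C) = 2 ^ m" "generated_by_involutions d (?r C)"
    if "C \<in> ?Cs" for C
    using class_rep_in(2)[OF that] by (auto simp: involution_groups_def)
  have "\<exists>xs. (\<forall>i<d. xs i \<in> carrier (?r C) \<and> xs i \<otimes>\<^bsub>?r C\<^esub> xs i = \<one>\<^bsub>?r C\<^esub>) \<and> generate (?r C) (xs ` {..<d}) = carrier (?r C)"
    if C: "C \<in> ?Cs" for C
  proof -
    obtain S where S: "finite S" "card S = d" "\<forall>x\<in>S. involution (?r C) x" "generate (?r C) S = carrier (?r C)"
      using r(3)[OF C] unfolding generated_by_involutions_def by blast
    obtain xs where "bij_betw xs {..<d} S"
      using S(1,2) ex_bij_betw_nat_finite[of S] by (auto simp: atLeast0LessThan)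
    hence im: "xs ` {..<d} = S" by (simp add: bij_betw_def)
    have "xs i \<in> carrier (?r C) \<and> xs i \<otimes>\<^bsub>?r C\<^esub> xs i = \<one>\<^bsub>?r C\<^esub>" if "i < d" for i
    proof -
      have "xs i \<in> S" using im that by blast
      thus ?thesis using S(3) involution_iff[OF r(1)[OF C]] by blast
    qed
    thus ?thesis using im S(4) by blast
  qed
  then obtain xs where xs: "\<And>C i. C \<in> ?Cs \<Longrightarrow> i < d \<Longrightarrow> xs C i \<in> carrier (?r C) \<and> xs C i \<otimes>\<^bsub>?r C\<^esub> xs C i = \<one>\<^bsub>?r C\<^esub>"
    and gen: "\<And>C. C \<in> ?Cs \<Longrightarrow> generate (?r C) (xs C ` {..<d}) = carrier (?r C)" by metis
  \<comment> \<open>Projection to the factor \<open>C\<close> sends \<open>x i\<close> to the chosen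
    involution \<open>xs C i\<close>, so the subgroup generated by the \<open>x i\<close> maps onto
    every representative.\<close>
  define P where "P = product_group ?Cs ?r"
  define x where "x i = (\<lambda>C\<in>?Cs. xs C i)" for i
  interpret P: group P unfolding P_def using r(1) by simp
  have xP: "x i \<in> carrier P" "x i \<otimes>\<^bsub>P\<^esub> x i = \<one>\<^bsub>P\<^esub>" if "i < d" for i
    using xs that by (auto simp: P_def x_def)
  have pr: "group_hom P (?r C) (\<lambda>f. f C)" if "C \<in> ?Cs" for C
    using r(1)[OF that] that P.is_group
    by (auto simp: group_hom_def group_hom_axioms_def hom_def P_def)
  have "order P = (2 ^ m) ^ card ?Cs"
    using r(2) by (simp add: P_def order_def card_PiE[OF finC])
  hence oP: "order P = 2 ^ (m * card ?Cs)" by (simp add: power_mult)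
  hence finP: "finite (carrier P)" using P.order_gt_0_iff_finite by simp
  define \<Gamma> where "\<Gamma> = generate P (x ` {..<d})"
  define Y where "Y = (\<lambda>i. x 0 \<otimes>\<^bsub>P\<^esub> x i) ` ({..<d} - {0})"
  define F where "F = generate P Y"
  have Yc: "Y \<subseteq> carrier P" using xP d by (auto simp: Y_def simp del: mult_product_group)
  have \<Gamma>s: "subgroup \<Gamma> P" unfolding \<Gamma>_def using xP by (intro P.generate_is_subgroup) auto
  have Fs: "subgroup F P" unfolding F_def by (rule P.generate_is_subgroup[OF Yc])
  have x\<Gamma>: "x i \<in> \<Gamma>" if "i < d" for i unfolding \<Gamma>_def using that by (intro generate.incl) auto
  have "Y \<subseteq> \<Gamma>" using x\<Gamma> d subgroup.m_closed[OF \<Gamma>s] by (auto simp: Y_def)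
  hence F\<Gamma>: "F \<subseteq> \<Gamma>" unfolding F_def by (rule P.generate_subgroup_incl[OF _ \<Gamma>s])
  have split: "g \<in> F \<or> g \<otimes>\<^bsub>P\<^esub> x 0 \<in> F" if "g \<in> \<Gamma>" for g
    unfolding F_def Y_def
    by (rule P.generate_involutions_subset) (use xP d that in \<open>auto simp: \<Gamma>_def\<close>)
  let ?GF = "P\<lparr>carrier := F\<rparr>" and ?G\<Gamma> = "P\<lparr>carrier := \<Gamma>\<rparr>"
  interpret GF: group ?GF by (rule P.subgroup_imp_group[OF Fs])
  interpret G\<Gamma>: group ?G\<Gamma> by (rule P.subgroup_imp_group[OF \<Gamma>s])
  have homF: "group_hom ?GF (?r C) (\<lambda>f. f C)" if "C \<in> ?Cs" for C
    using group_hom.induced_group_hom'[OF pr[OF that] Fs] .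
  have hom\<Gamma>: "group_hom ?G\<Gamma> (?r C) (\<lambda>f. f C)" if "C \<in> ?Cs" for C
    using group_hom.induced_group_hom'[OF pr[OF that] \<Gamma>s] .
  have im\<Gamma>: "(\<lambda>f. f C) ` \<Gamma> = carrier (?r C)" if C: "C \<in> ?Cs" for C
  proof -
    have "generate (?r C) ((\<lambda>f. f C) ` x ` {..<d}) = (\<lambda>f. f C) ` \<Gamma>"
      unfolding \<Gamma>_def by (rule group_hom.generate_img[OF pr[OF C]]) (use xP in auto)
    moreover have "(\<lambda>f. f C) ` x ` {..<d} = xs C ` {..<d}" using C by (auto simp: x_def image_image)
    ultimately show ?thesis using gen[OF C] by simp
  qed
  have "card F dvd 2 ^ (m * card ?Cs)" using P.lagrange[OF Fs] oP by (metis dvd_triv_right)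
  then obtain n where n: "order ?GF = 2 ^ n"
    using divides_primepow_nat[of "2::nat" "card F" "m * card ?Cs"] by (auto simp: order_def)
  have finF: "finite F" using finP subgroup.subset[OF Fs] finite_subset by blast
  \<comment> \<open>\<open>b C\<close> tells whether even words already fill
    \<open>class_rep C\<close>. If so, this group is the quotient of \<open>F\<close> by
    \<open>N C\<close>, otherwise that of \<open>\<Gamma>\<close> by the same subgroup; hence the
    pair of \<open>b C\<close> and \<open>N C\<close> determines the class.\<close>
  define N where "N C = kernel ?GF (?r C) (\<lambda>f. f C)" for C
  define b where "b C \<longleftrightarrow> (\<lambda>f. f C) ` F = carrier (?r C)" for C
  have cF: "card (N C) * card ((\<lambda>f. f C) ` F) = order ?GF" if "C \<in> ?Cs" for C
    using group_hom.card_kernel_image[OF homF[OF that]] finF by (simp add: N_def)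
  have Nn: "N C \<lhd> ?GF" if "C \<in> ?Cs" for C
    unfolding N_def by (rule group_hom.normal_kernel[OF homF[OF that]])
  \<comment> \<open>If the image of \<open>F\<close> contained \<open>xs C 0\<close>, it would also
    contain the image of the odd words and thus be everything.\<close>
  have x0: "xs C 0 \<notin> (\<lambda>f. f C) ` F" if C: "C \<in> ?Cs" and nb: "\<not> b C" for C
  proof
    assume a: "xs C 0 \<in> (\<lambda>f. f C) ` F"
    have S: "subgroup ((\<lambda>f. f C) ` F) (?r C)"
      by (rule group_hom.subgroup_img_is_subgroup[OF pr[OF C] Fs])
    interpret R: group "?r C" by (rule r(1)[OF C])
    have "g \<in> (\<lambda>f. f C) ` F" if g: "g \<in> carrier (?r C)" for g
    proof -
      obtain \<gamma> where \<gamma>: "\<gamma> \<in> \<Gamma>" "g = \<gamma> C" using g im\<Gamma>[OF C] by auto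
      from split[OF \<gamma>(1)] show ?thesis
      proof
        assume "\<gamma> \<in> F" thus ?thesis using \<gamma> by blast
      next
        assume f: "\<gamma> \<otimes>\<^bsub>P\<^esub> x 0 \<in> F"
        have "(\<gamma> \<otimes>\<^bsub>P\<^esub> x 0) C = g \<otimes>\<^bsub>?r C\<^esub> xs C 0" using C \<gamma> by (simp add: P_def x_def)
        hence "g \<otimes>\<^bsub>?r C\<^esub> xs C 0 \<in> (\<lambda>f. f C) ` F" using imageI[OF f, of "\<lambda>f. f C"] by simp
        hence "g \<otimes>\<^bsub>?r C\<^esub> xs C 0 \<otimes>\<^bsub>?r C\<^esub> xs C 0 \<in> (\<lambda>f. f C) ` F" using a subgroup.m_closed[OF S]
          by blast
        thus ?thesis using g xs[OF C, of 0] d by (simp add: R.m_assoc)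
      qed
    qed
    hence "b C" unfolding b_def using subgroup.subset[OF S] by blast
    thus False using nb by blast
  qed
  have half: "2 * card ((\<lambda>f. f C) ` F) = 2 ^ m" if C: "C \<in> ?Cs" and nb: "\<not> b C" for C
  proof -
    have S: "subgroup ((\<lambda>f. f C) ` F) (?r C)"
      by (rule group_hom.subgroup_img_is_subgroup[OF pr[OF C] Fs])
    interpret R: group "?r C" by (rule r(1)[OF C])
    have fin: "finite (carrier (?r C))" using r(2)[OF C] R.order_gt_0_iff_finite by simp
    have y: "xs C 0 \<in> carrier (?r C)" "xs C 0 \<otimes>\<^bsub>?r C\<^esub> xs C 0 = \<one>\<^bsub>?r C\<^esub>" using xs[OF C, of 0] d
      by auto
    let ?I = "(\<lambda>f. f C) ` F"
    have "?I \<union> (?I #>\<^bsub>?r C\<^esub> xs C 0) = carrier (?r C)"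
    proof
      show "?I \<union> (?I #>\<^bsub>?r C\<^esub> xs C 0) \<subseteq> carrier (?r C)"
        using R.r_coset_subset_G[OF subgroup.subset[OF S] y(1)] subgroup.subset[OF S] by blast
      show "carrier (?r C) \<subseteq> ?I \<union> (?I #>\<^bsub>?r C\<^esub> xs C 0)"
      proof
        fix g assume g: "g \<in> carrier (?r C)"
        obtain \<gamma> where \<gamma>: "\<gamma> \<in> \<Gamma>" "g = \<gamma> C" using g im\<Gamma>[OF C] by auto
        from split[OF \<gamma>(1)] show "g \<in> ?I \<union> (?I #>\<^bsub>?r C\<^esub> xs C 0)"
        proof
          assume f: "\<gamma> \<otimes>\<^bsub>P\<^esub> x 0 \<in> F"
          have "(\<gamma> \<otimes>\<^bsub>P\<^esub> x 0) C = g \<otimes>\<^bsub>?r C\<^esub> xs C 0" using C \<gamma> by (simp add: P_def x_def)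
          hence "g \<otimes>\<^bsub>?r C\<^esub> xs C 0 \<in> ?I" using imageI[OF f, of "\<lambda>f. f C"] by simp
          moreover have "g = (g \<otimes>\<^bsub>?r C\<^esub> xs C 0) \<otimes>\<^bsub>?r C\<^esub> xs C 0" using g y by (simp add: R.m_assoc)
          ultimately show ?thesis unfolding r_coset_def by blast
        qed (use \<gamma> in blast)
      qed
    qed
    thus ?thesis using R.card_adjoin_eq[OF fin S y(1) x0[OF C nb]] r(2)[OF C]
      by (simp add: order_def)
  qed
  \<comment> \<open>For an element \<open>g\<close> of the kernel outside \<open>F\<close>, the even
    element obtained by multiplying with \<open>x 0\<close> would map to \<open>xs C 0\<close>,
    which is not in the image of \<open>F\<close>.\<close>
  have ker\<Gamma>: "kernel ?G\<Gamma> (?r C) (\<lambda>f. f C) = N C" if C: "C \<in> ?Cs" and nb: "\<not> b C" for C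
  proof
    show "N C \<subseteq> kernel ?G\<Gamma> (?r C) (\<lambda>f. f C)" using F\<Gamma> by (auto simp: N_def kernel_def)
    show "kernel ?G\<Gamma> (?r C) (\<lambda>f. f C) \<subseteq> N C"
    proof
      interpret R: group "?r C" by (rule r(1)[OF C])
      fix g assume "g \<in> kernel ?G\<Gamma> (?r C) (\<lambda>f. f C)"
      hence g: "g \<in> \<Gamma>" "g C = \<one>\<^bsub>?r C\<^esub>" by (auto simp: kernel_def)
      have "g \<in> F"
      proof (rule ccontr)
        assume "g \<notin> F"
        hence f: "g \<otimes>\<^bsub>P\<^esub> x 0 \<in> F" using split[OF g(1)] by blast
        have "(g \<otimes>\<^bsub>P\<^esub> x 0) C = xs C 0" using C g xs[OF C, of 0] d by (simp add: P_def x_def)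
        hence "xs C 0 \<in> (\<lambda>f. f C) ` F" using imageI[OF f, of "\<lambda>f. f C"] by simp
        thus False using x0[OF C nb] by blast
      qed
      thus "g \<in> N C" using g by (simp add: N_def kernel_def)
    qed
  qed
  let ?T = "\<lambda>k. {K. K \<lhd> ?GF \<and> order ?GF = 2 ^ k * card K}"
  have genY: "generate ?GF Y = carrier ?GF"
  proof -
    have "Y \<subseteq> F" unfolding F_def by (rule P.subset_generate)
    thus ?thesis using P.generate_consistent[OF _ Fs] by (simp add: F_def)
  qed
  have cT: "card (?T k) \<le> 2 ^ (\<Sum>i<k. (d - 2) * i + (d - 1))" for k
  proof -
    have fY: "finite Y" by (simp add: Y_def)
    have "card Y \<le> card ({..<d} - {0})" unfolding Y_def by (rule card_image_le) simp
    hence cY: "card Y \<le> d - 1" using d by simp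
    have "Y \<subseteq> carrier ?GF" using P.subset_generate by (simp add: F_def)
    hence "card (?T k) \<le> 2 ^ (\<Sum>i<k. (card Y - 1) * i + card Y)"
      by (rule GF.card_normal_subgroups_le[OF n fY _ genY])
    also have "\<dots> \<le> 2 ^ (\<Sum>i<k. (d - 2) * i + (d - 1))"
    proof (rule power_increasing)
      have "(card Y - 1) * i + card Y \<le> (d - 2) * i + (d - 1)" for i
      proof (rule add_mono[OF mult_le_mono1 cY])
        show "card Y - 1 \<le> d - 2" using cY by simp
      qed
      thus "(\<Sum>i<k. (card Y - 1) * i + card Y) \<le> (\<Sum>i<k. (d - 2) * i + (d - 1))" by (intro sum_mono)
    qed simp
    finally show ?thesis .
  qed
  have finT: "finite (?T k)" for k
  proof (rule finite_subset[of _ "Pow F"])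
    show "?T k \<subseteq> Pow F" using normal_imp_subgroup[of _ ?GF] subgroup.subset[of _ ?GF] by fastforce
  qed (use finF in simp)
  have "inj_on (\<lambda>C. (b C, N C)) ?Cs"
  proof (rule inj_onI)
    fix C C' assume C: "C \<in> ?Cs" "C' \<in> ?Cs" and eq: "(b C, N C) = (b C', N C')"
    have "?r C \<cong> ?r C'"
    proof (cases "b C")
      case True
      show ?thesis
        by (rule iso_if_same_kernel[OF homF[OF C(1)] homF[OF C(2)]])
          (use True eq in \<open>simp_all add: b_def N_def\<close>)
    next
      case False
      show ?thesis
        by (rule iso_if_same_kernel[OF hom\<Gamma>[OF C(1)] hom\<Gamma>[OF C(2)]])
          (use False eq im\<Gamma> C ker\<Gamma> in simp_all)
    qed
    thus "C = C'" using class_rep_iso_imp_eq C by blast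
  qed
  moreover have "(\<lambda>C. (b C, N C)) ` ?Cs \<subseteq> {True} \<times> ?T m \<union> {False} \<times> ?T (m - 1)"
  proof (rule image_subsetI)
    fix C assume C: "C \<in> ?Cs"
    show "(b C, N C) \<in> {True} \<times> ?T m \<union> {False} \<times> ?T (m - 1)"
    proof (cases "b C")
      case True
      hence "card ((\<lambda>f. f C) ` F) = 2 ^ m" using r(2)[OF C] by (simp add: b_def order_def)
      hence "order ?GF = 2 ^ m * card (N C)" using cF[OF C] by (metis mult.commute)
      thus ?thesis using True Nn[OF C] by simp
    next
      case False
      have "(2::nat) ^ m = 2 * 2 ^ (m - 1)" using m
        by (metis Suc_diff_1 less_le_trans power_Suc zero_less_one)
      hence "card ((\<lambda>f. f C) ` F) = 2 ^ (m - 1)" using half[OF C False] by simp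
      hence "order ?GF = 2 ^ (m - 1) * card (N C)" using cF[OF C] by (metis mult.commute)
      thus ?thesis using False Nn[OF C] by simp
    qed
  qed
  ultimately have "card ?Cs \<le> card ({True} \<times> ?T m \<union> {False} \<times> ?T (m - 1))"
    by (rule card_inj_on_le) (use finT in simp)
  also have "\<dots> \<le> card (?T m) + card (?T (m - 1))"
    by (rule order_trans[OF card_Un_le]) (simp add: card_cartesian_product)
  also have "\<dots> \<le> 2 ^ (\<Sum>i<m. (d - 2) * i + (d - 1)) + 2 ^ (\<Sum>i<m - 1. (d - 2) * i + (d - 1))"
    by (rule add_mono[OF cT cT])
  finally show ?thesis by (simp add: num_involution_groups_def)
qed

end

section \<open>Counting central quotients\<close>

lemma generated_by_involutions_iso:
  assumes G: "group G" and H: "group H" and \<phi>: "\<phi> \<in> iso G H" and g: "generated_by_involutions d G"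
  shows "generated_by_involutions d H"
proof -
  interpret \<phi>: group_hom G H \<phi>
    using G H \<phi> by (simp add: group_hom_def group_hom_axioms_def iso_imp_homomorphism)
  have inj: "inj_on \<phi> (carrier G)" and im: "\<phi> ` carrier G = carrier H"
    using \<phi> by (auto simp: iso_def bij_betw_def)
  obtain S where S: "finite S" "card S = d" "\<forall>x\<in>S. involution G x" "generate G S = carrier G"
    using g unfolding generated_by_involutions_def by blast
  have Sc: "S \<subseteq> carrier G" using S(3) by (auto simp: involution_def)
  have "involution H (\<phi> x)" if "x \<in> S" for x
  proof -
    have x: "x \<in> carrier G" "x \<noteq> \<one>\<^bsub>G\<^esub>" "x \<otimes>\<^bsub>G\<^esub> x = \<one>\<^bsub>G\<^esub>"
      using S(3) that involution_iff[OF G] by auto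
    have "\<phi> x \<noteq> \<phi> \<one>\<^bsub>G\<^esub>" using x inj by (metis \<phi>.G.one_closed inj_onD)
    moreover have "\<phi> x \<otimes>\<^bsub>H\<^esub> \<phi> x = \<one>\<^bsub>H\<^esub>" using x by (metis \<phi>.hom_mult \<phi>.hom_one)
    ultimately show ?thesis using x involution_iff[OF H] by simp
  qed
  moreover have "card (\<phi> ` S) = d" using S(2) card_image[OF inj_on_subset[OF inj Sc]] by simp
  moreover have "generate H (\<phi> ` S) = carrier H" using \<phi>.generate_img[OF Sc] S(4) im by simp
  ultimately show ?thesis using S(1) unfolding generated_by_involutions_def
    by (intro exI[of _ "\<phi> ` S"]) auto
qed

text \<open>The quotients constructed below have carriers of other types; a multiplication table
  moves them to the natural numbers, where the classes are formed.\<close>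

lemma obtain_class_rep_iso:
  assumes G: "group G" "order G = 2 ^ m" "generated_by_involutions d G"
  obtains C \<phi> where "C \<in> inv_classes d m" "\<phi> \<in> iso G (class_rep C)"
proof -
  interpret group G by fact
  have fin: "finite (carrier G)" using G(2) order_gt_0_iff_finite by simp
  obtain f e where T: "G \<cong> table_monoid (order G) f e" "group (table_monoid (order G) f e)"
    using finite_group_iso_table[OF G(1) fin] by metis
  define H where "H = table_monoid (order G) f e"
  obtain \<phi> where \<phi>: "\<phi> \<in> iso G H" using T(1) by (auto simp: is_iso_def H_def)
  have gH: "group H" using T(2) by (simp add: H_def)
  have "order H = 2 ^ m" using iso_same_order[OF \<phi>] G(2) by simp
  hence H: "H \<in> involution_groups d m"
    using gH generated_by_involutions_iso[OF G(1) gH \<phi> G(3)] by (simp add: involution_groups_def)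
  let ?R = "group_iso_rel (involution_groups d m)"
  have C: "?R `` {H} \<in> inv_classes d m" using H by (rule quotientI)
  have "(H, class_rep (?R `` {H})) \<in> ?R" using class_rep_in(1)[OF C] by (rule ImageE) simp
  hence "H \<cong> class_rep (?R `` {H})" unfolding group_iso_rel_def by blast
  then obtain \<psi> where "\<psi> \<in> iso H (class_rep (?R `` {H}))" by (auto simp: is_iso_def)
  hence "\<psi> \<circ> \<phi> \<in> iso G (class_rep (?R `` {H}))" using iso_set_trans[OF \<phi>]
    by (simp add: comp_def compose_def)
  thus ?thesis using that C by blast
qed

lemma group_hom_eq_on_generators:
  assumes "group_hom G H f" "group_hom G H h" "X \<subseteq> carrier G" "generate G X = carrier G"
    and "\<And>x. x \<in> X \<Longrightarrow> f x = h x" and g: "g \<in> carrier G"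
  shows "f g = h g"
proof -
  interpret f: group_hom G H f by fact
  interpret h: group_hom G H h by fact
  have "subgroup {g \<in> carrier G. f g = h g} G"
    by (rule f.G.subgroupI) (use f.G.one_closed f.hom_one h.hom_one in \<open>auto simp del: f.hom_one h.hom_one\<close>)
  hence "generate G X \<subseteq> {g \<in> carrier G. f g = h g}"
    using assms by (intro f.G.generate_subgroup_incl) auto
  thus ?thesis using assms(4) g by blast
qed

text \<open>An isomorphism of \<open>G Mod N\<close> with a class representative yields a
  homomorphism from \<open>G\<close> with kernel \<open>N\<close>, and a homomorphism is determined
  by its values on \<open>X\<close>. So at most \<open>(2 ^ m) ^ card X\<close> of the subgroups
  belong to one class.\<close>

lemma (in group) card_quotients_le:
  assumes X: "finite X" "X \<subseteq> carrier G" "generate G X = carrier G"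
    and \<N>: "finite \<N>" "\<And>N. N \<in> \<N> \<Longrightarrow> N \<lhd> G" "\<And>N. N \<in> \<N> \<Longrightarrow> order (G Mod N) = 2 ^ m"
      "\<And>N. N \<in> \<N> \<Longrightarrow> generated_by_involutions d (G Mod N)"
  shows "card \<N> \<le> num_involution_groups d m * (2 ^ m) ^ card X"
proof -
  have "\<exists>C \<phi>. C \<in> inv_classes d m \<and> \<phi> \<in> iso (G Mod N) (class_rep C)" if "N \<in> \<N>" for N
    using obtain_class_rep_iso[OF normal.factorgroup_is_group[OF \<N>(2)[OF that]] \<N>(3,4)[OF that]]
      by metis
  then obtain C \<phi> where C: "\<And>N. N \<in> \<N> \<Longrightarrow> C N \<in> inv_classes d m"
    and \<phi>: "\<And>N. N \<in> \<N> \<Longrightarrow> \<phi> N \<in> iso (G Mod N) (class_rep (C N))" by metis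
  define \<theta> where "\<theta> N g = \<phi> N (N #> g)" for N g
  have r: "group (class_rep c)" "order (class_rep c) = 2 ^ m" if "c \<in> inv_classes d m" for c
    using class_rep_in(2)[OF that] by (auto simp: involution_groups_def)
  have hom: "group_hom G (class_rep (C N)) (\<theta> N)" if "N \<in> \<N>" for N
  proof -
    have "\<theta> N = \<phi> N \<circ> (\<lambda>g. N #> g)" by (auto simp: \<theta>_def)
    moreover have "\<phi> N \<circ> (\<lambda>g. N #> g) \<in> hom G (class_rep (C N))"
      by (rule Group.hom_compose[OF normal.r_coset_hom_Mod[OF \<N>(2)[OF that]] iso_imp_homomorphism[OF \<phi>[OF that]]])
    ultimately show ?thesis using r(1)[OF C[OF that]] is_group
      by (simp add: group_hom_def group_hom_axioms_def)
  qed
  have ker: "kernel G (class_rep (C N)) (\<theta> N) = N" if N: "N \<in> \<N>" for N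
  proof -
    interpret N: normal N G by (rule \<N>(2)[OF N])
    interpret \<phi>: group_hom "G Mod N" "class_rep (C N)" "\<phi> N"
      using N.factorgroup_is_group r(1)[OF C[OF N]] iso_imp_homomorphism[OF \<phi>[OF N]]
      by (simp add: group_hom_def group_hom_axioms_def)
    have inj: "inj_on (\<phi> N) (carrier (G Mod N))" using \<phi>[OF N] by (auto simp: iso_def bij_betw_def)
    have "\<theta> N g = \<one>\<^bsub>class_rep (C N)\<^esub> \<longleftrightarrow> g \<in> N" if g: "g \<in> carrier G" for g
    proof -
      have gQ: "N #> g \<in> carrier (G Mod N)" using g by (simp add: carrier_FactGroup)
      have "\<theta> N g = \<one>\<^bsub>class_rep (C N)\<^esub> \<longleftrightarrow> \<phi> N (N #> g) = \<phi> N \<one>\<^bsub>G Mod N\<^esub>"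
        by (simp only: \<theta>_def \<phi>.hom_one)
      also have "\<dots> \<longleftrightarrow> N #> g = \<one>\<^bsub>G Mod N\<^esub>" by (rule inj_on_eq_iff[OF inj gQ \<phi>.G.one_closed])
      also have "\<dots> \<longleftrightarrow> g \<in> N" using coset_join1[of N g] coset_join2[of g N] g N.is_subgroup by auto
      finally show ?thesis .
    qed
    thus ?thesis using N.subset by (auto simp: kernel_def)
  qed
  let ?S = "SIGMA c:inv_classes d m. X \<rightarrow>\<^sub>E carrier (class_rep c)"
  have "inj_on (\<lambda>N. (C N, restrict (\<theta> N) X)) \<N>"
  proof (rule inj_onI)
    fix N N' assume N: "N \<in> \<N>" "N' \<in> \<N>" and eq: "(C N, restrict (\<theta> N) X) = (C N', restrict (\<theta> N') X)"
    hence CN: "C N = C N'" by simp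
    have "\<theta> N x = \<theta> N' x" if "x \<in> X" for x using eq that by (metis prod.inject restrict_apply')
    hence "\<theta> N g = \<theta> N' g" if "g \<in> carrier G" for g
      using group_hom_eq_on_generators[OF hom[OF N(1)] _ X(2,3) _ that] hom[OF N(2)] CN by metis
    hence "kernel G (class_rep (C N)) (\<theta> N) = kernel G (class_rep (C N')) (\<theta> N')"
      using CN by (auto simp: kernel_def)
    thus "N = N'" using ker N by simp
  qed
  moreover have "(\<lambda>N. (C N, restrict (\<theta> N) X)) ` \<N> \<subseteq> ?S"
    using C X(2) group_hom.hom_closed[OF hom] by (auto simp: subset_iff)
  moreover have finr: "finite (carrier (class_rep c))" if "c \<in> inv_classes d m" for c
    using r[OF that] group.is_monoid monoid.order_gt_0_iff_finite
      by (metis zero_less_numeral zero_less_power)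
  have "finite ?S"
    using finite_involution_group_classes X(1) finr by (intro finite_SigmaI finite_PiE) auto
  ultimately have "card \<N> \<le> card ?S" by (rule card_inj_on_le)
  also have "\<dots> = (\<Sum>c\<in>inv_classes d m. card (X \<rightarrow>\<^sub>E carrier (class_rep c)))"
    using finite_involution_group_classes X(1) finr by (intro card_SigmaI) (auto intro: finite_PiE)
  also have "\<dots> = (\<Sum>c\<in>inv_classes d m. (2 ^ m) ^ card X)"
    using r(2) by (intro sum.cong refl) (simp add: card_PiE[OF X(1)] order_def)
  also have "\<dots> = num_involution_groups d m * (2 ^ m) ^ card X"
    by (simp add: num_involution_groups_def)
  finally show ?thesis .
qed

lemma card_UNIV_bit: "card (UNIV :: bit set) = 2"
proof -
  have "UNIV = {0, 1 :: bit}"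
  proof (rule UNIV_eq_I)
    fix x :: bit
    show "x \<in> {0, 1}" by (cases x rule: bit.exhaust) blast+
  qed
  thus ?thesis unfolding card_2_iff using zero_neq_one by blast
qed

text \<open>Over the two-element field, the graphs of the linear maps from the coordinates in \<open>J1\<close> to
  those in \<open>J2\<close> are the complements of the coordinate subspace \<open>J2\<close>.\<close>

lemma (in group) central_extension_count:
  assumes ord: "order G = 2 ^ (k + r)"
    and X: "finite X" "X \<subseteq> carrier G" "generate G X = carrier G" "\<And>x. x \<in> X \<Longrightarrow> x \<otimes> x = \<one>"
    and J: "finite J" "card J = r"
    and \<Phi>: "\<And>\<phi>. \<Phi> \<phi> \<in> carrier G" "\<And>\<phi> \<psi>. \<Phi> (\<lambda>i. \<phi> i + \<psi> i) = \<Phi> \<phi> \<otimes> \<Phi> \<psi>"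
      "\<And>\<phi> g. g \<in> carrier G \<Longrightarrow> \<Phi> \<phi> \<otimes> g = g \<otimes> \<Phi> \<phi>"
      "\<And>\<phi> \<psi>. \<Phi> \<phi> = \<Phi> \<psi> \<longleftrightarrow> (\<forall>i\<in>J. \<phi> i = (\<psi> i :: bit))"
    and XA: "\<And>x. x \<in> X \<Longrightarrow> x \<notin> range \<Phi>"
      "\<And>x y. x \<in> X \<Longrightarrow> y \<in> X \<Longrightarrow> x \<noteq> y \<Longrightarrow> x \<otimes> y \<notin> range \<Phi>"
    and s: "s \<le> r"
  shows "2 ^ (s * (r - s)) \<le> num_involution_groups (card X) (k + s) * (2 ^ (k + s)) ^ card X"
proof -
  have fin: "finite (carrier G)" using ord order_gt_0_iff_finite by simp
  have "r - s \<le> card J" using J by simp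
  then obtain J1 where J1: "J1 \<subseteq> J" "card J1 = r - s" using obtain_subset_with_card_n by metis
  have fJ1: "finite J1" using J1 J finite_subset by blast
  define J2 where "J2 = J - J1"
  have fJ2: "finite J2" using J by (simp add: J2_def)
  have cJ2: "card J2 = s" using card_Diff_subset[OF fJ1 J1(1)] J J1 s by (simp add: J2_def)
  \<comment> \<open>\<open>W h\<close> is the graph of the linear map with matrix \<open>h\<close>;
    coordinates outside \<open>J\<close> stay free, since \<open>\<Phi>\<close> does not see
    them.\<close>
  define W where "W h = {\<phi>. \<forall>c\<in>J2. \<phi> c = (\<Sum>i\<in>J1. h (i, c) * \<phi> i)}" for h :: "'c \<times> 'c \<Rightarrow> bit"
  define U where "U h = \<Phi> ` W h" for h
  have \<Phi>0: "\<Phi> (\<lambda>_. 0) = \<one>"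
  proof -
    have "\<Phi> (\<lambda>_. 0) = \<Phi> (\<lambda>_. 0) \<otimes> \<Phi> (\<lambda>_. 0)" using \<Phi>(2)[of "\<lambda>_. 0" "\<lambda>_. 0"] by simp
    thus ?thesis using \<Phi>(1) by (metis l_cancel_one)
  qed
  have \<Phi>inv: "inv (\<Phi> \<phi>) = \<Phi> \<phi>" for \<phi>
    using \<Phi>(2)[of \<phi> \<phi>] \<Phi>0 \<Phi>(1) by (simp add: inv_equality)
  have Us: "subgroup (U h) G" for h
  proof (rule subgroupI)
    show "U h \<subseteq> carrier G" using \<Phi>(1) by (auto simp: U_def)
    have "(\<lambda>_. 0) \<in> W h" by (simp add: W_def)
    thus "U h \<noteq> {}" by (auto simp: U_def)
    fix a assume a: "a \<in> U h"
    then obtain \<phi> where \<phi>: "\<phi> \<in> W h" "a = \<Phi> \<phi>" by (auto simp: U_def)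
    show "inv a \<in> U h" using a \<phi> \<Phi>inv by simp
    fix b assume "b \<in> U h"
    then obtain \<psi> where \<psi>: "\<psi> \<in> W h" "b = \<Phi> \<psi>" by (auto simp: U_def)
    have "(\<lambda>i. \<phi> i + \<psi> i) \<in> W h"
      using \<phi>(1) \<psi>(1) unfolding W_def mem_Collect_eq distrib_left sum.distrib by simp
    thus "a \<otimes> b \<in> U h" unfolding U_def \<phi>(2) \<psi>(2) \<Phi>(2)[symmetric] by blast
  qed
  have Un: "U h \<lhd> G" for h
  proof (rule normal_invI[OF Us])
    fix x a assume x: "x \<in> carrier G" and a: "a \<in> U h"
    have "x \<otimes> a \<otimes> inv x = a" using a x \<Phi>(1,3) by (auto simp: U_def m_assoc simp flip: \<Phi>(3))
    thus "x \<otimes> a \<otimes> inv x \<in> U h" using a by simp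
  qed
  have cU: "card (U h) = 2 ^ (r - s)" for h
  proof -
    define ext where "ext f i = (if i \<in> J1 then f i else (\<Sum>l\<in>J1. h (l, i) * f l))" for f i
    have extW: "ext f \<in> W h" for f by (auto simp: W_def ext_def J2_def)
    have "U h = (\<lambda>f. \<Phi> (ext f)) ` (J1 \<rightarrow>\<^sub>E UNIV)"
    proof
      show "(\<lambda>f. \<Phi> (ext f)) ` (J1 \<rightarrow>\<^sub>E UNIV) \<subseteq> U h" using extW by (auto simp: U_def)
      show "U h \<subseteq> (\<lambda>f. \<Phi> (ext f)) ` (J1 \<rightarrow>\<^sub>E UNIV)"
      proof
        fix a assume "a \<in> U h"
        then obtain \<phi> where \<phi>: "\<phi> \<in> W h" "a = \<Phi> \<phi>" by (auto simp: U_def)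
        have e: "\<Phi> \<phi> = \<Phi> (ext (restrict \<phi> J1))"
          unfolding \<Phi>(4) using \<phi>(1) by (auto simp: ext_def W_def J2_def)
        show "a \<in> (\<lambda>f. \<Phi> (ext f)) ` (J1 \<rightarrow>\<^sub>E UNIV)"
          unfolding \<phi>(2) by (rule image_eqI[where x = "restrict \<phi> J1"], rule e) simp
      qed
    qed
    moreover have "inj_on (\<lambda>f. \<Phi> (ext f)) (J1 \<rightarrow>\<^sub>E UNIV)"
    proof (rule inj_onI)
      fix f g assume f: "f \<in> J1 \<rightarrow>\<^sub>E UNIV" and g: "g \<in> J1 \<rightarrow>\<^sub>E UNIV" and eq: "\<Phi> (ext f) = \<Phi> (ext g)"
      have "\<forall>i\<in>J. ext f i = ext g i" by (rule \<Phi>(4)[THEN iffD1, OF eq])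
      hence "ext f i = ext g i" if "i \<in> J1" for i using that J1(1) by blast
      thus "f = g" using f g by (intro PiE_ext[OF f g]) (auto simp: ext_def)
    qed
    ultimately have "card (U h) = card (J1 \<rightarrow>\<^sub>E (UNIV :: bit set))" by (simp add: card_image)
    thus ?thesis by (simp add: card_PiE[OF fJ1] card_UNIV_bit J1)
  qed
  define \<H> where "\<H> = (J1 \<times> J2) \<rightarrow>\<^sub>E (UNIV :: bit set)"
  have c\<H>: "card \<H> = 2 ^ (s * (r - s))"
    using fJ1 fJ2
      by (simp add: \<H>_def card_PiE card_UNIV_bit card_cartesian_product J1 cJ2 mult.commute)
  have fin\<H>: "finite \<H>" using c\<H> card_ge_0_finite by (metis zero_less_numeral zero_less_power)
  have inj: "inj_on U \<H>"
  proof (rule inj_onI)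
    fix h h' assume h: "h \<in> \<H>" "h' \<in> \<H>" and eq: "U h = U h'"
    show "h = h'"
    proof (rule PiE_ext[OF h[unfolded \<H>_def]])
      fix p assume "p \<in> J1 \<times> J2"
      then obtain i c where p: "p = (i, c)" "i \<in> J1" "c \<in> J2" by auto
      \<comment> \<open>The point of the graph over the unit vector \<open>i\<close>: its coordinate
        \<open>c\<close> is the matrix entry \<open>h (i, c)\<close>, so \<open>U h\<close> recovers
        \<open>h\<close>.\<close>
      define \<phi> where "\<phi> l = (if l \<in> J1 then if l = i then 1 else 0 else h (i, l))" for l
      have "(\<Sum>l\<in>J1. h (l, c') * \<phi> l) = h (i, c')" for c'
      proof -
        have "(\<Sum>l\<in>J1. h (l, c') * \<phi> l) = (\<Sum>l\<in>J1. if l = i then h (l, c') else 0)"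
          by (rule sum.cong) (auto simp: \<phi>_def)
        thus ?thesis using p fJ1 by simp
      qed
      hence "\<phi> \<in> W h" by (auto simp: W_def \<phi>_def J2_def)
      hence "\<Phi> \<phi> \<in> U h'" using eq unfolding U_def by blast
      then obtain \<psi> where \<psi>: "\<psi> \<in> W h'" "\<Phi> \<phi> = \<Phi> \<psi>" by (auto simp: U_def)
      have "\<forall>l\<in>J. \<phi> l = \<psi> l" by (rule \<Phi>(4)[THEN iffD1, OF \<psi>(2)])
      hence e: "\<phi> l = \<psi> l" if "l \<in> J" for l using that by blast
      have "h p = \<phi> c" using p by (auto simp: \<phi>_def J2_def)
      also have "\<dots> = (\<Sum>l\<in>J1. h' (l, c) * \<psi> l)" using e[of c] \<psi>(1) p by (simp add: J2_def W_def)
      also have "\<dots> = (\<Sum>l\<in>J1. if l = i then h' (l, c) else 0)"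
        by (rule sum.cong) (use e J1(1) in \<open>auto simp: \<phi>_def simp flip: e\<close>)
      also have "\<dots> = h' p" using p fJ1 by simp
      finally show "h p = h' p" .
    qed
  qed
  have "card (U ` \<H>) \<le> num_involution_groups (card X) (k + s) * (2 ^ (k + s)) ^ card X"
  proof (rule card_quotients_le[OF X(1-3)])
    show "finite (U ` \<H>)" using fin\<H> by simp
    fix N assume "N \<in> U ` \<H>"
    then obtain h where N: "N = U h" by blast
    show "N \<lhd> G" using Un N by simp
    interpret N: normal N G by fact
    have "order (G Mod N) * 2 ^ (r - s) = 2 ^ (k + r)"
      using lagrange[OF N.is_subgroup] cU[of h] ord N by (simp add: order_def FactGroup_def)
    also have "\<dots> = 2 ^ (k + s) * 2 ^ (r - s)" using s by (simp flip: power_add)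
    finally show "order (G Mod N) = 2 ^ (k + s)" by simp
    interpret Q: group "G Mod N" by (rule N.factorgroup_is_group)
    interpret p: group_hom G "G Mod N" "\<lambda>a. N #> a"
      by unfold_locales (rule N.r_coset_hom_Mod)
    \<comment> \<open>By \<open>XA\<close>, neither a generator nor a product of two distinct ones
      lies in \<open>range \<Phi>\<close>, so the generators stay nontrivial and distinct modulo
      \<open>N\<close>.\<close>
    have NA: "N \<subseteq> range \<Phi>" by (auto simp: N U_def)
    have iX: "inv x = x" if "x \<in> X" for x using X that by (simp add: inv_equality subset_iff)
    have "inj_on (\<lambda>a. N #> a) X"
    proof (rule inj_onI)
      fix x y assume xy: "x \<in> X" "y \<in> X" "N #> x = N #> y"
      have c: "x \<in> carrier G" "y \<in> carrier G" using xy X by auto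
      have "x \<otimes> inv y \<in> N"
        using xy(3) c rcos_self[OF c(1) N.is_subgroup] N.rcos_module_imp[OF group_axioms c(2)]
          by simp
      thus "x = y" using XA(2)[OF xy(1,2)] NA iX[OF xy(2)] by auto
    qed
    moreover have "involution (G Mod N) (N #> x)" if x: "x \<in> X" for x
    proof -
      have c: "x \<in> carrier G" using x X by auto
      have "N #> x \<noteq> N" using coset_join1[OF _ c N.is_subgroup] XA(1)[OF x] NA by blast
      moreover have "(N #> x) <#> (N #> x) = N" using N.rcos_sum[OF c c] X(4)[OF x] N.subset by simp
      ultimately show ?thesis using c by (simp add: involution_iff[OF Q.is_group] carrier_FactGroup)
    qed
    moreover have "generate (G Mod N) ((\<lambda>a. N #> a) ` X) = carrier (G Mod N)"
      using p.generate_img[OF X(2)] X(3) by (simp add: carrier_FactGroup)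
    ultimately show "generated_by_involutions (card X) (G Mod N)"
      unfolding generated_by_involutions_def using X(1)
      by (intro exI[of _ "(\<lambda>a. N #> a) ` X"]) (auto simp: card_image)
  qed
  thus ?thesis using card_image[OF inj] c\<H> by simp
qed

section \<open>A class-2 group with a dihedral action\<close>

lemma restrict_eq_iff: "restrict f A = restrict g A \<longleftrightarrow> (\<forall>x\<in>A. f x = g x)"
  by (metis restrict_apply' restrict_ext)

text \<open>A tuple \<open>(u, w, z, n, b)\<close> stands for the element \<open>(u, w, z)\<close> of the class-2 group times \<open>t^n x^b\<close>,
  where \<open>t\<close> acts by \<open>(u, w, z) \<mapsto> (t u, t^-1 w, z)\<close> and the involution \<open>x\<close> swaps \<open>u\<close> and \<open>w\<close>. The map
  \<open>rd\<close> is reduction to a finite quotient ring; the group is first built over the unreduced ring.\<close>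

type_synonym 'k dh = "(nat \<Rightarrow> 'k) \<times> (nat \<Rightarrow> 'k) \<times> (nat \<times> nat \<Rightarrow> 'k) \<times> int \<times> bool"

text \<open>\<open>bar\<close> is a ring endomorphism that inverts \<open>t\<close>, and
  \<open>rd a = rd a'\<close> plays the role of a ring congruence. The assumption
  \<open>span\<close> says that sums of powers of \<open>t\<close> reach every residue, which is
  what lets one involution generate a whole coordinate.\<close>

locale dihedral_heisenberg =
  fixes t s :: "'k::comm_ring_1" and bar rd :: "'k \<Rightarrow> 'k" and e N :: nat
  assumes char2: "x + x = (0::'k)"
    and ts: "t * s = 1"
    and bar_add: "bar (x + y) = bar x + bar y" and bar_mult: "bar (x * y) = bar x * bar y"
    and bar_1: "bar 1 = 1" and bar_t: "bar t = s"
    and rd_rd: "rd (rd x) = rd x"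
    and rd_add: "rd a = rd a' \<Longrightarrow> rd c = rd c' \<Longrightarrow> rd (a + c) = rd (a' + c')"
    and rd_mult: "rd a = rd a' \<Longrightarrow> rd c = rd c' \<Longrightarrow> rd (a * c) = rd (a' * c')"
    and rd_bar: "rd a = rd a' \<Longrightarrow> rd (bar a) = rd (bar a')"
    and rd_tN: "rd (t ^ N) = rd 1" and N: "N \<ge> 2"
    and rd_01: "rd 0 \<noteq> rd 1"
    and span: "\<And>S a. 1 \<in> S \<Longrightarrow> (\<And>p q. p \<in> S \<Longrightarrow> q \<in> S \<Longrightarrow> p + q \<in> S) \<Longrightarrow> (\<And>p. p \<in> S \<Longrightarrow> t * p \<in> S) \<Longrightarrow>
      \<exists>p\<in>S. rd p = rd a"
begin

section \<open>Powers of \<open>t\<close> and the unreduced group\<close>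

definition T :: "int \<Rightarrow> 'k" where "T n = (if n \<ge> 0 then t ^ nat n else s ^ nat (- n))"

lemma T_diff: "T (int a - int b) = t ^ a * s ^ b"
proof -
  have ts': "t ^ m * s ^ m = 1" for m by (simp add: ts flip: power_mult_distrib)
  show ?thesis
  proof (cases "a \<ge> b")
    case True
    then obtain c where c: "a = b + c" using le_Suc_ex by blast
    have "t ^ a * s ^ b = t ^ c * (t ^ b * s ^ b)" by (simp add: c power_add mult_ac)
    thus ?thesis using c ts' by (simp add: T_def)
  next
    case False
    then obtain c where c: "b = a + c" "c > 0" by (metis less_imp_add_positive not_le)
    have "t ^ a * s ^ b = s ^ c * (t ^ a * s ^ a)" by (simp add: c power_add mult_ac)
    thus ?thesis using c ts' by (simp add: T_def)
  qed
qed

lemma T_add: "T (m + n) = T m * T n"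
proof -
  obtain a b where m: "m = int a - int b" by (metis int_diff_cases)
  obtain c d where n: "n = int c - int d" by (metis int_diff_cases)
  have "m + n = int (a + c) - int (b + d)" by (simp add: m n)
  hence "T (m + n) = t ^ (a + c) * s ^ (b + d)" by (simp only: T_diff)
  thus ?thesis by (simp add: m n T_diff power_add mult_ac)
qed

lemma T_0 [simp]: "T 0 = 1" and T_1: "T 1 = t" and T_m1: "T (- 1) = s"
  by (simp_all add: T_def)

lemma T_minus: "T n * T (- n) = 1"
  by (simp flip: T_add)

lemma bar_0 [simp]: "bar 0 = 0"
  using bar_add[of 0 0] by simp

lemma bar_T: "bar (T n) = T (- n)"
proof -
  have "s * bar s = 1" using bar_mult[of t s] by (simp only: ts bar_1 bar_t)
  hence "t * s * bar s = t" by (simp add: mult.assoc)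
  hence bs: "bar s = t" by (simp add: ts)
  have p: "bar (x ^ m) = bar x ^ m" for x m by (induction m) (simp_all add: bar_1 bar_mult)
  obtain a b where n: "n = int a - int b" by (metis int_diff_cases)
  have "- n = int b - int a" by (simp add: n)
  thus ?thesis by (simp add: n T_diff bar_mult p bar_t bs mult.commute)
qed

lemma char2': "x + (x + y) = (y::'k)"
  using char2[of x] by (simp flip: add.assoc)

lemma two_eq_0: "(2::'k) = 0"
  using char2[of 1] by simp

text \<open>The cocycle must be invariant under the dihedral action: under \<open>t\<close> this holds since \<open>u\<close> and \<open>w\<close> are
  scaled inversely and \<open>bar\<close> inverts \<open>t\<close>; the entries off the diagonal are symmetric under the swap,
  and on the diagonal the swap is corrected by the term \<open>u i * w i\<close> in \<open>mul\<close>.\<close>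

definition \<beta> :: "(nat \<Rightarrow> 'k) \<Rightarrow> (nat \<Rightarrow> 'k) \<Rightarrow> (nat \<Rightarrow> 'k) \<Rightarrow> (nat \<Rightarrow> 'k) \<Rightarrow> nat \<times> nat \<Rightarrow> 'k" where
  "\<beta> u w u' w' = (\<lambda>(i, l). if i < l then u i * w' l + w i * u' l
     else if l < i then u i * bar (u' l) + w i * bar (w' l) else u i * w' i)"

fun mul :: "'k dh \<Rightarrow> 'k dh \<Rightarrow> 'k dh" where
  "mul (u, w, z, n, b) (u', w', z', n', b') =
    (\<lambda>i. u i + T n * (if b then w' i else u' i),
     \<lambda>i. w i + T (- n) * (if b then u' i else w' i),
     \<lambda>p. z p + z' p + (if b \<and> fst p = snd p then u' (fst p) * w' (fst p) else 0) +
       \<beta> u w (\<lambda>i. T n * (if b then w' i else u' i)) (\<lambda>i. T (- n) * (if b then u' i else w' i)) p,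
     if b then n - n' else n + n', b \<noteq> b')"

definition Dh :: "'k dh monoid" where
  "Dh = \<lparr>carrier = UNIV, monoid.mult = mul, one = (\<lambda>_. 0, \<lambda>_. 0, \<lambda>_. 0, 0, False)\<rparr>"

text \<open>Powers of \<open>t\<close> are replaced by letters with \<open>a * a' = 1\<close> and
  \<open>b * b' = 1\<close>, where \<open>bar\<close> exchanges the partners. For each choice of
  \<open>b1\<close> and \<open>b2\<close> a polynomial identity in characteristic 2 remains.\<close>

lemma mul_assoc: "mul (mul g1 g2) g3 = mul g1 (mul g2 g3)"
proof -
  obtain u1 w1 z1 n1 b1 where g1: "g1 = (u1, w1, z1, n1, b1)" by (metis prod_cases5)
  obtain u2 w2 z2 n2 b2 where g2: "g2 = (u2, w2, z2, n2, b2)" by (metis prod_cases5)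
  obtain u3 w3 z3 n3 b3 where g3: "g3 = (u3, w3, z3, n3, b3)" by (metis prod_cases5)
  define a a' b b' where ab: "a = T n1" "a' = T (- n1)" "b = T n2" "b' = T (- n2)"
  have aa: "a * a' = 1" and bb: "b * b' = 1" by (simp_all add: ab T_minus)
  have ba: "bar a = a'" "bar a' = a" "bar b = b'" "bar b' = b" by (simp_all add: ab bar_T)
  have Ts: "T (n1 + n2) = a * b" "T (- n1 - n2) = a' * b'" "T (n1 - n2) = a * b'" "T (n2 - n1) = a' * b"
    using T_add[of n1 n2] T_add[of "- n1" "- n2"] T_add[of n1 "- n2"] T_add[of "- n1" n2]
    by (simp_all add: ab)
  have c: "a * (a' * x) = x" "a' * (a * x) = x" "b * (b' * x) = x" "b' * (b * x) = x" for x
    using aa bb by (simp_all add: mult.commute flip: mult.assoc)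
  show ?thesis
    unfolding g1 g2 g3
    by (cases b1; cases b2)
      (simp_all add: fun_eq_iff \<beta>_def Ts flip: ab, simp_all add: bar_add bar_mult ba,
        simp_all add: algebra_simps c char2 char2')
qed

lemma \<beta>_0 [simp]: "\<beta> u w (\<lambda>_. 0) (\<lambda>_. 0) = (\<lambda>_. 0)" "\<beta> (\<lambda>_. 0) (\<lambda>_. 0) u w = (\<lambda>_. 0)"
  by (auto simp: \<beta>_def)

lemma carrier_Dh [simp]: "carrier Dh = UNIV" and mult_Dh [simp]: "monoid.mult Dh = mul"
  and one_Dh: "one Dh = (\<lambda>_. 0, \<lambda>_. 0, \<lambda>_. 0, 0, False)"
  by (simp_all add: Dh_def)

lemma group_Dh: "group Dh"
proof (rule groupI)
  fix g :: "'k dh"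
  obtain u w z n b where g: "g = (u, w, z, n, b)" by (metis prod_cases5)
  show "\<one>\<^bsub>Dh\<^esub> \<otimes>\<^bsub>Dh\<^esub> g = g" by (simp add: g one_Dh)
  show "\<exists>h\<in>carrier Dh. h \<otimes>\<^bsub>Dh\<^esub> g = \<one>\<^bsub>Dh\<^esub>"
  proof (cases b)
    case True
    \<comment> \<open>A reflection is its own inverse in the dihedral part. The central coordinate
      repeats the other terms of the product, so that everything cancels in characteristic
      2.\<close>
    define h where "h = (\<lambda>i. T n * w i, \<lambda>i. T (- n) * u i,
      \<lambda>p. z p + (if fst p = snd p then u (fst p) * w (fst p) else 0) +
        \<beta> (\<lambda>i. T n * w i) (\<lambda>i. T (- n) * u i) (\<lambda>i. T n * w i) (\<lambda>i. T (- n) * u i) p, n, True)"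
    have "mul h g = \<one>\<^bsub>Dh\<^esub>"
      by (simp add: h_def g True one_Dh char2 fun_eq_iff) (simp add: two_eq_0 char2 char2' add_ac)
    thus ?thesis by (intro bexI[of _ h]) simp_all
  next
    case False
    define h where "h = (\<lambda>i. T (- n) * u i, \<lambda>i. T n * w i,
      \<lambda>p. z p + \<beta> (\<lambda>i. T (- n) * u i) (\<lambda>i. T n * w i) (\<lambda>i. T (- n) * u i) (\<lambda>i. T n * w i) p, - n, False)"
    have "mul h g = \<one>\<^bsub>Dh\<^esub>"
      by (simp add: h_def g False one_Dh char2 fun_eq_iff) (simp add: two_eq_0 char2 char2' add_ac)
    thus ?thesis by (intro bexI[of _ h]) simp_all
  qed
qed (simp_all add: mul_assoc)

interpretation Dh: group Dh by (rule group_Dh)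

section \<open>Reduction to a finite group\<close>

definition red :: "'k dh \<Rightarrow> 'k dh" where
  "red = (\<lambda>(u, w, z, n, b). (\<lambda>i\<in>{..<e}. rd (u i), \<lambda>i\<in>{..<e}. rd (w i),
     \<lambda>p\<in>{..<e} \<times> {..<e}. rd (z p), n mod int N, b))"

lemma red_eq_iff: "red (u, w, z, n, b) = red (u', w', z', n', b') \<longleftrightarrow>
    (\<forall>i<e. rd (u i) = rd (u' i)) \<and> (\<forall>i<e. rd (w i) = rd (w' i)) \<and>
    (\<forall>i<e. \<forall>l<e. rd (z (i, l)) = rd (z' (i, l))) \<and> n mod int N = n' mod int N \<and> b = b'"
  unfolding red_def prod.case prod.inject restrict_eq_iff by auto

lemma red_red: "red (red g) = red g"
proof -
  obtain u w z n b where g: "g = (u, w, z, n, b)" by (metis prod_cases5)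
  show ?thesis by (auto simp: g red_def rd_rd)
qed

lemma rd_T: "rd (T n) = rd (T n')" if nn: "n mod int N = n' mod int N"
proof -
  have pw: "rd (x ^ m) = rd 1" if "rd x = rd 1" for x m
  proof (induction m)
    case (Suc m)
    thus ?case using rd_mult[OF that Suc] by simp
  qed simp
  have per: "rd (T (int N * k)) = rd 1" for k
  proof -
    have tN: "rd (T (int N)) = rd 1" using rd_tN by (simp add: T_def)
    \<comment> \<open>Applying \<open>bar\<close> carries the relation over from \<open>t\<close> to
      its inverse.\<close>
    have sN: "rd (T (- int N)) = rd 1" using rd_bar[OF tN] by (simp add: bar_T bar_1)
    obtain m where "k = int m \<or> k = - int m" by (metis int_cases2)
    have tp: "T (x * int m) = T x ^ m" for x m
      by (induction m) (simp_all add: algebra_simps T_add)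
    show ?thesis
    proof (cases k rule: int_cases2)
      case (nonneg m)
      thus ?thesis using pw[OF tN, of m] tp[of "int N" m] by (simp add: mult.commute)
    next
      case (nonpos m)
      thus ?thesis using pw[OF sN, of m] tp[of "- int N" m] by simp
    qed
  qed
  obtain k where k: "n = n' + int N * k"
    using mod_eqE[OF sym[OF nn]] by blast
  have "rd (T n' * T (int N * k)) = rd (T n' * 1)" by (rule rd_mult[OF refl per])
  thus ?thesis unfolding k T_add by simp
qed

text \<open>Having the same image under \<open>red\<close> is a congruence for \<open>mul\<close>,
  so the finite \<open>Er\<close> inherits the group axioms from \<open>Dh\<close> as a homomorphic
  image.\<close>

lemma red_mul_cong:
  assumes "red g = red g'" "red h = red h'"
  shows "red (mul g h) = red (mul g' h')"
proof -
  obtain u w z n b where g: "g = (u, w, z, n, b)" by (metis prod_cases5)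
  obtain u' w' z' n' b' where g': "g' = (u', w', z', n', b')" by (metis prod_cases5)
  obtain x y v k c where h: "h = (x, y, v, k, c)" by (metis prod_cases5)
  obtain x' y' v' k' c' where h': "h' = (x', y', v', k', c')" by (metis prod_cases5)
  have u: "rd (u i) = rd (u' i)" "rd (w i) = rd (w' i)" if "i < e" for i
    using assms(1) that by (auto simp: g g' red_eq_iff)
  have x: "rd (x i) = rd (x' i)" "rd (y i) = rd (y' i)" if "i < e" for i
    using assms(2) that by (auto simp: h h' red_eq_iff)
  have z: "rd (z (i, l)) = rd (z' (i, l))" "rd (v (i, l)) = rd (v' (i, l))"
    if "i < e" "l < e" for i l
    using assms that by (auto simp: g g' h h' red_eq_iff)
  have n: "n mod int N = n' mod int N" "k mod int N = k' mod int N" and b: "b = b'" "c = c'"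
    using assms by (auto simp: g g' h h' red_eq_iff)
  have Tn: "rd (T n) = rd (T n')" by (rule rd_T[OF n(1)])
  have Tm: "rd (T (- n)) = rd (T (- n'))" using n(1) by (intro rd_T) (metis mod_minus_eq)
  define p where "p = (\<lambda>i. T n * (if b then y i else x i))"
  define p' where "p' = (\<lambda>i. T n' * (if b then y' i else x' i))"
  define r where "r = (\<lambda>i. T (- n) * (if b then x i else y i))"
  define r' where "r' = (\<lambda>i. T (- n') * (if b then x' i else y' i))"
  have p: "rd (p i) = rd (p' i)" if "i < e" for i
    unfolding p_def p'_def by (rule rd_mult[OF Tn]) (use x that in auto)
  have r: "rd (r i) = rd (r' i)" if "i < e" for i
    unfolding r_def r'_def by (rule rd_mult[OF Tm]) (use x that in auto)
  have \<beta>: "rd (\<beta> u w p r (i, l)) = rd (\<beta> u' w' p' r' (i, l))" if "i < e" "l < e" for i l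
    using u p r that by (auto simp: \<beta>_def intro!: rd_add rd_mult rd_bar)
  have \<theta>: "rd (if b \<and> i = l then x i * y i else 0) = rd (if b \<and> i = l then x' i * y' i else 0)"
    if "i < e" for i l
    using x that by (auto intro!: rd_mult)
  have nk: "(if b then n - k else n + k) mod int N = (if b' then n' - k' else n' + k') mod int N"
    using n b by (auto intro: mod_add_cong mod_diff_cong)
  have g1: "mul g h = (\<lambda>i. u i + p i, \<lambda>i. w i + r i,
    \<lambda>q. z q + v q + (if b \<and> fst q = snd q then x (fst q) * y (fst q) else 0) + \<beta> u w p r q,
    if b then n - k else n + k, b \<noteq> c)"
    unfolding g h p_def r_def by simp
  have g2: "mul g' h' = (\<lambda>i. u' i + p' i, \<lambda>i. w' i + r' i,
    \<lambda>q. z' q + v' q + (if b \<and> fst q = snd q then x' (fst q) * y' (fst q) else 0) + \<beta> u' w' p' r' q,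
    if b' then n' - k' else n' + k', b' \<noteq> c')"
    unfolding g' h' p'_def r'_def using b by simp
  show ?thesis
    unfolding g1 g2 red_eq_iff
  proof (intro conjI allI impI)
    fix i l assume "i < e" "l < e"
    thus "rd (z (i, l) + v (i, l) + (if b \<and> fst (i, l) = snd (i, l) then x (fst (i, l)) * y (fst (i, l)) else 0) + \<beta> u w p r (i, l)) =
      rd (z' (i, l) + v' (i, l) + (if b \<and> fst (i, l) = snd (i, l) then x' (fst (i, l)) * y' (fst (i, l)) else 0) + \<beta> u' w' p' r' (i, l))"
      unfolding fst_conv snd_conv by (intro rd_add z \<beta> \<theta>)
  qed (use nk b u p r in \<open>auto intro!: rd_add\<close>)
qed

definition Er :: "'k dh monoid" where
  "Er = \<lparr>carrier = range red, monoid.mult = (\<lambda>g h. red (mul g h)), one = red \<one>\<^bsub>Dh\<^esub>\<rparr>"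

lemma red_hom: "red \<in> hom Dh Er"
proof (rule homI)
  fix g h show "red (g \<otimes>\<^bsub>Dh\<^esub> h) = red g \<otimes>\<^bsub>Er\<^esub> red h"
    using red_mul_cong[OF red_red red_red, of g h] by (simp add: Er_def)
qed (simp add: Er_def)

lemma group_Er: "group Er"
  using Dh.hom_imp_img_group[OF red_hom] by (simp add: Er_def)

lemma group_hom_red: "group_hom Dh Er red"
  using group_Dh group_Er red_hom by (simp add: group_hom_def group_hom_axioms_def)

section \<open>Generation by \<open>e + 2\<close> involutions\<close>

abbreviation P :: "(nat \<Rightarrow> 'k) \<Rightarrow> (nat \<Rightarrow> 'k) \<Rightarrow> (nat \<times> nat \<Rightarrow> 'k) \<Rightarrow> 'k dh" where
  "P u w z \<equiv> (u, w, z, 0, False)"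

definition \<delta> :: "'b \<Rightarrow> 'k \<Rightarrow> 'b \<Rightarrow> 'k" where
  "\<delta> i p = (\<lambda>l. if l = i then p else 0)"

text \<open>Two reflections, whose product is \<open>t\<close> or its inverse, give the dihedral
  part. The unit vectors are placed in \<open>u\<close> only: \<open>w\<close> and the center are
  obtained from them by conjugation and commutators.\<close>

definition gens :: "'k dh set" where
  "gens = {(\<lambda>_. 0, \<lambda>_. 0, \<lambda>_. 0, 0, True), (\<lambda>_. 0, \<lambda>_. 0, \<lambda>_. 0, 1, True)} \<union>
    (\<lambda>i. P (\<delta> i 1) (\<lambda>_. 0) (\<lambda>_. 0)) ` {..<e}"

lemma P_mul: "mul (P u w z) (P u' w' z') =
    P (\<lambda>i. u i + u' i) (\<lambda>i. w i + w' i) (\<lambda>p. z p + z' p + \<beta> u w u' w' p)"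
  by simp

lemma \<delta>_add: "(\<lambda>l. \<delta> i p l + \<delta> i q l) = \<delta> i (p + q)"
  by (auto simp: \<delta>_def)

lemma \<delta>_0 [simp]: "\<delta> i 0 = (\<lambda>_. 0)"
  by (auto simp: \<delta>_def)

text \<open>Products and conjugation by \<open>t\<close> spread a unit vector over a whole
  coordinate of \<open>u\<close>, conjugation by the reflection moves it to \<open>w\<close>, and
  commutators fill the center. Equality holds only after \<open>red\<close>, because
  \<open>span\<close> supplies representatives of residues.\<close>

lemma generate_gens: "\<exists>\<gamma>\<in>generate Dh gens. red \<gamma> = red g"
proof -
  let ?\<Gamma> = "generate Dh gens"
  let ?D = "\<lambda>n b. (\<lambda>_. 0, \<lambda>_. 0, \<lambda>_. 0, n, b) :: 'k dh"
  have \<Gamma>: "subgroup ?\<Gamma> Dh" by (rule Dh.generate_is_subgroup) simp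
  have m: "mul g h \<in> ?\<Gamma>" if "g \<in> ?\<Gamma>" "h \<in> ?\<Gamma>" for g h
    using subgroup.m_closed[OF \<Gamma> that] by simp
  have cancel: "h \<in> ?\<Gamma>" if "mul h g = k" "g \<in> ?\<Gamma>" "k \<in> ?\<Gamma>" for g h k
  proof -
    have "h = k \<otimes>\<^bsub>Dh\<^esub> inv\<^bsub>Dh\<^esub> g" using Dh.inv_solve_right[of h k g] that(1) by simp
    thus ?thesis using subgroup.m_closed[OF \<Gamma> that(3) subgroup.m_inv_closed[OF \<Gamma> that(2)]] by simp
  qed
  have x: "?D 0 True \<in> ?\<Gamma>" and y: "?D 1 True \<in> ?\<Gamma>"
    by (auto intro!: generate.incl simp: gens_def)
  have a: "P (\<delta> i 1) (\<lambda>_. 0) (\<lambda>_. 0) \<in> ?\<Gamma>" if "i < e" for i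
    using that by (auto intro!: generate.incl simp: gens_def)
  have t1: "?D 1 False \<in> ?\<Gamma>" and tm1: "?D (- 1) False \<in> ?\<Gamma>"
    using m[OF y x] m[OF x y] by (simp_all cong: if_cong)
  have tp: "?D (int n) False \<in> ?\<Gamma>" for n
  proof (induction n)
    case 0
    show ?case using m[OF x x] by (simp cong: if_cong)
  next
    case (Suc n)
    show ?case using m[OF t1 Suc] by simp
  qed
  have tn: "?D (- int n) False \<in> ?\<Gamma>" for n
  proof (induction n)
    case 0
    show ?case using m[OF x x] by (simp cong: if_cong)
  next
    case (Suc n)
    show ?case using m[OF tm1 Suc] by simp
  qed
  have D: "?D n b \<in> ?\<Gamma>" for n b
  proof -
    have "?D n False \<in> ?\<Gamma>" using tp tn by (cases n rule: int_cases2) auto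
    thus ?thesis using m[OF _ x, of "?D n False"] by (cases b) simp_all
  qed
  define A where "A i = {p. P (\<delta> i p) (\<lambda>_. 0) (\<lambda>_. 0) \<in> ?\<Gamma>}" for i
  have A1: "1 \<in> A i" if "i < e" for i using a[OF that] by (simp add: A_def)
  have Aadd: "p + q \<in> A i" if "p \<in> A i" "q \<in> A i" for p q i
  proof -
    have "\<beta> (\<delta> i p) (\<lambda>_. 0) (\<delta> i q) (\<lambda>_. 0) = (\<lambda>_. 0)" by (auto simp: \<beta>_def \<delta>_def fun_eq_iff)
    thus ?thesis using m[of "P (\<delta> i p) (\<lambda>_. 0) (\<lambda>_. 0)" "P (\<delta> i q) (\<lambda>_. 0) (\<lambda>_. 0)"] that
      unfolding A_def mem_Collect_eq P_mul \<delta>_add by simp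
  qed
  have At: "t * p \<in> A i" if "p \<in> A i" for p i
  proof -
    have "mul (mul (?D 1 False) (P (\<delta> i p) (\<lambda>_. 0) (\<lambda>_. 0))) (?D (- 1) False) \<in> ?\<Gamma>"
      using that D by (intro m) (auto simp: A_def)
    moreover have "(\<lambda>l. t * \<delta> i p l) = \<delta> i (t * p)" by (auto simp: \<delta>_def)
    ultimately show ?thesis by (simp add: A_def T_1)
  qed
  have ex: "\<exists>p\<in>A i. rd p = rd c" if "i < e" for i c
    by (rule span[OF A1[OF that] Aadd At])
  have B: "P (\<lambda>_. 0) (\<delta> i p) (\<lambda>_. 0) \<in> ?\<Gamma>" if "p \<in> A i" for i p
  proof -
    have "mul (mul (?D 0 True) (P (\<delta> i p) (\<lambda>_. 0) (\<lambda>_. 0))) (?D 0 True) \<in> ?\<Gamma>"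
      using that D by (intro m) (auto simp: A_def)
    thus ?thesis by (simp cong: if_cong)
  qed
  \<comment> \<open>The entry \<open>(i, l)\<close> is the commutator of two
    \<open>u\<close>-vectors if \<open>l < i\<close>, and of a \<open>u\<close>-vector with a
    \<open>w\<close>-vector otherwise. The second vector has entry 1, which \<open>bar\<close>
    fixes.\<close>
  have Z1: "P (\<lambda>_. 0) (\<lambda>_. 0) (\<delta> (i, l) p) \<in> ?\<Gamma>"
    if i: "i < e" and l: "l < e" and p: "p \<in> A i" for i l p
  proof (cases "l < i")
    case True
    let ?g = "P (\<delta> i p) (\<lambda>_. 0) (\<lambda>_. 0)" and ?h = "P (\<delta> l 1) (\<lambda>_. 0) (\<lambda>_. 0)"
    have g: "?g \<in> ?\<Gamma>" and h: "?h \<in> ?\<Gamma>" using p a[OF l] by (auto simp: A_def)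
    have b1: "\<beta> (\<delta> i p) (\<lambda>_. 0) (\<delta> l 1) (\<lambda>_. 0) = \<delta> (i, l) p"
      using True by (auto simp: \<beta>_def \<delta>_def fun_eq_iff bar_1)
    have b2: "\<beta> (\<delta> l 1) (\<lambda>_. 0) (\<delta> i p) (\<lambda>_. 0) = (\<lambda>_. 0)"
      using True by (auto simp: \<beta>_def \<delta>_def fun_eq_iff)
    have "mul (P (\<lambda>_. 0) (\<lambda>_. 0) (\<delta> (i, l) p)) (mul ?h ?g) = mul ?g ?h"
      unfolding P_mul b1 b2 by (simp add: add.commute)
    thus ?thesis using cancel m g h by blast
  next
    case False
    let ?g = "P (\<delta> i p) (\<lambda>_. 0) (\<lambda>_. 0)" and ?h = "P (\<lambda>_. 0) (\<delta> l 1) (\<lambda>_. 0)"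
    have g: "?g \<in> ?\<Gamma>" and h: "?h \<in> ?\<Gamma>" using p B[OF A1[OF l]] by (auto simp: A_def)
    have b1: "\<beta> (\<delta> i p) (\<lambda>_. 0) (\<lambda>_. 0) (\<delta> l 1) = \<delta> (i, l) p"
      using False by (auto simp: \<beta>_def \<delta>_def fun_eq_iff)
    have b2: "\<beta> (\<lambda>_. 0) (\<delta> l 1) (\<delta> i p) (\<lambda>_. 0) = (\<lambda>_. 0)"
      using False by (auto simp: \<beta>_def \<delta>_def fun_eq_iff)
    have "mul (P (\<lambda>_. 0) (\<lambda>_. 0) (\<delta> (i, l) p)) (mul ?h ?g) = mul ?g ?h"
      unfolding P_mul b1 b2 by (simp add: add.commute)
    thus ?thesis using cancel m g h by blast
  qed
  have Z: "P (\<lambda>_. 0) (\<lambda>_. 0) z \<in> ?\<Gamma>"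
    if "finite I" "I \<subseteq> {..<e} \<times> {..<e}" "\<And>q. q \<in> I \<Longrightarrow> z q \<in> A (fst q)" "\<And>q. q \<notin> I \<Longrightarrow> z q = 0" for I z
    using that
  proof (induction I arbitrary: z rule: finite_induct)
    case empty
    hence "z = (\<lambda>_. 0)" by auto
    thus ?case using D[of 0 False] by simp
  next
    case (insert q I)
    let ?z = "\<lambda>r. if r = q then 0 else z r"
    have "P (\<lambda>_. 0) (\<lambda>_. 0) ?z \<in> ?\<Gamma>"
      by (rule insert.IH) (use insert in auto)
    moreover have "P (\<lambda>_. 0) (\<lambda>_. 0) (\<delta> q (z q)) \<in> ?\<Gamma>"
      using Z1[of "fst q" "snd q" "z q"] insert.prems by auto
    ultimately have "mul (P (\<lambda>_. 0) (\<lambda>_. 0) ?z) (P (\<lambda>_. 0) (\<lambda>_. 0) (\<delta> q (z q))) \<in> ?\<Gamma>"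
      by (rule m)
    moreover have "(\<lambda>r. ?z r + \<delta> q (z q) r + 0) = z" by (auto simp: \<delta>_def)
    ultimately show ?case unfolding P_mul \<beta>_0 by simp
  qed
  \<comment> \<open>Multiplying the coordinates together leaves an uncontrolled central part, to be
    corrected at the end.\<close>
  have UW: "\<exists>z. P u w z \<in> ?\<Gamma>"
    if "k \<le> e" "\<And>i. i < k \<Longrightarrow> u i \<in> A i" "\<And>i. i < k \<Longrightarrow> w i \<in> A i"
      "\<And>i. i \<ge> k \<Longrightarrow> u i = 0" "\<And>i. i \<ge> k \<Longrightarrow> w i = 0" for k u w
    using that
  proof (induction k arbitrary: u w)
    case 0
    hence "u = (\<lambda>_. 0)" "w = (\<lambda>_. 0)" by auto
    thus ?case using D[of 0 False] by auto
  next
    case (Suc k)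
    let ?u = "\<lambda>i. if i = k then 0 else u i" and ?w = "\<lambda>i. if i = k then 0 else w i"
    have "\<exists>z. P ?u ?w z \<in> ?\<Gamma>" by (rule Suc.IH) (use Suc.prems in auto)
    then obtain z where z: "P ?u ?w z \<in> ?\<Gamma>" by blast
    have "P (\<delta> k (u k)) (\<lambda>_. 0) (\<lambda>_. 0) \<in> ?\<Gamma>" using Suc.prems(2)[of k] by (simp add: A_def)
    moreover have "P (\<lambda>_. 0) (\<delta> k (w k)) (\<lambda>_. 0) \<in> ?\<Gamma>" using B[OF Suc.prems(3)[of k]] by simp
    ultimately have "mul (mul (P ?u ?w z) (P (\<delta> k (u k)) (\<lambda>_. 0) (\<lambda>_. 0))) (P (\<lambda>_. 0) (\<delta> k (w k)) (\<lambda>_. 0)) \<in> ?\<Gamma>"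
      using z m by blast
    moreover have "(\<lambda>i. ?u i + \<delta> k (u k) i + 0) = u" "(\<lambda>i. ?w i + 0 + \<delta> k (w k) i) = w"
      by (auto simp: \<delta>_def)
    ultimately show ?case unfolding P_mul by auto
  qed
  obtain u w z n b where g: "g = (u, w, z, n, b)" by (metis prod_cases5)
  obtain c where c: "\<And>i p. i < e \<Longrightarrow> c i p \<in> A i \<and> rd (c i p) = rd p" using ex by metis
  define u' where "u' i = (if i < e then c i (u i) else 0)" for i
  define w' where "w' i = (if i < e then c i (w i) else 0)" for i
  have "\<exists>z. P u' w' z \<in> ?\<Gamma>"
    by (rule UW[OF order_refl]) (use c in \<open>auto simp: u'_def w'_def\<close>)
  then obtain z0 where z0: "P u' w' z0 \<in> ?\<Gamma>" by blast
  \<comment> \<open>The missing central factor, each entry being replaced by a congruent one from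
    \<open>A\<close>.\<close>
  define z' where "z' q = (if q \<in> {..<e} \<times> {..<e} then c (fst q) (z q - z0 q) else 0)" for q
  have "P (\<lambda>_. 0) (\<lambda>_. 0) z' \<in> ?\<Gamma>"
    by (rule Z[of "{..<e} \<times> {..<e}"]) (use c in \<open>auto simp: z'_def\<close>)
  hence "mul (mul (P (\<lambda>_. 0) (\<lambda>_. 0) z') (P u' w' z0)) (?D n b) \<in> ?\<Gamma>" using z0 D m by blast
  moreover have "mul (mul (P (\<lambda>_. 0) (\<lambda>_. 0) z') (P u' w' z0)) (?D n b) = (u', w', \<lambda>q. z' q + z0 q, n, b)"
    by (cases b) simp_all
  moreover have "rd (z' q + z0 q) = rd (z q)" if "q \<in> {..<e} \<times> {..<e}" for q
  proof -
    have "rd (z' q) = rd (z q - z0 q)" using c that by (auto simp: z'_def)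
    from rd_add[OF this refl, of "z0 q"] show ?thesis by simp
  qed
  hence "red (u', w', \<lambda>q. z' q + z0 q, n, b) = red g"
    unfolding g red_eq_iff using c by (simp add: u'_def w'_def)
  ultimately show ?thesis by metis
qed

lemma generate_Er: "generate Er (red ` gens) = carrier Er"
proof -
  interpret r: group_hom Dh Er red by (rule group_hom_red)
  have "generate Er (red ` gens) = red ` generate Dh gens" by (rule r.generate_img) simp
  also have "\<dots> = range red"
  proof
    show "range red \<subseteq> red ` generate Dh gens"
    proof
      fix y assume "y \<in> range red"
      then obtain g where "y = red g" by blast
      moreover obtain \<gamma> where "\<gamma> \<in> generate Dh gens" "red \<gamma> = red g" using generate_gens[of g]
        by blast
      ultimately show "y \<in> red ` generate Dh gens" by (metis image_eqI)
    qed
    show "red ` generate Dh gens \<subseteq> range red" by (rule image_mono) simp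
  qed
  also have "\<dots> = carrier Er" by (simp only: Er_def partial_object.select_convs)
  finally show ?thesis .
qed

end

text \<open>\<open>dec\<close> gives coordinates over the two-element field, of which
  \<open>rd\<close> sees exactly the first \<open>j\<close>. They serve to compute the order and to
  parametrize the central subgroup linearly.\<close>

locale dihedral_heisenberg_bits = dihedral_heisenberg t s bar rd e "2 ^ q"
  for t s :: "'k::comm_ring_1" and bar rd e q +
  fixes dec :: "(nat \<Rightarrow> bit) \<Rightarrow> 'k" and j :: nat
  assumes dec_add: "dec (\<lambda>l. f l + g l) = dec f + dec g"
    and rd_dec: "rd (dec f) = rd (dec g) \<longleftrightarrow> (\<forall>l<j. f l = g l)"
    and dec_surj: "\<exists>f. dec f = a"
begin

lemma card_range_rd: "card (range rd) = 2 ^ j"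
proof -
  have "range rd = (\<lambda>f. rd (dec f)) ` ({..<j} \<rightarrow>\<^sub>E UNIV)"
  proof
    show "range rd \<subseteq> (\<lambda>f. rd (dec f)) ` ({..<j} \<rightarrow>\<^sub>E UNIV)"
    proof
      fix y assume "y \<in> range rd"
      then obtain a where "y = rd a" by blast
      moreover obtain f where "dec f = a" using dec_surj by blast
      moreover have "rd (dec f) = rd (dec (restrict f {..<j}))" by (simp add: rd_dec)
      ultimately have "y = rd (dec (restrict f {..<j}))" by simp
      thus "y \<in> (\<lambda>f. rd (dec f)) ` ({..<j} \<rightarrow>\<^sub>E UNIV)"
        by (intro image_eqI[where x = "restrict f {..<j}"]) simp_all
    qed
  qed blast
  moreover have "inj_on (\<lambda>f. rd (dec f)) ({..<j} \<rightarrow>\<^sub>E (UNIV :: bit set))"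
  proof (rule inj_onI)
    fix f g assume f: "f \<in> {..<j} \<rightarrow>\<^sub>E (UNIV :: bit set)" and g: "g \<in> {..<j} \<rightarrow>\<^sub>E (UNIV :: bit set)"
      and "rd (dec f) = rd (dec g)"
    hence "\<forall>l<j. f l = g l" by (simp only: rd_dec)
    thus "f = g" by (intro PiE_ext[OF f g]) simp
  qed
  ultimately have "card (range rd) = card ({..<j} \<rightarrow>\<^sub>E (UNIV :: bit set))" by (simp add: card_image)
  thus ?thesis by (simp add: card_PiE card_UNIV_bit)
qed

text \<open>The last summand of the exponent is the central rank. In the rest,
  \<open>2 * e * j\<close> belongs to \<open>u\<close> and \<open>w\<close>, \<open>q\<close> to the
  rotations and 1 to the reflection.\<close>

lemma order_Er: "order Er = 2 ^ ((2 * e * j + q + 1) + e * e * j)"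
proof -
  let ?R = "range rd"
  let ?C = "({..<e} \<rightarrow>\<^sub>E ?R) \<times> ({..<e} \<rightarrow>\<^sub>E ?R) \<times> ({..<e} \<times> {..<e} \<rightarrow>\<^sub>E ?R) \<times> {0..<2 ^ q :: int} \<times> (UNIV :: bool set)"
  have rdR: "rd r = r" if "r \<in> ?R" for r using that rd_rd by auto
  have eqR1: "(\<lambda>i\<in>I. rd (f i)) = f" if "f \<in> I \<rightarrow>\<^sub>E ?R" for f and I :: "nat set"
  proof -
    have "(\<lambda>i\<in>I. rd (f i)) = restrict f I" by (rule restrict_ext) (rule rdR[OF PiE_mem[OF that]])
    thus ?thesis using PiE_restrict[OF that] by simp
  qed
  have eqR2: "(\<lambda>i\<in>I. rd (f i)) = f" if "f \<in> I \<rightarrow>\<^sub>E ?R" for f and I :: "(nat \<times> nat) set"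
  proof -
    have "(\<lambda>i\<in>I. rd (f i)) = restrict f I" by (rule restrict_ext) (rule rdR[OF PiE_mem[OF that]])
    thus ?thesis using PiE_restrict[OF that] by simp
  qed
  have "range red = ?C"
  proof
    show "range red \<subseteq> ?C"
    proof
      fix g assume "g \<in> range red"
      then obtain u w z n b where g: "g = red (u, w, z, n, b)" by (metis imageE prod_cases5)
      show "g \<in> ?C" unfolding g red_def prod.case mem_Sigma_iff restrict_PiE_iff by simp
    qed
    show "?C \<subseteq> range red"
    proof
      fix g assume g: "g \<in> ?C"
      obtain u w z n b where g': "g = (u, w, z, n, b)" by (metis prod_cases5)
      have u: "u \<in> {..<e} \<rightarrow>\<^sub>E ?R" and w: "w \<in> {..<e} \<rightarrow>\<^sub>E ?R" and z: "z \<in> {..<e} \<times> {..<e} \<rightarrow>\<^sub>E ?R"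
        and n: "n \<in> {0..<2 ^ q}" using g by (simp_all only: g' mem_Sigma_iff)
      have "0 \<le> n" "n < 2 ^ q" using n by auto
      hence "n mod 2 ^ q = n" by (rule mod_pos_pos_trivial)
      hence "g = red g" unfolding g' red_def prod.case
        by (simp add: eqR1[OF u] eqR1[OF w] eqR2[OF z])
      thus "g \<in> range red" by (rule range_eqI)
    qed
  qed
  hence "order Er = card ?C" by (simp add: order_def Er_def)
  also have "\<dots> = (2 ^ j) ^ e * ((2 ^ j) ^ e * ((2 ^ j) ^ (e * e) * (2 ^ q * 2)))"
    by (simp add: card_cartesian_product card_PiE card_range_rd nat_power_eq)
  also have "\<dots> = 2 ^ ((2 * e * j + q + 1) + e * e * j)"
    by (simp add: algebra_simps flip: power_mult power_add power_Suc)
  finally show ?thesis .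
qed

definition \<Phi> :: "((nat \<times> nat) \<times> nat \<Rightarrow> bit) \<Rightarrow> 'k dh" where
  "\<Phi> \<phi> = red (P (\<lambda>_. 0) (\<lambda>_. 0) (\<lambda>p. dec (\<lambda>l. \<phi> (p, l))))"

lemma range_\<Phi>D:
  assumes "red (u, w, z, n, b) \<in> range \<Phi>"
  shows "\<not> b" "n mod 2 ^ q = 0" "\<And>i. i < e \<Longrightarrow> rd (u i) = rd 0"
  using assms unfolding \<Phi>_def image_iff red_eq_iff by auto

lemma red_mul: "red g \<otimes>\<^bsub>Er\<^esub> red h = red (mul g h)"
  using hom_mult[OF red_hom, of g h] by simp

text \<open>Keeps the generators distinct in the central quotients. Two reflections multiply to
  \<open>t\<close> or its inverse, nontrivial since \<open>2 ^ q \<ge> 2\<close>; a reflection times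
  a unit vector is no rotation; two unit vectors leave a nonzero coordinate of
  \<open>u\<close>.\<close>

lemma gens_product_notin:
  assumes "g \<in> gens" "h \<in> gens" "g \<noteq> h"
  shows "red (mul g h) \<notin> range \<Phi>"
proof
  assume r: "red (mul g h) \<in> range \<Phi>"
  have "int 2 \<le> int (2 ^ q)" using N by (simp only: of_nat_le_iff)
  hence q: "(2::int) ^ q \<ge> 2" by simp
  let ?D = "\<lambda>n. (\<lambda>_. 0, \<lambda>_. 0, \<lambda>_. 0, n, True) :: 'k dh"
  let ?a = "\<lambda>i. P (\<delta> i 1) (\<lambda>_. 0) (\<lambda>_. 0)"
  have form: "(\<exists>n\<in>{0, 1}. g = ?D n) \<or> (\<exists>i<e. g = ?a i)" if "g \<in> gens" for g
    using that unfolding gens_def by blast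
  consider n n' where "g = ?D n" "h = ?D n'" "n \<in> {0, 1}" "n' \<in> {0, 1}"
    | n i where "g = ?D n" "h = ?a i" | n i where "g = ?a i" "h = ?D n"
    | i l where "g = ?a i" "h = ?a l" "i < e"
    using form[OF assms(1)] form[OF assms(2)] by blast
  thus False
  proof cases
    case 1
    have "n \<noteq> n'" using assms(3) unfolding 1 by blast
    hence nn: "n - n' = 1 \<or> n - n' = -1" using 1(3,4) by auto
    have "(n - n') mod 2 ^ q = 0" using range_\<Phi>D(2)[OF r[unfolded 1(1,2) mul.simps]] by simp
    hence "(2::int) ^ q dvd n - n'" by (rule dvd_eq_mod_eq_0[THEN iffD2])
    hence "(2::int) ^ q dvd 1" using nn by auto
    thus False using q zdvd_imp_le by fastforce
  next
    case 2
    thus False using range_\<Phi>D(1)[OF r[unfolded 2(1,2) mul.simps]] by simp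
  next
    case 3
    thus False using range_\<Phi>D(1)[OF r[unfolded 3(1,2) mul.simps]] by simp
  next
    case 4
    have "i \<noteq> l" using assms(3) unfolding 4 by blast
    thus False using range_\<Phi>D(3)[OF r[unfolded 4(1,2) mul.simps] 4(3)] rd_01 by (simp add: \<delta>_def)
  qed
qed

lemma gens_notin:
  assumes "g \<in> gens"
  shows "red g \<notin> range \<Phi>"
proof
  assume r: "red g \<in> range \<Phi>"
  consider n where "g = (\<lambda>_. 0, \<lambda>_. 0, \<lambda>_. 0, n, True)" | i where "g = P (\<delta> i 1) (\<lambda>_. 0) (\<lambda>_. 0)" "i < e"
    using assms by (auto simp: gens_def)
  thus False
  proof cases
    case 1
    show False using range_\<Phi>D(1)[OF r[unfolded 1]] by simp
  next
    case 2
    show False using range_\<Phi>D(3)[OF r[unfolded 2] 2(2)] rd_01 by (simp add: \<delta>_def)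
  qed
qed

lemma gens_square:
  assumes "g \<in> gens"
  shows "mul g g = \<one>\<^bsub>Dh\<^esub>"
proof -
  have "\<beta> (\<delta> i 1) (\<lambda>_. 0) (\<delta> i 1) (\<lambda>_. 0) = (\<lambda>_. 0)" for i by (auto simp: \<beta>_def \<delta>_def fun_eq_iff)
  hence "mul (P (\<delta> i 1) (\<lambda>_. 0) (\<lambda>_. 0)) (P (\<delta> i 1) (\<lambda>_. 0) (\<lambda>_. 0)) = \<one>\<^bsub>Dh\<^esub>" for i
    unfolding P_mul \<delta>_add by (simp add: char2 one_Dh)
  thus ?thesis using assms by (auto simp: gens_def one_Dh cong: if_cong)
qed

lemma \<Phi>_add: "\<Phi> (\<lambda>i. \<phi> i + \<psi> i) = \<Phi> \<phi> \<otimes>\<^bsub>Er\<^esub> \<Phi> \<psi>"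
  unfolding \<Phi>_def red_mul P_mul \<beta>_0 dec_add by simp

lemma \<Phi>_eq_iff: "\<Phi> \<phi> = \<Phi> \<psi> \<longleftrightarrow> (\<forall>i\<in>({..<e} \<times> {..<e}) \<times> {..<j}. \<phi> i = \<psi> i)"
  unfolding \<Phi>_def red_eq_iff rd_dec by auto

lemma \<Phi>_central: "\<Phi> \<phi> \<otimes>\<^bsub>Er\<^esub> g = g \<otimes>\<^bsub>Er\<^esub> \<Phi> \<phi>" if g: "g \<in> carrier Er"
proof -
  obtain h where h: "g = red h" using g by (auto simp: Er_def)
  obtain u w z n b where h': "h = (u, w, z, n, b)" by (metis prod_cases5)
  have "mul (P (\<lambda>_. 0) (\<lambda>_. 0) v) h = mul h (P (\<lambda>_. 0) (\<lambda>_. 0) v)" for v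
    by (simp add: h' add.commute cong: if_cong)
  thus ?thesis unfolding \<Phi>_def h red_mul by simp
qed

lemma num_involution_groups_ge:
  assumes "v \<le> e * e * j"
  shows "2 ^ (v * (e * e * j - v)) \<le> num_involution_groups (e + 2) (2 * e * j + q + 1 + v) *
    (2 ^ (2 * e * j + q + 1 + v)) ^ (e + 2)"
proof -
  interpret Er: group Er by (rule group_Er)
  interpret r: group_hom Dh Er red by (rule group_hom_red)
  have cE: "carrier Er = range red" by (simp only: Er_def partial_object.select_convs)
  have sq: "red g \<otimes>\<^bsub>Er\<^esub> red g = \<one>\<^bsub>Er\<^esub>" if "g \<in> gens" for g
    unfolding red_mul gens_square[OF that] by (rule r.hom_one)
  have one: "\<one>\<^bsub>Er\<^esub> \<in> range \<Phi>"
  proof -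
    have z: "dec (\<lambda>_. 0) = 0" using dec_add[of "\<lambda>_. 0" "\<lambda>_. 0"] by simp
    have "\<Phi> (\<lambda>_. 0) = \<one>\<^bsub>Er\<^esub>" unfolding \<Phi>_def z using r.hom_one by (simp only: one_Dh)
    thus ?thesis by (metis rangeI)
  qed
  have inj: "inj_on red gens"
  proof (rule inj_onI, rule ccontr)
    fix g h assume gh: "g \<in> gens" "h \<in> gens" "red g = red h" "g \<noteq> h"
    have "red (mul g h) = \<one>\<^bsub>Er\<^esub>" using sq[OF gh(1)] gh(3) by (simp flip: red_mul)
    thus False using gens_product_notin[OF gh(1,2,4)] one by simp
  qed
  have "card gens = e + 2"
  proof -
    have ne: "(0::'k) \<noteq> 1" using rd_01 by auto
    have "inj_on (\<lambda>i. P (\<delta> i 1) (\<lambda>_. 0) (\<lambda>_. 0)) {..<e}"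
      using ne by (auto simp: inj_on_def \<delta>_def fun_eq_iff)
    hence c: "card ((\<lambda>i. P (\<delta> i 1) (\<lambda>_. 0) (\<lambda>_. 0)) ` {..<e}) = e" by (simp add: card_image)
    show ?thesis unfolding gens_def by (subst card_Un_disjoint) (auto simp: c)
  qed
  hence cX: "card (red ` gens) = e + 2" using card_image[OF inj] by simp
  have "2 ^ (v * (e * e * j - v)) \<le> num_involution_groups (card (red ` gens)) (2 * e * j + q + 1 + v) *
    (2 ^ (2 * e * j + q + 1 + v)) ^ card (red ` gens)"
  proof (rule Er.central_extension_count[OF order_Er _ _ generate_Er])
    show "finite (red ` gens)" by (simp add: gens_def)
    show "red ` gens \<subseteq> carrier Er" unfolding cE by (rule image_mono) simp
    show "x \<otimes>\<^bsub>Er\<^esub> x = \<one>\<^bsub>Er\<^esub>" if "x \<in> red ` gens" for x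
      using that by (elim imageE) (simp only: sq)
    show "finite (({..<e} \<times> {..<e}) \<times> {..<j})" by simp
    show "card (({..<e} \<times> {..<e}) \<times> {..<j}) = e * e * j" by (simp add: card_cartesian_product)
    show "\<Phi> \<phi> \<in> carrier Er" for \<phi> unfolding cE \<Phi>_def by (rule rangeI)
    show "x \<notin> range \<Phi>" if "x \<in> red ` gens" for x
      using that by (elim imageE) (simp only: gens_notin not_False_eq_True)
    show "x \<otimes>\<^bsub>Er\<^esub> y \<notin> range \<Phi>" if "x \<in> red ` gens" "y \<in> red ` gens" "x \<noteq> y" for x y
    proof -
      from that(1) obtain g where g: "g \<in> gens" "x = red g" by (elim imageE)
      from that(2) obtain h where h: "h \<in> gens" "y = red h" by (elim imageE)
      have "g \<noteq> h" using that(3) g h by blast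
      thus ?thesis unfolding g h red_mul by (rule gens_product_notin[OF g(1) h(1)])
    qed
    show "\<Phi> (\<lambda>i. \<phi> i + \<psi> i) = \<Phi> \<phi> \<otimes>\<^bsub>Er\<^esub> \<Phi> \<psi>" for \<phi> \<psi> by (rule \<Phi>_add)
    show "\<Phi> \<phi> \<otimes>\<^bsub>Er\<^esub> g = g \<otimes>\<^bsub>Er\<^esub> \<Phi> \<phi>" if "g \<in> carrier Er" for \<phi> g by (rule \<Phi>_central[OF that])
    show "\<Phi> \<phi> = \<Phi> \<psi> \<longleftrightarrow> (\<forall>i\<in>({..<e} \<times> {..<e}) \<times> {..<j}. \<phi> i = \<psi> i)" for \<phi> \<psi> by (rule \<Phi>_eq_iff)
    show "v \<le> e * e * j" by fact
  qed
  thus ?thesis by (simp only: cX)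
qed

end

section \<open>Truncated power series over the two-element field\<close>

lemma bit_add_self: "a + a = (0::bit)"
  by (cases a) simp_all

lemma bit_fps_add_self: "p + p = (0 :: bit fps)"
  by (rule fps_ext) (simp only: fps_add_nth bit_add_self fps_zero_nth)

text \<open>Squaring is additive in characteristic 2. Since \<open>fps_X ^ (2 ^ q)\<close> is cut
  off when \<open>j \<le> 2 ^ q\<close>, a logarithmic \<open>q\<close> makes
  \<open>1 + fps_X\<close> periodic after truncation.\<close>

lemma bit_fps_X_power: "(1 + fps_X) ^ (2 ^ q) = (1 + fps_X ^ (2 ^ q) :: bit fps)"
proof (induction q)
  case (Suc q)
  let ?y = "fps_X ^ (2 ^ q) :: bit fps"
  have "(1 + fps_X :: bit fps) ^ (2 ^ Suc q) = ((1 + fps_X) ^ (2 ^ q)) ^ 2"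
    by (simp only: power_Suc power_mult[symmetric] mult.commute)
  also have "\<dots> = (1 + ?y) ^ 2" by (simp only: Suc)
  also have "\<dots> = 1 + (?y + ?y) + ?y ^ 2" by (simp add: power2_eq_square algebra_simps)
  also have "\<dots> = 1 + fps_X ^ (2 ^ Suc q)"
    by (simp only: bit_fps_add_self add_0_right power_mult[symmetric] power_Suc mult.commute)
  finally show ?case .
qed simp

text \<open>\<open>bar\<close> substitutes \<open>fps_X * inverse (1 + fps_X)\<close> for
  \<open>fps_X\<close>. In characteristic 2 this series plus one is the inverse of
  \<open>1 + fps_X\<close>, so \<open>t\<close> is inverted; its zero constant term makes the
  substitution multiplicative.\<close>

lemma dihedral_heisenberg_fps:
  assumes j: "1 \<le> j" "j \<le> 2 ^ q" and q: "1 \<le> q"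
  shows "dihedral_heisenberg_bits (1 + fps_X) (inverse (1 + fps_X))
    (\<lambda>p. fps_compose p (fps_X * inverse (1 + fps_X))) (fps_cutoff j) q Abs_fps j"
proof -
  let ?t = "1 + fps_X :: bit fps" and ?h = "fps_X * inverse (1 + fps_X) :: bit fps"
  have t0: "fps_nth ?t 0 \<noteq> 0" by simp
  have h0: "fps_nth ?h 0 = 0" by simp
  have ts: "?t * inverse ?t = 1" using inverse_mult_eq_1[OF t0] by (simp only: mult.commute)
  have "?t * (1 + ?h) = ?t + fps_X * (?t * inverse ?t)"
    by (simp only: distrib_left mult_1_right mult_ac)
  also have "\<dots> = 1 + (fps_X + fps_X)" by (simp only: ts mult_1_right add.assoc)
  also have "\<dots> = 1" by (simp only: bit_fps_add_self add_0_right)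
  finally have "inverse ?t * (?t * (1 + ?h)) = inverse ?t" by simp
  hence sh: "1 + ?h = inverse ?t" using ts
    by (simp only: mult.assoc[symmetric] mult.commute[of "inverse ?t" ?t] mult_1)
  show ?thesis
  proof
    show "p + p = 0" for p :: "bit fps" by (rule bit_fps_add_self)
    show "?t * inverse ?t = 1" by (rule ts)
    show "(x + y) oo ?h = (x oo ?h) + (y oo ?h)" for x y by (rule fps_compose_add_distrib)
    show "(x * y) oo ?h = (x oo ?h) * (y oo ?h)" for x y by (rule fps_compose_mult_distrib[OF h0])
    show "1 oo ?h = 1" by (rule fps_compose_1)
    show "?t oo ?h = inverse ?t"
      by (simp only: fps_compose_add_distrib fps_compose_1 fps_X_fps_compose_startby0[OF h0] sh)
    show "fps_cutoff j (fps_cutoff j x) = fps_cutoff j x" for x :: "bit fps"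
      by (simp add: fps_eq_iff)
    show "fps_cutoff j (a + c) = fps_cutoff j (a' + c')"
      if "fps_cutoff j a = fps_cutoff j a'" "fps_cutoff j c = fps_cutoff j c'" for a a' c c' :: "bit fps"
      using that by (simp only: fps_cutoff_add)
    show "fps_cutoff j (a * c) = fps_cutoff j (a' * c')"
      if "fps_cutoff j a = fps_cutoff j a'" "fps_cutoff j c = fps_cutoff j c'" for a a' c c' :: "bit fps"
      unfolding fps_cutoff_eq_fps_cutoff_iff fps_mult_nth
    proof (intro allI impI sum.cong refl)
      fix k i assume "k < j" "i \<in> {0..k}"
      hence "fps_nth a i = fps_nth a' i" "fps_nth c (k - i) = fps_nth c' (k - i)"
        using that unfolding fps_cutoff_eq_fps_cutoff_iff by auto
      thus "fps_nth a i * fps_nth c (k - i) = fps_nth a' i * fps_nth c' (k - i)" by (simp only:)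
    qed
    show "fps_cutoff j (a oo ?h) = fps_cutoff j (a' oo ?h)"
      if "fps_cutoff j a = fps_cutoff j a'" for a a' :: "bit fps"
      unfolding fps_cutoff_eq_fps_cutoff_iff fps_compose_nth
    proof (intro allI impI sum.cong refl)
      fix k i assume "k < j" "i \<in> {0..k}"
      hence "fps_nth a i = fps_nth a' i"
        using that unfolding fps_cutoff_eq_fps_cutoff_iff by auto
      thus "fps_nth a i * fps_nth (?h ^ i) k = fps_nth a' i * fps_nth (?h ^ i) k" by (simp only:)
    qed
    show "fps_cutoff j (?t ^ 2 ^ q) = fps_cutoff j 1"
      unfolding bit_fps_X_power fps_cutoff_eq_fps_cutoff_iff using j by simp
    have "(2::nat) ^ 1 \<le> 2 ^ q" using q by (intro power_increasing) auto
    thus "2 \<le> (2::nat) ^ q" by simp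
    show "fps_cutoff j 0 \<noteq> fps_cutoff j (1 :: bit fps)"
      unfolding fps_cutoff_eq_fps_cutoff_iff using j by (auto intro!: exI[of _ 0])
    show "\<exists>p\<in>S. fps_cutoff j p = fps_cutoff j a"
      if S: "1 \<in> S" "\<And>p q. p \<in> S \<Longrightarrow> q \<in> S \<Longrightarrow> p + q \<in> S" "\<And>p. p \<in> S \<Longrightarrow> ?t * p \<in> S" for S and a :: "bit fps"
    proof -
      have S0: "0 \<in> S" using S(2)[OF S(1) S(1)] by (simp only: bit_fps_add_self)
      \<comment> \<open>Multiplication by \<open>fps_X\<close> is \<open>?t * p + p\<close> in
        characteristic 2, so \<open>S\<close> contains all monomials and hence all truncations of
        \<open>a\<close>.\<close>
      have SX: "fps_X * p \<in> S" if "p \<in> S" for p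
      proof -
        have "?t * p + p = fps_X * p + (p + p)" by (simp only: distrib_right mult_1 add_ac)
        also have "\<dots> = fps_X * p" by (simp only: bit_fps_add_self add_0_right)
        finally show ?thesis using S(2)[OF S(3)[OF that] that] by simp
      qed
      have Xn: "fps_X ^ n \<in> S" for n
        by (induction n) (use S(1) SX in simp_all)
      have "fps_cutoff n a \<in> S" for n
      proof (induction n)
        case 0
        thus ?case using S0 by simp
      next
        case (Suc n)
        show ?case
        proof (cases "fps_nth a n = 0")
          case True
          have "fps_cutoff (Suc n) a = fps_cutoff n a"
            by (rule fps_ext) (use True in \<open>auto simp: less_Suc_eq\<close>)
          thus ?thesis using Suc by simp
        next
          case False
          hence "fps_nth a n = 1" by simp
          hence "fps_cutoff (Suc n) a = fps_cutoff n a + fps_X ^ n"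
            by (intro fps_ext) (auto simp: less_Suc_eq fps_X_power_nth)
          thus ?thesis using S(2)[OF Suc Xn] by simp
        qed
      qed
      thus ?thesis by (intro bexI[of _ "fps_cutoff j a"]) (simp_all add: fps_eq_iff)
    qed
    show "Abs_fps (\<lambda>l. f l + g l) = Abs_fps f + Abs_fps g" for f g :: "nat \<Rightarrow> bit"
      by (rule fps_ext) (simp only: fps_add_nth fps_nth_Abs_fps)
    show "fps_cutoff j (Abs_fps f) = fps_cutoff j (Abs_fps g) \<longleftrightarrow> (\<forall>l<j. f l = g l)" for f g :: "nat \<Rightarrow> bit"
      unfolding fps_cutoff_eq_fps_cutoff_iff by simp
    show "\<exists>f. Abs_fps f = a" for a :: "bit fps" by (rule exI[of _ "fps_nth a"]) (rule fps_ext, simp)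
  qed
qed

lemma num_involution_groups_ge_fps:
  assumes "1 \<le> j" "j \<le> 2 ^ q" "1 \<le> q" "v \<le> e * e * j" "m = 2 * e * j + q + 1 + v"
  shows "2 ^ (v * (e * e * j - v)) \<le> num_involution_groups (e + 2) m * 2 ^ (m * (e + 2))"
  using dihedral_heisenberg_bits.num_involution_groups_ge[OF dihedral_heisenberg_fps[OF assms(1-3)] assms(4)]
  unfolding assms(5) power_mult .

section \<open>Asymptotics of the exponents\<close>

text \<open>Up to lower order terms \<open>v * w\<close> is (m - 2ej)(e(e+2)j - m), a parabola in j
  with roots m/(2e) and m/(e(e+2)); \<open>c * m\<close> is their midpoint. There v is about
  em/(2(e+2)) and w about em/4, with product e^2 m^2/(8(e+2)). The loss
  \<open>real m * real d\<close> from isomorphic quotients is only linear.\<close>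

lemma lower_exponent_asymptotics:
  fixes e d :: nat
  assumes e: "e \<ge> 1" and d: "d = e + 2"
  defines "c \<equiv> (real e + 4) / (4 * real e * (real e + 2))"
  defines "j \<equiv> \<lambda>m::nat. nat \<lfloor>c * real m\<rfloor>" and "q \<equiv> \<lambda>m::nat. nat \<lceil>log 2 (real m + 2)\<rceil>"
  defines "v \<equiv> \<lambda>m::nat. real m - 2 * real e * real (j m) - real (q m) - 1"
    and "w \<equiv> \<lambda>m::nat. real e * real e * real (j m) - (real m - 2 * real e * real (j m) - real (q m) - 1)"
  shows "\<forall>\<^sub>F m in sequentially. 1 \<le> j m \<and> j m \<le> 2 ^ q m \<and> 1 \<le> q m \<and> 0 \<le> v m \<and> 0 \<le> w m"
    and "(\<lambda>m. v m * w m - real m * real d - (real d - 2) ^ 2 / (8 * real d) * real m ^ 2) \<in> o(\<lambda>m. real m ^ 2)"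
proof -
  have e0: "real e > 0" using e by simp
  have e2: "real e + 2 \<noteq> 0" using e0 by linarith
  have ec: "real e * c = (real e + 4) / (4 * (real e + 2))" unfolding c_def using e0 by simp
  have c0: "c > 0" using e0 by (simp add: c_def)
  \<comment> \<open>Gives \<open>j m \<le> m\<close>, so that the rounded logarithm
    \<open>q m\<close> satisfies \<open>j m \<le> 2 ^ q m\<close>.\<close>
  have c1: "c \<le> 1"
  proof -
    have "real e \<ge> 1" "real e * real e \<ge> 0" using e by simp_all
    hence "real e + 4 \<le> 4 * (real e * real e) + 8 * real e" by linarith
    also have "\<dots> = 4 * real e * (real e + 2)" by (simp add: algebra_simps)
    finally have "real e + 4 \<le> 4 * real e * (real e + 2)" .
    thus ?thesis unfolding c_def using e0 by (subst divide_le_eq_1) auto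
  qed
  have jr: "c * real m - 1 \<le> real (j m)" "real (j m) \<le> c * real m" for m
    using c0 unfolding j_def by simp_all
  have qr: "log 2 (real m + 2) \<le> real (q m)" "real (q m) \<le> log 2 (real m + 2) + 1" for m
  proof -
    have "0 \<le> log 2 (real m + 2)" by simp
    thus "log 2 (real m + 2) \<le> real (q m)" "real (q m) \<le> log 2 (real m + 2) + 1"
      unfolding q_def by linarith+
  qed
  have jlim: "(\<lambda>m. real (j m) / real m) \<longlonglongrightarrow> c"
  proof (rule tendsto_sandwich)
    show "\<forall>\<^sub>F m in sequentially. c - 1 / real m \<le> real (j m) / real m"
      using eventually_gt_at_top[of 0]
    proof eventually_elim
      case (elim m)
      have "c - 1 / real m = (c * real m - 1) / real m" using elim by (simp add: field_simps)
      thus ?case using jr(1)[of m] elim by (simp add: divide_right_mono)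
    qed
    show "\<forall>\<^sub>F m in sequentially. real (j m) / real m \<le> c"
      using eventually_gt_at_top[of 0]
    proof eventually_elim
      case (elim m)
      thus ?case using jr(2)[of m] by (simp add: divide_le_eq)
    qed
    show "(\<lambda>m. c - 1 / real m) \<longlonglongrightarrow> c" by real_asymp
  qed simp
  have qlim: "(\<lambda>m. real (q m) / real m) \<longlonglongrightarrow> 0"
  proof (rule tendsto_sandwich)
    show "\<forall>\<^sub>F m in sequentially. 0 \<le> real (q m) / real m" by simp
    show "\<forall>\<^sub>F m in sequentially. real (q m) / real m \<le> (log 2 (real m + 2) + 1) / real m"
      using qr(2) by (intro always_eventually allI divide_right_mono) auto
    show "(\<lambda>m. (log 2 (real m + 2) + 1) / real m) \<longlonglongrightarrow> 0" by real_asymp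
  qed simp
  have onelim: "(\<lambda>m. 1 / real m) \<longlonglongrightarrow> 0" by real_asymp
  have "(\<lambda>m. 1 - 2 * (real e * (real (j m) / real m)) - real (q m) / real m - 1 / real m) \<longlonglongrightarrow> 1 - 2 * (real e * c) - 0 - 0"
    by (intro tendsto_intros jlim qlim onelim)
  moreover have "\<forall>\<^sub>F m in sequentially. 1 - 2 * (real e * (real (j m) / real m)) - real (q m) / real m - 1 / real m = v m / real m"
    using eventually_gt_at_top[of 0] by eventually_elim (simp add: v_def diff_divide_distrib)
  ultimately have "(\<lambda>m. v m / real m) \<longlonglongrightarrow> 1 - 2 * (real e * c) - 0 - 0"
    by (rule Lim_transform_eventually)
  moreover have "1 - 2 * (real e * c) - 0 - 0 = real e / (2 * (real e + 2))"
    unfolding ec using e2 by (simp add: field_simps)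
  ultimately have vlim: "(\<lambda>m. v m / real m) \<longlonglongrightarrow> real e / (2 * (real e + 2))" by simp
  have "(\<lambda>m. real e * (real e * (real (j m) / real m)) - v m / real m) \<longlonglongrightarrow> real e * (real e * c) - real e / (2 * (real e + 2))"
    by (intro tendsto_intros jlim vlim)
  moreover have "(\<lambda>m. real e * (real e * (real (j m) / real m)) - v m / real m) = (\<lambda>m. w m / real m)"
    by (simp add: v_def w_def fun_eq_iff diff_divide_distrib)
  moreover have "real e * (real e * c) - real e / (2 * (real e + 2)) = real e / 4"
  proof -
    have "(x + 2) / (4 * x) - 1 / (2 * x) = 1 / 4" if "x \<noteq> 0" for x :: real
      using that by (simp add: field_simps)
    from this[OF e2] have "(real e + 4) / (4 * (real e + 2)) - 1 / (2 * (real e + 2)) = 1 / 4"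
      by (simp add: add.assoc)
    hence "real e * ((real e + 4) / (4 * (real e + 2)) - 1 / (2 * (real e + 2))) = real e * (1 / 4)"
      by (simp only:)
    thus ?thesis unfolding ec by (simp only: right_diff_distrib times_divide_eq_right mult_1_right)
  qed
  ultimately have wlim: "(\<lambda>m. w m / real m) \<longlonglongrightarrow> real e / 4" by (simp only:)
  have pos: "real e / (2 * (real e + 2)) > 0" "real e / 4 > 0" using e0 by simp_all
  have "\<forall>\<^sub>F m in sequentially. 0 < c * real m - 2" using c0 by real_asymp
  moreover have "\<forall>\<^sub>F m in sequentially. 0 < v m / real m"
    by (rule order_tendstoD(1)[OF vlim pos(1)])
  moreover have "\<forall>\<^sub>F m in sequentially. 0 < w m / real m"
    by (rule order_tendstoD(1)[OF wlim pos(2)])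
  ultimately show "\<forall>\<^sub>F m in sequentially. 1 \<le> j m \<and> j m \<le> 2 ^ q m \<and> 1 \<le> q m \<and> 0 \<le> v m \<and> 0 \<le> w m"
    using eventually_gt_at_top[of 0]
  proof eventually_elim
    case (elim m)
    have "1 \<le> real (j m)" using jr(1)[of m] elim(1) by linarith
    moreover have "real (j m) \<le> 2 ^ q m"
    proof -
      have "real (j m) \<le> real m" using jr(2)[of m] c1 mult_right_mono[of c 1 "real m"] by linarith
      also have "\<dots> \<le> real m + 2" by simp
      also have "\<dots> = 2 powr log 2 (real m + 2)" by simp
      also have "\<dots> \<le> 2 powr real (q m)" by (rule powr_mono[OF qr(1)]) simp
      also have "\<dots> = 2 ^ q m" by (simp add: powr_realpow)
      finally show ?thesis .
    qed
    hence "j m \<le> 2 ^ q m" by (simp flip: of_nat_le_iff)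
    moreover have "1 \<le> real (q m)"
    proof -
      have "log 2 2 \<le> log 2 (real m + 2)" by (subst log_le_cancel_iff) auto
      moreover have "log 2 2 = (1::real)" by simp
      ultimately show ?thesis using qr(1)[of m] by linarith
    qed
    ultimately show ?case using elim by (simp add: zero_less_divide_iff)
  qed
  have "(\<lambda>m. (v m / real m) * (w m / real m) - real d * (1 / real m) - (real d - 2) ^ 2 / (8 * real d)) \<longlonglongrightarrow>
      real e / (2 * (real e + 2)) * (real e / 4) - real d * 0 - (real d - 2) ^ 2 / (8 * real d)"
    by (intro tendsto_intros vlim wlim onelim)
  moreover have "real e / (2 * (real e + 2)) * (real e / 4) - real d * 0 - (real d - 2) ^ 2 / (8 * real d) = 0"
    using e0 by (simp add: d field_simps power2_eq_square)
  ultimately have lim: "(\<lambda>m. (v m / real m) * (w m / real m) - real d * (1 / real m) - (real d - 2) ^ 2 / (8 * real d)) \<longlonglongrightarrow> 0"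
    by simp
  show "(\<lambda>m. v m * w m - real m * real d - (real d - 2) ^ 2 / (8 * real d) * real m ^ 2) \<in> o(\<lambda>m. real m ^ 2)"
  proof (rule smalloI_tendsto)
    have ev: "\<forall>\<^sub>F m in sequentially. (v m / real m) * (w m / real m) - real d * (1 / real m) - (real d - 2) ^ 2 / (8 * real d)
      = (v m * w m - real m * real d - (real d - 2) ^ 2 / (8 * real d) * real m ^ 2) / real m ^ 2"
      using eventually_gt_at_top[of 0]
    proof eventually_elim
      case (elim m)
      thus ?case by (simp add: diff_divide_distrib power2_eq_square)
    qed
    show "(\<lambda>m. (v m * w m - real m * real d - (real d - 2) ^ 2 / (8 * real d) * real m ^ 2) / real m ^ 2) \<longlonglongrightarrow> 0"
      by (rule Lim_transform_eventually[OF lim ev])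
    show "\<forall>\<^sub>F m in sequentially. real m ^ 2 \<noteq> 0" using eventually_gt_at_top[of 0]
      by eventually_elim simp
  qed
qed

lemma upper_exponent_le:
  assumes "d \<ge> 2"
  shows "real (\<Sum>i<m. (d - 2) * i + (d - 1)) \<le> 1 / 2 * (real d - 2) * real m ^ 2 + real d * real m"
proof (induction m)
  case (Suc m)
  have "real (\<Sum>i<Suc m. (d - 2) * i + (d - 1)) \<le> 1 / 2 * (real d - 2) * real m ^ 2 + real d * real m + ((real d - 2) * real m + (real d - 1))"
    using Suc assms by (simp add: of_nat_diff)
  also have "\<dots> \<le> 1 / 2 * (real d - 2) * real (Suc m) ^ 2 + real d * real (Suc m)"
    using assms by (simp add: power2_eq_square field_simps)
  finally show ?case .
qed simp

theorem theorem4p1: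
  fixes d :: nat
  assumes "d \<ge> 3"
  shows "\<exists>\<epsilon> \<delta> :: nat \<Rightarrow> real.
    \<epsilon> \<in> o(\<lambda>m. real m ^ 2) \<and> \<delta> \<in> o(\<lambda>m. real m ^ 2) \<and>
    (\<forall>\<^sub>F m in sequentially.
       2 powr ((real d - 2) ^ 2 / (8 * real d) * real m ^ 2 + \<epsilon> m)
         \<le> real (num_involution_groups d m) \<and>
       real (num_involution_groups d m)
         \<le> 2 powr (1 / 2 * (real d - 2) * real m ^ 2 + \<delta> m))"
proof -
  define e where "e = d - 2"
  have e: "e \<ge> 1" "d = e + 2" using assms by (simp_all add: e_def)
  define j where "j m = nat \<lfloor>(real e + 4) / (4 * real e * (real e + 2)) * real m\<rfloor>" for m :: nat
  define q where "q m = nat \<lceil>log 2 (real m + 2)\<rceil>" for m :: nat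
  define v where "v m = real m - 2 * real e * real (j m) - real (q m) - 1" for m
  define w where "w m = real e * real e * real (j m) - v m" for m
  define \<epsilon> where "\<epsilon> m = v m * w m - real m * real d - (real d - 2) ^ 2 / (8 * real d) * real m ^ 2" for m
  \<comment> \<open>The final 1 absorbs the factor 2 that arises from bounding both summands of the
    upper bound by the larger one.\<close>
  define \<delta> where "\<delta> m = real d * real m + 1" for m
  note asym = lower_exponent_asymptotics[OF e, folded j_def q_def, folded v_def, folded w_def, folded \<epsilon>_def]
  have "\<epsilon> \<in> o(\<lambda>m. real m ^ 2)" using asym(2) by (simp add: \<epsilon>_def[abs_def])
  moreover have "\<delta> \<in> o(\<lambda>m. real m ^ 2)" unfolding \<delta>_def by real_asymp
  moreover have "\<forall>\<^sub>F m in sequentially.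
       2 powr ((real d - 2) ^ 2 / (8 * real d) * real m ^ 2 + \<epsilon> m) \<le> real (num_involution_groups d m) \<and>
       real (num_involution_groups d m) \<le> 2 powr (1 / 2 * (real d - 2) * real m ^ 2 + \<delta> m)"
    using asym(1) eventually_ge_at_top[of 1]
  proof eventually_elim
    case (elim m)
    let ?g = "num_involution_groups d m"
    let ?S = "\<lambda>k. \<Sum>i<k. (d - 2) * i + (d - 1)"
    \<comment> \<open>The value \<open>v m\<close> as a natural number, the central rank kept in the
      quotients. Since \<open>v m\<close> and \<open>w m\<close> are not negative, no subtraction of
      naturals is cut off.\<close>
    define n where "n = m - (2 * e * j m + q m + 1)"
    have "real (2 * e * j m + q m + 1) \<le> real m" using elim by (simp add: v_def)
    hence m: "2 * e * j m + q m + 1 \<le> m" by (simp only: of_nat_le_iff)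
    hence n: "m = 2 * e * j m + q m + 1 + n" by (simp add: n_def)
    have vn: "v m = real n" using m by (simp add: v_def n_def of_nat_diff)
    have "real n \<le> real (e * e * j m)" using elim vn by (simp add: w_def)
    hence ne: "n \<le> e * e * j m" by (simp only: of_nat_le_iff)
    have wn: "w m = real (e * e * j m - n)" using ne vn by (simp add: w_def of_nat_diff)
    have "2 ^ (n * (e * e * j m - n)) \<le> ?g * 2 ^ (m * d)"
      unfolding e(2) by (rule num_involution_groups_ge_fps[OF _ _ _ ne n]) (use elim in auto)
    hence "real (2 ^ (n * (e * e * j m - n))) \<le> real (?g * 2 ^ (m * d))"
      by (simp only: of_nat_le_iff)
    hence "2 ^ (n * (e * e * j m - n)) \<le> real ?g * 2 ^ (m * d)"
      by (simp only: of_nat_mult of_nat_power of_nat_numeral)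
    moreover have "2 powr (v m * w m) = 2 ^ (n * (e * e * j m - n))"
      unfolding vn wn of_nat_mult[symmetric] by (rule powr_realpow) simp
    moreover have "2 powr (real m * real d) = 2 ^ (m * d)"
      unfolding of_nat_mult[symmetric] by (rule powr_realpow) simp
    ultimately have "2 powr (v m * w m) \<le> real ?g * 2 powr (real m * real d)" by (simp only:)
    hence "2 powr (v m * w m - real m * real d) \<le> real ?g"
      by (simp add: powr_diff divide_le_eq)
    hence lower: "2 powr ((real d - 2) ^ 2 / (8 * real d) * real m ^ 2 + \<epsilon> m) \<le> real ?g"
      by (simp add: \<epsilon>_def)
    have "?S (m - 1) \<le> ?S m" by (rule sum_mono2) auto
    hence "(2::nat) ^ ?S (m - 1) \<le> 2 ^ ?S m" by (rule power_increasing) simp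
    hence "?g \<le> 2 * 2 ^ ?S m" using num_involution_groups_le[of d m] assms elim by linarith
    hence "?g \<le> 2 ^ (?S m + 1)" by simp
    hence "real ?g \<le> real (2 ^ (?S m + 1))" by (simp only: of_nat_le_iff)
    also have "\<dots> = 2 powr (real (?S m) + 1)"
      by (simp only: of_nat_power of_nat_numeral powr_realpow[symmetric] zero_less_numeral of_nat_add of_nat_1)
    also have "\<dots> \<le> 2 powr (1 / 2 * (real d - 2) * real m ^ 2 + \<delta> m)"
      using upper_exponent_le[of d m] assms by (intro powr_mono) (simp_all add: \<delta>_def)
    finally show ?case using lower by blast
  qed
  ultimately show ?thesis by blast
qed

end
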